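(* Let $A\in\mathbb{R}^{n,n}$ be a Hurwitz matrix ($sI_n-A$ nonsingular for $\mathrm{Re}(s)\ge0$), $B_1\in\mathbb{R}^{n,k}$, $B_2\in\mathbb{R}^{n,q}$, $Q=Q'\in\mathbb{R}^{n+k+q,n+k+q}$, $X_0\subset\mathbb{R}^n$, and $\sigma(x,v,w)=[x;v;w]'Q[x;v;w]$. Let $\Delta\subset L_k\times L_q$ be a weakly causally stable system which satisfies the conditional IQC defined by $A,B_1,B_2,Q,X_0$. Assume: (a) with $B=[B_1,B_2]$ and $\Pi(s)=[(sI_n-A)^{-1}B;\,I_{k+q}]'Q[(sI_n-A)^{-1}B;\,I_{k+q}]$ partitioned as $\begin{bmatrix}\Pi_{11}&\Pi_{12}\\ \Pi_{21}&\Pi_{22}\end{bmatrix}$ with $\Pi_{11}(s)\in\mathbb{C}^{k,k}$, $\Pi_{22}(s)\in\mathbb{C}^{q,q}$, there exist $\epsilon>0$ and $s_0\in j\mathbb{R}$ such that $\begin{bmatrix}\Pi_{11}(s)&\epsilon\Pi_{12}(s)\\ \epsilon\Pi_{21}(s)&-\Pi_{22}(s)\end{bmatrix}\ge0$ for all $s\in j\mathbb{R}$, $\Pi_{11}(s_0)>0$ and $\Pi_{22}(s_0)<0$; (b) there exist real matrices $C\in\mathbb{R}^{k,n}$, $D_1\in\mathbb{R}^{k,k}$, $D_2\in\mathbb{R}^{k,q}$ such that $\sigma(x,v,w)\le|Cx+D_1v+D_2w|^2$ for all $x\in\mathbb{R}^n,v\in\mathbb{R}^k,w\in\mathbb{R}^q$,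 and $\det\begin{bmatrix}A-sI&B_1\\ C&D_1\end{bmatrix}\ne0$ for all $s\in\mathbb{C}$ with $\mathrm{Re}(s)>0$. Then $\Delta$ satisfies the complete IQC defined by $A,B_1,B_2,Q,X_0$.
   Context: $j\mathbb{R}=\{s:\mathrm{Re}(s)=0\}$. $L_m$ is the set of locally square integrable $u:[0,\infty)\to\mathbb{R}^m$, and $L^2_m\subset L_m$ those with $\|u\|^2=\int_0^\infty|u(t)|^2dt<\infty$. For $x_0\in\mathbb{R}^n$, $v\in L_k$, $w\in L_q$, "$x$ satisfies $\dot x=Ax+B_1v+B_2w$, $x(0)=x_0$" means $x(t)=x_0+\int_0^t[Ax(\tau)+B_1v(\tau)+B_2w(\tau)]d\tau$ for $t\ge0$. A system $\Delta\subset L_k\times L_q$ is weakly causally stable if for every $T\ge0$, $(v,w)\in\Delta$ and $v_*\in L^2_k$ with $v(t)=v_*(t)$ for all $t\le T$, there is a sequence $(v_i,w_i)\in\Delta\cap(L^2_k\times L^2_q)$ with $v_i(t)=v(t)$, $w_i(t)=w(t)$ for $t\le T$ and $\|v_i-v_*\|\to0$. $\Delta$ satisfies the conditional IQC defined by $A,B_1,B_2,Q,X_0$ if there is a continuous $\kappa:\mathbb{R}^n\times\mathbb{R}^k\times\mathbb{R}^q\to\mathbb{R}$ such that $\int_0^\infty\sigma(x(t),v(t),w(t))dt\ge-\kappa(x_0,v(0),w(0))$ for all $(v,w)\in\Delta\cap(L^2_k\times L^2_q)$ and $x_0\in X_0$, with $x$ the solution of the state equation from $x_0$. $\Delta$ satisfies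 the complete IQC if there is such a continuous $\kappa$ with $\int_0^T\sigma(x(t),v(t),w(t))dt\ge-\kappa(x_0,v(0),w(0))$ for all $T\ge0$, $(v,w)\in\Delta$, $x_0\in X_0$ and $x\in L_n$ satisfying the state equation with $x(0)=x_0$. *)

theory Defs
  imports "HOL-Analysis.Analysis"
begin

text \<open>Signals u : [0,infinity) -> R^m are modelled as functions real => real^'m;
 only their values on {0..} matter.\<close>

definition loc_L2 :: "(real \<Rightarrow> real^'m) \<Rightarrow> bool" where
  "loc_L2 u \<longleftrightarrow> u measurable_on {0..} \<and>
     (\<forall>T\<ge>0. (\<lambda>t. (norm (u t))\<^sup>2) integrable_on {0..T})"

definition L2 :: "(real \<Rightarrow> real^'m) \<Rightarrow> bool" where
  "L2 u \<longleftrightarrow> loc_L2 u \<and> (\<lambda>t. (norm (u t))\<^sup>2) integrable_on {0..}"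

definition L2norm :: "(real \<Rightarrow> real^'m) \<Rightarrow> real" where
  "L2norm u = sqrt (integral {0..} (\<lambda>t. (norm (u t))\<^sup>2))"

text \<open>x satisfies x' = A x + B1 v + B2 w, x(0) = x0 (integral form, for t >= 0).\<close>
definition solves_state ::
  "real^'n^'n \<Rightarrow> real^'k^'n \<Rightarrow> real^'q^'n \<Rightarrow> real^'n \<Rightarrow>
   (real \<Rightarrow> real^'k) \<Rightarrow> (real \<Rightarrow> real^'q) \<Rightarrow> (real \<Rightarrow> real^'n) \<Rightarrow> bool" where
  "solves_state A B1 B2 x0 v w x \<longleftrightarrow>
     (\<forall>t\<ge>0. ((\<lambda>\<tau>. A *v x \<tau> + B1 *v v \<tau> + B2 *v w \<tau>) has_integral (x t - x0)) {0..t})"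

definition stack3 :: "real^'n \<Rightarrow> real^'k \<Rightarrow> real^'q \<Rightarrow> real^('n + ('k + 'q))" where
  "stack3 x v w = (\<chi> i. case i of Inl a \<Rightarrow> x $ a | Inr (Inl b) \<Rightarrow> v $ b | Inr (Inr c) \<Rightarrow> w $ c)"

definition sigma_Q ::
  "real^('n + ('k + 'q))^('n + ('k + 'q)) \<Rightarrow> real^'n \<Rightarrow> real^'k \<Rightarrow> real^'q \<Rightarrow> real" where
  "sigma_Q Q x v w = stack3 x v w \<bullet> (Q *v stack3 x v w)"

definition weakly_causally_stable ::
  "((real \<Rightarrow> real^'k) \<times> (real \<Rightarrow> real^'q)) set \<Rightarrow> bool" where
  "weakly_causally_stable \<Delta> \<longleftrightarrow>
    (\<forall>T\<ge>0. \<forall>v w vs. (v, w) \<in> \<Delta> \<and> L2 vs \<and> (\<forall>t\<in>{0..T}. v t = vs t) \<longrightarrow>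
       (\<exists>seq :: nat \<Rightarrow> (real \<Rightarrow> real^'k) \<times> (real \<Rightarrow> real^'q).
          (\<forall>i. seq i \<in> \<Delta> \<and> L2 (fst (seq i)) \<and> L2 (snd (seq i)) \<and>
               (\<forall>t\<in>{0..T}. fst (seq i) t = v t \<and> snd (seq i) t = w t)) \<and>
          (\<lambda>i. L2norm (\<lambda>t. fst (seq i) t - vs t)) \<longlonglongrightarrow> 0))"

definition conditional_IQC ::
  "((real \<Rightarrow> real^'k) \<times> (real \<Rightarrow> real^'q)) set \<Rightarrow>
   real^'n^'n \<Rightarrow> real^'k^'n \<Rightarrow> real^'q^'n \<Rightarrow> real^('n + ('k + 'q))^('n + ('k + 'q)) \<Rightarrow>
   (real^'n) set \<Rightarrow> bool" where
  "conditional_IQC \<Delta> A B1 B2 Q X0 \<longleftrightarrow>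
    (\<exists>\<kappa> :: (real^'n) \<times> (real^'k) \<times> (real^'q) \<Rightarrow> real. continuous_on UNIV \<kappa> \<and>
      (\<forall>v w x0 x. (v, w) \<in> \<Delta> \<and> L2 v \<and> L2 w \<and> x0 \<in> X0 \<and> solves_state A B1 B2 x0 v w x \<longrightarrow>
         integral {0..} (\<lambda>t. sigma_Q Q (x t) (v t) (w t)) \<ge> - \<kappa> (x0, v 0, w 0)))"

definition complete_IQC ::
  "((real \<Rightarrow> real^'k) \<times> (real \<Rightarrow> real^'q)) set \<Rightarrow>
   real^'n^'n \<Rightarrow> real^'k^'n \<Rightarrow> real^'q^'n \<Rightarrow> real^('n + ('k + 'q))^('n + ('k + 'q)) \<Rightarrow>
   (real^'n) set \<Rightarrow> bool" where
  "complete_IQC \<Delta> A B1 B2 Q X0 \<longleftrightarrow>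
    (\<exists>\<kappa> :: (real^'n) \<times> (real^'k) \<times> (real^'q) \<Rightarrow> real. continuous_on UNIV \<kappa> \<and>
      (\<forall>T\<ge>0. \<forall>v w x0 x. (v, w) \<in> \<Delta> \<and> x0 \<in> X0 \<and> loc_L2 x \<and> solves_state A B1 B2 x0 v w x \<longrightarrow>
         integral {0..T} (\<lambda>t. sigma_Q Q (x t) (v t) (w t)) \<ge> - \<kappa> (x0, v 0, w 0)))"

definition cmat :: "real^'n^'m \<Rightarrow> complex^'n^'m" where
  "cmat M = (\<chi> i j. complex_of_real (M $ i $ j))"

definition cadj :: "complex^'n^'m \<Rightarrow> complex^'m^'n" where
  "cadj M = (\<chi> i j. cnj (M $ j $ i))"

definition cquad :: "complex^'n^'n \<Rightarrow> complex^'n \<Rightarrow> complex" where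
  "cquad P z = (\<Sum>i\<in>UNIV. \<Sum>j\<in>UNIV. cnj (z $ i) * P $ i $ j * z $ j)"

definition cpsd :: "complex^'n^'n \<Rightarrow> bool" where
  "cpsd P \<longleftrightarrow> cadj P = P \<and> (\<forall>z. 0 \<le> Re (cquad P z))"

definition cpd :: "complex^'n^'n \<Rightarrow> bool" where
  "cpd P \<longleftrightarrow> cadj P = P \<and> (\<forall>z. z \<noteq> 0 \<longrightarrow> 0 < Re (cquad P z))"

definition hurwitz :: "real^'n^'n \<Rightarrow> bool" where
  "hurwitz A \<longleftrightarrow> (\<forall>s::complex. Re s \<ge> 0 \<longrightarrow> invertible (mat s - cmat A))"

definition Bcat :: "real^'k^'n \<Rightarrow> real^'q^'n \<Rightarrow> real^('k + 'q)^'n" where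
  "Bcat B1 B2 = (\<chi> i j. case j of Inl a \<Rightarrow> B1 $ i $ a | Inr b \<Rightarrow> B2 $ i $ b)"

definition PiQ :: "real^'n^'n \<Rightarrow> real^'k^'n \<Rightarrow> real^'q^'n \<Rightarrow>
   real^('n + ('k + 'q))^('n + ('k + 'q)) \<Rightarrow> complex \<Rightarrow> complex^('k + 'q)^('k + 'q)" where
  "PiQ A B1 B2 Q s =
    (let M = (\<chi> i j. case i of
               Inl r \<Rightarrow> (matrix_inv (mat s - cmat A) ** cmat (Bcat B1 B2)) $ r $ j
             | Inr r \<Rightarrow> (if r = j then 1 else 0)) :: complex^('k + 'q)^('n + ('k + 'q))
     in cadj M ** cmat Q ** M)"

definition blk11 :: "complex^('k::finite + 'q::finite)^('k + 'q) \<Rightarrow> complex^'k^'k" where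
  "blk11 P = (\<chi> i j. P $ Inl i $ Inl j)"

definition blk22 :: "complex^('k::finite + 'q::finite)^('k + 'q) \<Rightarrow> complex^'q^'q" where
  "blk22 P = (\<chi> i j. P $ Inr i $ Inr j)"

definition blk_eps :: "real \<Rightarrow> complex^('k::finite + 'q::finite)^('k + 'q) \<Rightarrow> complex^('k + 'q)^('k + 'q)" where
  "blk_eps \<epsilon> P = (\<chi> i j. case (i, j) of
       (Inl _, Inl _) \<Rightarrow> P $ i $ j
     | (Inr _, Inr _) \<Rightarrow> - P $ i $ j
     | _ \<Rightarrow> complex_of_real \<epsilon> * P $ i $ j)"

definition sysmat :: "real^'n^'n \<Rightarrow> real^'k^'n \<Rightarrow> real^'n^'k \<Rightarrow> real^'k^'k \<Rightarrow> complex \<Rightarrow>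
    complex^('n + 'k)^('n + 'k)" where
  "sysmat A B1 C D1 s = (\<chi> i j. case (i, j) of
       (Inl a, Inl b) \<Rightarrow> complex_of_real (A $ a $ b) - (if a = b then s else 0)
     | (Inl a, Inr b) \<Rightarrow> complex_of_real (B1 $ a $ b)
     | (Inr a, Inl b) \<Rightarrow> complex_of_real (C $ a $ b)
     | (Inr a, Inr b) \<Rightarrow> complex_of_real (D1 $ a $ b))"

end

theory Submission
  imports Defs "HOL-Real_Asymp.Real_Asymp" "HOL-Library.Function_Algebras"
    "HOL-Computational_Algebra.Fundamental_Theorem_Algebra"
begin

text \<open>
  The Cayley transform \<open>z = (s - 1) / (s + 1)\<close> and the Laguerre basis of square-integrable functions on
  the half-line turn inputs into polynomials in \<open>z\<close>: multiplication by \<open>z\<close> is the filter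
  \<open>(s - 1) / (s + 1)\<close>, and integrals of quadratic forms become averages over points of the unit circle.
  For inputs divisible by the determinant of \<open>(1 + z) - (1 - z) A\<close> all signals are polynomials, and such
  inputs are dense because this determinant has no zeros in the open disc. In this way (a) gives convexity
  in \<open>v\<close>, concavity in \<open>w\<close> and a bound on the coupling, and (b) makes the output
  \<open>C x + D1 v + D2 w\<close> arbitrarily small for every given \<open>w\<close>, by an approximate inversion. A minimax
  argument then yields, from any state, an input \<open>v\<close> for which the supremum over \<open>w\<close> of the
  cost-to-go is at most any given positive number, and by convexity this survives small perturbations of
  \<open>v\<close>. Continuing the given \<open>v\<close> after time \<open>T\<close> by this input, weak causal stability and the
  conditional IQC bound the integral up to \<open>T\<close>.
\<close>

subsection \<open>Square-integrable functions on the half-line\<close>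

text \<open>Hypothesis (a) is strict at one frequency only, so Pi22 may be singular elsewhere on the
  imaginary axis and at infinity, and (b) allows zeros on the axis. Hence no form need be coercive
  and no infimum or supremum need be attained: every step is an inequality with an error that is
  sent to 0, and Cauchy-Schwarz for semidefinite forms replaces inversion. The delicate point is
  that, from a nonzero state, the supremum over \<open>w\<close> is finite although the form in
  \<open>w\<close> may degenerate. Its determinant is a nonzero trigonometric polynomial, with
  finitely many zeros on the circle, and a free response is insensitive to these: its Laguerre
  coefficients are generated by a matrix with spectrum in the open disc, so its pairing with
  \<open>p\<close> is controlled by that with \<open>h * p\<close> whenever all roots of
  \<open>h\<close> lie on the circle. Weak causal stability reproduces the chosen continuation only
  approximately, so the bound on the supremum must hold on a ball of inputs. As the cost after
  \<open>T\<close> is below any positive number, the \<open>\<kappa>\<close> of the conditional IQC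
  serves unchanged.\<close>

instantiation "fun" :: (type, scaleR) scaleR
begin
definition scaleR_fun :: "real \<Rightarrow> ('a \<Rightarrow> 'b) \<Rightarrow> 'a \<Rightarrow> 'b"
  where "scaleR_fun c f = (\<lambda>x. c *\<^sub>R f x)"
instance ..
end

lemma scaleR_fun_apply [simp]: "(c *\<^sub>R f) x = c *\<^sub>R f x"
  by (simp add: scaleR_fun_def)

text \<open>Signals and trajectories become vectors, so \<open>subspace\<close> and the abstract
  locale \<open>saddle\<close> apply to them without a separate type of square-integrable
  functions.\<close>

instance "fun" :: (type, real_vector) real_vector
  by standard (simp_all add: fun_eq_iff algebra_simps)

abbreviation halfline :: "real measure"
  where "halfline \<equiv> lebesgue_on {0..}"

text \<open>This is \<open>L2\<close> expressed with the Lebesgue integral, which brings Fatou and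
  dominated convergence. Functions are not identified almost everywhere, because agreement of inputs
  on \<open>{0..T}\<close> is pointwise; thus \<open>nsq\<close> below is the square of a seminorm
  only, and values at negative times are arbitrary.\<close>

definition sqi :: "(real \<Rightarrow> 'a::euclidean_space) \<Rightarrow> bool" where
  "sqi f \<longleftrightarrow> f \<in> borel_measurable halfline \<and> integrable halfline (\<lambda>t. (norm (f t))\<^sup>2)"

definition ip :: "(real \<Rightarrow> 'a::euclidean_space) \<Rightarrow> (real \<Rightarrow> 'a) \<Rightarrow> real" where
  "ip f g = (LINT t|halfline. f t \<bullet> g t)"

abbreviation nsq :: "(real \<Rightarrow> 'a::euclidean_space) \<Rightarrow> real" where
  "nsq f \<equiv> ip f f"

lemma sqi_measurable: "sqi f \<Longrightarrow> f \<in> borel_measurable halfline"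
  by (simp add: sqi_def)

lemma integrable_inner:
  assumes "sqi f" "sqi g"
  shows "integrable halfline (\<lambda>t. f t \<bullet> g t)"
proof (rule Bochner_Integration.integrable_bound)
  show "integrable halfline (\<lambda>t. (norm (f t))\<^sup>2 + (norm (g t))\<^sup>2)"
    using assms by (simp add: sqi_def)
  show "(\<lambda>t. f t \<bullet> g t) \<in> borel_measurable halfline"
    using assms by (auto simp: sqi_def)
  have "norm (f t \<bullet> g t) \<le> norm ((norm (f t))\<^sup>2 + (norm (g t))\<^sup>2)" for t
  proof -
    have "2 * (norm (f t) * norm (g t)) \<le> (norm (f t))\<^sup>2 + (norm (g t))\<^sup>2"
      using sum_squares_bound[of "norm (f t)" "norm (g t)"] by simp
    moreover have "0 \<le> norm (f t) * norm (g t)" by simp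
    ultimately show ?thesis
      using Cauchy_Schwarz_ineq2[of "f t" "g t"] by simp
  qed
  then show "AE t in halfline. norm (f t \<bullet> g t) \<le> norm ((norm (f t))\<^sup>2 + (norm (g t))\<^sup>2)"
    by simp
qed

lemma sqi_add:
  assumes "sqi f" "sqi g"
  shows "sqi (f + g)"
proof -
  have "integrable halfline (\<lambda>t. (norm (f t))\<^sup>2 + 2 * (f t \<bullet> g t) + (norm (g t))\<^sup>2)"
    using integrable_inner[OF assms] assms by (simp add: sqi_def)
  moreover have "(norm (f t + g t))\<^sup>2 = (norm (f t))\<^sup>2 + 2 * (f t \<bullet> g t) + (norm (g t))\<^sup>2" for t
    by (simp add: power2_norm_eq_inner algebra_simps inner_commute)
  moreover have "f + g \<in> borel_measurable halfline"
    using assms unfolding sqi_def plus_fun_def by (intro borel_measurable_add) auto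
  ultimately show ?thesis
    by (simp add: sqi_def)
qed

lemma sqi_bounded_linear:
  assumes "bounded_linear L" "sqi f"
  shows "sqi (\<lambda>t. L (f t))"
proof -
  obtain K where K: "\<And>x. norm (L x) \<le> norm x * K"
    using bounded_linear.bounded[OF assms(1)] by blast
  have m: "(\<lambda>t. L (f t)) \<in> borel_measurable halfline"
    using measurable_compose[OF sqi_measurable[OF assms(2)]
        borel_measurable_continuous_onI[OF linear_continuous_on[OF assms(1)]]] by simp
  have "integrable halfline (\<lambda>t. (norm (L (f t)))\<^sup>2)"
  proof (rule Bochner_Integration.integrable_bound)
    show "integrable halfline (\<lambda>t. K\<^sup>2 * (norm (f t))\<^sup>2)"
      using assms by (simp add: sqi_def)
    show "(\<lambda>t. (norm (L (f t)))\<^sup>2) \<in> borel_measurable halfline"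
      using m by simp
    have "(norm (L (f t)))\<^sup>2 \<le> K\<^sup>2 * (norm (f t))\<^sup>2" for t
      using power_mono[OF K[of "f t"] norm_ge_zero, of 2] by (simp add: power_mult_distrib mult.commute)
    then show "AE t in halfline. norm ((norm (L (f t)))\<^sup>2) \<le> norm (K\<^sup>2 * (norm (f t))\<^sup>2)"
      by simp
  qed
  with m show ?thesis by (simp add: sqi_def)
qed

lemma sqi_scaleR: "sqi f \<Longrightarrow> sqi (c *\<^sub>R f)"
  using sqi_bounded_linear[OF bounded_linear_scaleR_right, of f c] by (simp add: scaleR_fun_def)

lemma sqi_0 [simp]: "sqi 0"
  by (simp add: sqi_def zero_fun_def)

lemma sqi_diff: "sqi f \<Longrightarrow> sqi g \<Longrightarrow> sqi (f - g)"
  using sqi_add[of f "(-1) *\<^sub>R g"] sqi_scaleR[of g "-1"] by simp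

lemma sqi_sum: "(\<And>i. i \<in> I \<Longrightarrow> sqi (f i)) \<Longrightarrow> sqi (\<Sum>i\<in>I. f i)"
  by (induction I rule: infinite_finite_induct) (auto simp: sqi_add)

lemma sqi_cong: "(\<And>t. t \<ge> 0 \<Longrightarrow> f t = g t) \<Longrightarrow> sqi f \<longleftrightarrow> sqi g"
  unfolding sqi_def
  by (intro conj_cong measurable_cong Bochner_Integration.integrable_cong) auto

lemma ip_cong:
  "(\<And>t. t \<ge> 0 \<Longrightarrow> f t = f' t) \<Longrightarrow> (\<And>t. t \<ge> 0 \<Longrightarrow> g t = g' t) \<Longrightarrow> ip f g = ip f' g'"
  unfolding ip_def by (intro Bochner_Integration.integral_cong) auto

lemma ip_commute: "ip f g = ip g f"
  by (simp add: ip_def inner_commute)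

lemma ip_add_left: "sqi f \<Longrightarrow> sqi g \<Longrightarrow> sqi h \<Longrightarrow> ip (f + g) h = ip f h + ip g h"
  by (simp add: ip_def inner_add_left integrable_inner)

lemma ip_add_right: "sqi f \<Longrightarrow> sqi g \<Longrightarrow> sqi h \<Longrightarrow> ip h (f + g) = ip h f + ip h g"
  by (simp add: ip_def inner_add_right integrable_inner)

lemma ip_scaleR_left [simp]: "ip (c *\<^sub>R f) h = c * ip f h"
  by (simp add: ip_def)

lemma ip_scaleR_right [simp]: "ip h (c *\<^sub>R f) = c * ip h f"
  by (simp add: ip_def)

lemma ip_0 [simp]: "ip 0 f = 0" "ip f 0 = 0"
  by (simp_all add: ip_def)

lemma ip_diff_left: "sqi f \<Longrightarrow> sqi g \<Longrightarrow> sqi h \<Longrightarrow> ip (f - g) h = ip f h - ip g h"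
  by (simp add: ip_def inner_diff_left integrable_inner)

lemma ip_diff_right: "sqi f \<Longrightarrow> sqi g \<Longrightarrow> sqi h \<Longrightarrow> ip h (f - g) = ip h f - ip h g"
  by (simp add: ip_def inner_diff_right integrable_inner)

lemma ip_sum_left:
  "(\<And>i. i \<in> I \<Longrightarrow> sqi (f i)) \<Longrightarrow> sqi g \<Longrightarrow> ip (\<Sum>i\<in>I. f i) g = (\<Sum>i\<in>I. ip (f i) g)"
  by (induction I rule: infinite_finite_induct) (simp_all add: ip_add_left sqi_sum)

lemma ip_sum_right:
  "(\<And>i. i \<in> I \<Longrightarrow> sqi (f i)) \<Longrightarrow> sqi g \<Longrightarrow> ip g (\<Sum>i\<in>I. f i) = (\<Sum>i\<in>I. ip g (f i))"
  using ip_sum_left[of I f g] by (simp add: ip_commute)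

lemma ip_nonneg [simp]: "0 \<le> nsq f"
  by (simp add: ip_def)

text \<open>The degenerate case c = 0 is included: a nonnegative affine function is constant. This
  is what yields Cauchy-Schwarz inequalities for forms that are merely semidefinite.\<close>

lemma quadratic_nonneg_discriminant:
  fixes a b c :: real
  assumes "\<And>t. 0 \<le> a + 2 * t * b + t\<^sup>2 * c"
  shows "b\<^sup>2 \<le> a * c"
proof (cases "c = 0")
  case True
  have "b = 0"
  proof (rule ccontr)
    assume "b \<noteq> 0"
    then have "a + 2 * (- (a + 1) / (2 * b)) * b = - 1" by (simp add: field_simps)
    with assms[of "- (a + 1) / (2 * b)"] True show False by simp
  qed
  with True show ?thesis by simp
next
  case False
  have "c > 0"
  proof (rule ccontr)
    assume "\<not> c > 0"
    with False have c: "c < 0" by simp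
    \<comment> \<open>Chosen so that \<open>2 * b + t * c\<close> is at most -1 - |a|; as t is at
      least 1, the quadratic is then negative.\<close>
    define t where "t = (1 + \<bar>a\<bar> + 2 * \<bar>b\<bar>) / (- c) + 1"
    have t: "t \<ge> 1" using c by (simp add: t_def field_simps)
    have ct: "c * t = - (1 + \<bar>a\<bar> + 2 * \<bar>b\<bar>) + c"
      using c by (simp add: t_def field_simps)
    have "t * (2 * b + t * c) \<le> t * (- 1 - \<bar>a\<bar>)"
      using c t ct by (intro mult_left_mono) (auto simp: mult.commute)
    also have "\<dots> \<le> - 1 - \<bar>a\<bar>"
      using t mult_right_mono[of 1 t "1 + \<bar>a\<bar>"] by (simp add: algebra_simps)
    finally have "a + 2 * t * b + t\<^sup>2 * c < 0"
      by (simp add: power2_eq_square algebra_simps)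
    with assms[of t] show False by simp
  qed
  then show ?thesis
    using assms[of "- b / c"] by (simp add: field_simps power2_eq_square)
qed

lemma ip_Cauchy_Schwarz:
  assumes "sqi f" "sqi g"
  shows "(ip f g)\<^sup>2 \<le> nsq f * nsq g"
proof (rule quadratic_nonneg_discriminant)
  fix t
  have "0 \<le> nsq (f + t *\<^sub>R g)" by simp
  also have "\<dots> = nsq f + 2 * t * ip f g + t\<^sup>2 * nsq g"
    using assms by (simp add: ip_add_left ip_add_right sqi_add sqi_scaleR ip_commute[of g f]
        power2_eq_square algebra_simps)
  finally show "0 \<le> nsq f + 2 * t * ip f g + t\<^sup>2 * nsq g" .
qed

lemma ip_self_add_le:
  assumes "sqi f" "sqi g"
  shows "nsq (f + g) \<le> 2 * nsq f + 2 * nsq g"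
proof -
  have "0 \<le> nsq (f - g)" by simp
  then show ?thesis
    using assms by (simp add: ip_add_left ip_add_right ip_diff_left ip_diff_right sqi_add sqi_diff
        ip_commute[of g f])
qed

lemma ip_self_diff_commute: "nsq (f - g) = nsq (g - f)"
  by (simp add: ip_def power2_norm_eq_inner[symmetric] norm_minus_commute)

lemma ip_self_diff_le:
  assumes "sqi f" "sqi g" "sqi h"
  shows "nsq (f - h) \<le> 2 * nsq (f - g) + 2 * nsq (g - h)"
  using ip_self_add_le[of "f - g" "g - h"] assms by (simp add: sqi_diff)

lemma ip_self_mono:
  assumes "sqi f" "sqi g" "\<And>t. t \<ge> 0 \<Longrightarrow> (norm (f t))\<^sup>2 \<le> c * (norm (g t))\<^sup>2"
  shows "nsq f \<le> c * nsq g"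
proof -
  have "(LINT t|halfline. (norm (f t))\<^sup>2) \<le> (LINT t|halfline. c * (norm (g t))\<^sup>2)"
    using assms by (intro integral_mono) (auto simp: sqi_def)
  then show ?thesis by (simp add: ip_def power2_norm_eq_inner)
qed

lemma ip_matrix_bound:
  fixes N :: "real^'a^'b"
  obtains K where "K > 0" "\<And>f. sqi f \<Longrightarrow> nsq (\<lambda>t. N *v f t) \<le> K * nsq f"
proof -
  obtain K where K: "K > 0" "\<And>x. norm (N *v x) \<le> norm x * K"
    using bounded_linear.pos_bounded[OF matrix_vector_mul_bounded_linear[of N]] by blast
  have "nsq (\<lambda>t. N *v f t) \<le> K\<^sup>2 * nsq f" if "sqi f" for f
  proof (rule ip_self_mono[OF sqi_bounded_linear[OF matrix_vector_mul_bounded_linear that] that])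
    show "(norm (N *v f t))\<^sup>2 \<le> K\<^sup>2 * (norm (f t))\<^sup>2" for t
      using power_mono[OF K(2)[of "f t"] norm_ge_zero, of 2] by (simp add: power_mult_distrib mult.commute)
  qed
  with K(1) that[of "K\<^sup>2"] show ?thesis by simp
qed

text \<open>Fatou's lemma, in place of completeness of L2: limits are constructed pointwise in time,
  and bounds on the norms pass to them.\<close>

lemma sqi_limit:
  assumes lim: "\<And>t. t \<ge> 0 \<Longrightarrow> (\<lambda>i. u i t) \<longlonglongrightarrow> f t"
    and u: "\<And>i. sqi (u i)"
    and K: "eventually (\<lambda>i. nsq (u i) \<le> K) sequentially"
  shows "sqi f" "nsq f \<le> K"
proof -
  have m: "f \<in> borel_measurable halfline"
    by (rule borel_measurable_LIMSEQ_metric[of u]) (use lim u in \<open>auto simp: sqi_def\<close>)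
  have K0: "K \<ge> 0"
    using eventually_happens[OF K] by (auto intro: order_trans[OF ip_nonneg])
  have "(\<integral>\<^sup>+t. ennreal ((norm (f t))\<^sup>2) \<partial>halfline)
      = (\<integral>\<^sup>+t. liminf (\<lambda>i. ennreal ((norm (u i t))\<^sup>2)) \<partial>halfline)"
  proof (intro nn_integral_cong lim_imp_Liminf[symmetric])
    fix t assume "t \<in> space halfline"
    then have "(\<lambda>i. u i t) \<longlonglongrightarrow> f t" using lim by simp
    then show "(\<lambda>i. ennreal ((norm (u i t))\<^sup>2)) \<longlonglongrightarrow> ennreal ((norm (f t))\<^sup>2)"
      by (intro tendsto_ennrealI tendsto_intros)
  qed simp
  also have "\<dots> \<le> liminf (\<lambda>i. \<integral>\<^sup>+t. ennreal ((norm (u i t))\<^sup>2) \<partial>halfline)"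
    by (intro nn_integral_liminf) (use u in \<open>auto simp: sqi_def\<close>)
  also have "(\<lambda>i. \<integral>\<^sup>+t. ennreal ((norm (u i t))\<^sup>2) \<partial>halfline) = (\<lambda>i. ennreal (nsq (u i)))"
    using u by (auto simp: nn_integral_eq_integral sqi_def ip_def power2_norm_eq_inner)
  also have "liminf (\<lambda>i. ennreal (nsq (u i))) \<le> limsup (\<lambda>i. ennreal (nsq (u i)))"
    by (intro Liminf_le_Limsup) simp
  also have "\<dots> \<le> ennreal K"
    by (intro Limsup_bounded) (use K in eventually_elim, simp add: ennreal_leI)
  finally have le: "(\<integral>\<^sup>+t. ennreal ((norm (f t))\<^sup>2) \<partial>halfline) \<le> ennreal K" .
  have i: "integrable halfline (\<lambda>t. (norm (f t))\<^sup>2)"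
    using m le by (intro integrableI_bounded) (auto simp: le_less_trans[OF _ ennreal_less_top])
  with m show "sqi f" by (simp add: sqi_def)
  have "ennreal (nsq f) \<le> ennreal K"
    using le i by (simp add: nn_integral_eq_integral ip_def power2_norm_eq_inner)
  with K0 show "nsq f \<le> K" by simp
qed

lemma L2_iff_sqi: "L2 u \<longleftrightarrow> sqi u"
proof -
  have M: "u measurable_on {0..} \<longleftrightarrow> u \<in> borel_measurable halfline"
    by (intro measurable_on_iff_borel_measurable) simp
  have eq: "integrable halfline (\<lambda>t. (norm (u t))\<^sup>2) \<longleftrightarrow> (\<lambda>t. (norm (u t))\<^sup>2) integrable_on {0..}"
  proof
    assume "(\<lambda>t. (norm (u t))\<^sup>2) integrable_on {0..}"
    then have "(\<lambda>t. (norm (u t))\<^sup>2) absolutely_integrable_on {0..}"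
      by (intro nonnegative_absolutely_integrable_1) auto
    then show "integrable halfline (\<lambda>t. (norm (u t))\<^sup>2)"
      by (simp add: integrable_restrict_space set_integrable_def)
  qed (simp add: integrable_on_lebesgue_on)
  show ?thesis
    unfolding L2_def loc_L2_def sqi_def M eq
    by (auto intro: integrable_on_subinterval)
qed

lemma L2norm_eq_ip: "sqi u \<Longrightarrow> L2norm u = sqrt (nsq u)"
  unfolding L2norm_def sqi_def ip_def
  by (subst lebesgue_integral_eq_integral) (auto simp: power2_norm_eq_inner)

text \<open>Dominated convergence for the truncations to [0, n]; it links antiderivatives on compact
  intervals, which live in the gauge integral, to the Lebesgue integral on the half-line.\<close>

lemma halfline_integral_limit:
  fixes f :: "real \<Rightarrow> real"
  assumes f: "integrable halfline f"
    and F: "\<And>t. t \<ge> 0 \<Longrightarrow> (f has_integral F t - F 0) {0..t}"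
    and lim: "(F \<longlongrightarrow> L) at_top"
  shows "(LINT t|halfline. f t) = L - F 0"
proof -
  have "(\<lambda>n. LINT t|halfline. indicator {..real n} t * f t) \<longlonglongrightarrow> (LINT t|halfline. f t)"
  proof (rule integral_dominated_convergence[where w = "\<lambda>t. \<bar>f t\<bar>"])
    show "AE t in halfline. (\<lambda>n. indicator {..real n} t * f t) \<longlonglongrightarrow> f t"
    proof (intro AE_I2 tendsto_eventually)
      fix t
      obtain m where "t \<le> real m" using real_arch_simple by blast
      then show "\<forall>\<^sub>F n in sequentially. indicator {..real n} t * f t = f t"
        by (intro eventually_sequentiallyI[of m]) (auto simp: indicator_def)
    qed
    show "AE t in halfline. norm (indicator {..real n} t * f t) \<le> \<bar>f t\<bar>" for n
      by (auto simp: indicator_def)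
    have "{x. 0 \<le> x \<and> x \<le> real n} \<in> sets halfline" for n
    proof -
      have "{x. 0 \<le> x \<and> x \<le> real n} = {0..real n}" by auto
      then show ?thesis by (simp add: sets_restrict_space_iff)
    qed
    then show "(\<lambda>t. indicator {..real n} t * f t) \<in> borel_measurable halfline" for n
      using f by (intro borel_measurable_times borel_measurable_indicator') simp_all
  qed (use f in auto)
  moreover have "(LINT t|halfline. indicator {..real n} t * f t) = F (real n) - F 0" for n
  proof -
    have "(LINT t|halfline. indicator {..real n} t * f t)
        = (LINT t|lebesgue. indicator {0..real n} t * f t)"
      by (subst integral_restrict_space) (auto simp: indicator_def intro!: Bochner_Integration.integral_cong)
    also have "\<dots> = (LINT t|lebesgue_on {0..real n}. f t)"
      by (subst integral_restrict_space) (auto simp: indicator_def intro!: Bochner_Integration.integral_cong)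
    also have "\<dots> = integral {0..real n} f"
    proof (rule lebesgue_integral_eq_integral)
      show "integrable (lebesgue_on {0..real n}) f"
        using f set_integrable_subset[of lebesgue "{0..}" f "{0..real n}"]
        by (simp add: integrable_restrict_space set_integrable_def)
    qed simp
    also have "\<dots> = F (real n) - F 0"
      using F by (simp add: integral_unique)
    finally show ?thesis .
  qed
  ultimately have "(\<lambda>n. F (real n) - F 0) \<longlonglongrightarrow> (LINT t|halfline. f t)" by simp
  moreover have "(\<lambda>n. F (real n) - F 0) \<longlonglongrightarrow> L - F 0"
    by (intro tendsto_intros filterlim_compose[OF lim filterlim_real_sequentially])
  ultimately show ?thesis
    by (rule LIMSEQ_unique)
qed

subsection \<open>Laguerre functions\<close>

lemma ip_minus [simp]: "ip (- f) g = - ip f g" "ip f (- g) = - ip f g"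
  by (simp_all add: ip_def)

text \<open>The Laguerre polynomial L_k at the argument 2 t. The closed form reduces its recurrences
  to binomial identities.\<close>

definition lagpoly :: "nat \<Rightarrow> real poly" where
  "lagpoly k = (\<Sum>j\<le>k. monom (real (k choose j) * (-2) ^ j / fact j) j)"

text \<open>The factor sqrt 2 normalises in L2. The Laplace transform is sqrt 2 / (s + 1) * ((s - 1)
  / (s + 1))^k.\<close>

definition lag :: "nat \<Rightarrow> real \<Rightarrow> real" where
  "lag k t = sqrt 2 * exp (- t) * poly (lagpoly k) t"

lemma coeff_lagpoly: "coeff (lagpoly k) j = real (k choose j) * (-2) ^ j / fact j"
  by (auto simp: lagpoly_def coeff_sum sum.delta if_distrib cong: if_cong)

text \<open>Pascal's rule, coefficient by coefficient; the 2 in the factor is the inner derivative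
  of the argument 2 t.\<close>

lemma pderiv_lagpoly_Suc: "pderiv (lagpoly (Suc k)) - pderiv (lagpoly k) = smult (-2) (lagpoly k)"
proof (rule poly_eqI)
  fix n
  have *: "coeff (pderiv (lagpoly m)) n = real (m choose Suc n) * (-2) ^ Suc n / fact n" for m
    by (simp add: coeff_pderiv coeff_lagpoly fact_Suc del: of_nat_Suc power_Suc)
  show "coeff (pderiv (lagpoly (Suc k)) - pderiv (lagpoly k)) n = coeff (smult (-2) (lagpoly k)) n"
    by (simp add: * coeff_lagpoly algebra_simps diff_divide_distrib add_divide_distrib)
qed

lemma poly_lagpoly_0 [simp]: "poly (lagpoly k) 0 = 1"
  by (simp add: poly_0_coeff_0 coeff_lagpoly)

lemma lag_0 [simp]: "lag k 0 = sqrt 2"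
  by (simp add: lag_def)

text \<open>Time-domain form of s (1 - z) = 1 + z. The recurrence turns the derivative of the
  polynomial difference into twice \<open>lagpoly k\<close>; the derivative of the exponential
  subtracts \<open>lagpoly k\<close> and adds \<open>lagpoly (Suc k)\<close>.\<close>

lemma DERIV_lag_diff:
  "((\<lambda>t. lag k t - lag (Suc k) t) has_real_derivative lag k t + lag (Suc k) t) (at t within S)"
proof -
  have "poly (pderiv (lagpoly k)) t - poly (pderiv (lagpoly (Suc k))) t = 2 * poly (lagpoly k) t"
    using arg_cong[OF pderiv_lagpoly_Suc[of k], of "\<lambda>p. poly p t"] by simp
  then have *: "sqrt 2 * exp (- t) * (poly (pderiv (lagpoly k)) t - poly (pderiv (lagpoly (Suc k))) t)
      = sqrt 2 * exp (- t) * (2 * poly (lagpoly k) t)"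
    by simp
  show ?thesis
    unfolding lag_def
    by (rule derivative_eq_intros refl poly_DERIV | simp)+ (use * in \<open>simp add: algebra_simps\<close>)
qed

lemma DERIV_lag_diff':
  "((lag k - lag (Suc k)) has_real_derivative (lag k + lag (Suc k)) t) (at t within S)"
  using DERIV_lag_diff[of k t S] by (simp add: fun_diff_def)

text \<open>Horner step: the factor t costs e^(a t / 2) because t is at most (2 / a) e^(a t / 2),
  and the remaining polynomial gets the other half of the exponent. Hence \<open>a\<close> is
  arbitrary in the induction.\<close>

lemma poly_le_exp:
  fixes p :: "real poly"
  assumes "a > 0"
  shows "\<exists>C. \<forall>t\<ge>0. \<bar>poly p t\<bar> \<le> C * exp (a * t)"
  using assms
proof (induction p arbitrary: a)
  case (pCons c p)
  obtain C where C: "\<And>t. t \<ge> 0 \<Longrightarrow> \<bar>poly p t\<bar> \<le> C * exp (a / 2 * t)"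
    using pCons.IH[of "a / 2"] pCons.prems by auto
  have "\<bar>poly (pCons c p) t\<bar> \<le> (\<bar>c\<bar> + 2 / a * C) * exp (a * t)" if t: "t \<ge> 0" for t
  proof -
    have "a / 2 * t \<le> exp (a / 2 * t)"
      using exp_ge_add_one_self[of "a / 2 * t"] by linarith
    then have "2 / a * (a / 2 * t) \<le> 2 / a * exp (a / 2 * t)"
      using pCons.prems by (intro mult_left_mono) auto
    moreover have "2 / a * (a / 2 * t) = t" using pCons.prems by simp
    ultimately have 1: "t \<le> 2 / a * exp (a / 2 * t)" by simp
    have "t * \<bar>poly p t\<bar> \<le> (2 / a * exp (a / 2 * t)) * (C * exp (a / 2 * t))"
      using 1 C[OF t] t pCons.prems by (intro mult_mono) auto
    also have "\<dots> = 2 / a * C * exp (a * t)"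
      by (simp add: exp_add[symmetric] field_simps)
    finally have 2: "t * \<bar>poly p t\<bar> \<le> 2 / a * C * exp (a * t)" .
    have "\<bar>c\<bar> * 1 \<le> \<bar>c\<bar> * exp (a * t)"
      using t pCons.prems by (intro mult_left_mono) auto
    moreover have "\<bar>poly (pCons c p) t\<bar> \<le> \<bar>c\<bar> + t * \<bar>poly p t\<bar>"
      using t abs_triangle_ineq[of c "t * poly p t"] by (simp add: abs_mult)
    ultimately show ?thesis using 2 by (simp add: algebra_simps)
  qed
  then show ?case by blast
qed (auto intro: exI[of _ 0])

lemma lag_decay: "\<exists>C. \<forall>t\<ge>0. \<bar>lag k t\<bar> \<le> C * exp (- t / 2)"
proof -
  obtain C where C: "\<And>t. t \<ge> 0 \<Longrightarrow> \<bar>poly (lagpoly k) t\<bar> \<le> C * exp (1 / 2 * t)"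
    using poly_le_exp[of "1/2" "lagpoly k"] by auto
  have "\<bar>lag k t\<bar> \<le> (sqrt 2 * C) * exp (- t / 2)" if "t \<ge> 0" for t
  proof -
    have "\<bar>lag k t\<bar> \<le> sqrt 2 * exp (- t) * (C * exp (1 / 2 * t))"
      unfolding lag_def abs_mult using C[OF that] by (intro mult_mono) auto
    also have "\<dots> = sqrt 2 * C * exp (- t / 2)"
      by (simp add: exp_add[symmetric] field_simps)
    finally show ?thesis .
  qed
  then show ?thesis by blast
qed

lemma integrable_exp_halfline:
  assumes "a > 0"
  shows "integrable halfline (\<lambda>t. exp (- a * t))" "(LINT t|halfline. exp (- a * t)) = 1 / a"
proof -
  have *: "((\<lambda>t. exp (- a * t)) has_integral 1 / a) {0..}"
    using has_integral_exp_minus_to_infinity[OF assms, of 0] by simp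
  then have "(\<lambda>t. exp (- a * t)) absolutely_integrable_on {0..}"
    by (intro nonnegative_absolutely_integrable_1) (auto simp: integrable_on_def)
  then show i: "integrable halfline (\<lambda>t. exp (- a * t))"
    by (simp add: integrable_restrict_space set_integrable_def)
  show "(LINT t|halfline. exp (- a * t)) = 1 / a"
    by (subst lebesgue_integral_eq_integral[OF i]) (use * in \<open>auto simp: integral_unique\<close>)
qed

lemma sqi_exp_decay:
  fixes f :: "real \<Rightarrow> 'a::euclidean_space"
  assumes "continuous_on {0..} f" "a > 0" "\<And>t. t \<ge> 0 \<Longrightarrow> norm (f t) \<le> C * exp (- a * t)"
  shows "sqi f"
proof -
  have m: "f \<in> borel_measurable halfline"
    by (intro continuous_imp_measurable_on_sets_lebesgue assms) simp
  have "integrable halfline (\<lambda>t. (norm (f t))\<^sup>2)"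
  proof (rule Bochner_Integration.integrable_bound)
    show "integrable halfline (\<lambda>t. C\<^sup>2 * exp (- (2 * a) * t))"
      using integrable_exp_halfline[of "2 * a"] assms(2) by simp
    have "(norm (f t))\<^sup>2 \<le> C\<^sup>2 * exp (- (2 * a) * t)" if "t \<ge> 0" for t
    proof -
      have "(norm (f t))\<^sup>2 \<le> (C * exp (- a * t))\<^sup>2"
        using assms(3)[OF that] by (intro power_mono) auto
      also have "\<dots> = C\<^sup>2 * exp (- (2 * a) * t)"
        by (simp add: power_mult_distrib power2_eq_square exp_add[symmetric])
      finally show ?thesis .
    qed
    then show "AE t in halfline. norm ((norm (f t))\<^sup>2) \<le> norm (C\<^sup>2 * exp (- (2 * a) * t))"
      by (intro AE_I2) simp
    show "(\<lambda>t. (norm (f t))\<^sup>2) \<in> borel_measurable halfline" using m by simp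
  qed
  with m show ?thesis by (simp add: sqi_def)
qed

lemma continuous_on_lag: "continuous_on S (lag k)"
  unfolding lag_def[abs_def] by (intro continuous_intros)

lemma sqi_lag [simp]: "sqi (lag k)"
proof -
  obtain C where "\<And>t. t \<ge> 0 \<Longrightarrow> \<bar>lag k t\<bar> \<le> C * exp (- t / 2)" using lag_decay by blast
  then show ?thesis
    by (intro sqi_exp_decay[where a = "1/2" and C = C] continuous_on_lag) auto
qed

lemma lag_tendsto_0: "(lag k \<longlongrightarrow> 0) at_top"
proof -
  obtain C where C: "\<And>t. t \<ge> 0 \<Longrightarrow> \<bar>lag k t\<bar> \<le> C * exp (- t / 2)" using lag_decay by blast
  have "((\<lambda>t::real. exp (- t / 2)) \<longlongrightarrow> 0) at_top" by real_asymp
  then have "((\<lambda>t. C * exp (- t / 2)) \<longlongrightarrow> 0) at_top"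
    using tendsto_mult_right_zero by blast
  then show ?thesis
    by (rule Lim_null_comparison[rotated])
      (use C in \<open>auto intro!: eventually_at_top_linorderI[of 0]\<close>)
qed

lemma ip_integration_by_parts:
  fixes f g :: "real \<Rightarrow> real"
  assumes f: "\<And>t. t \<ge> 0 \<Longrightarrow> (f has_real_derivative f' t) (at t within {0..})"
    and g: "\<And>t. t \<ge> 0 \<Longrightarrow> (g has_real_derivative g' t) (at t within {0..})"
    and sqi: "sqi f" "sqi f'" "sqi g" "sqi g'"
    and lim: "((\<lambda>t. f t * g t) \<longlongrightarrow> 0) at_top"
  shows "ip f' g + ip f g' = - f 0 * g 0"
proof -
  have "(LINT t|halfline. f' t * g t + f t * g' t) = 0 - f 0 * g 0"
  proof (rule halfline_integral_limit[OF _ _ lim])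
    show "integrable halfline (\<lambda>t. f' t * g t + f t * g' t)"
      using integrable_inner[OF sqi(2,3)] integrable_inner[OF sqi(1,4)] by simp
    fix t :: real assume "t \<ge> 0"
    then show "((\<lambda>t. f' t * g t + f t * g' t) has_integral f t * g t - f 0 * g 0) {0..t}"
    proof (rule fundamental_theorem_of_calculus)
      fix s assume s: "s \<in> {0..t}"
      have "((\<lambda>t. f t * g t) has_real_derivative f' s * g s + f s * g' s) (at s within {0..})"
        using f[of s] g[of s] s by (auto intro!: derivative_eq_intros)
      then show "((\<lambda>t. f t * g t) has_vector_derivative f' s * g s + f s * g' s) (at s within {0..t})"
        unfolding has_real_derivative_iff_has_vector_derivative
        by (rule has_vector_derivative_within_subset) auto
    qed
  qed
  then show ?thesis
    using integrable_inner[OF sqi(2,3)] integrable_inner[OF sqi(1,4)] by (simp add: ip_def)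
qed

text \<open>Integrating the derivative of the product of two differences, the mixed terms cancel,
  and the boundary term at 0 vanishes because all \<open>lag k\<close> agree there. The index shift
  is thus an isometry.\<close>

lemma ip_lag_shift: "ip (lag (Suc i)) (lag (Suc j)) = ip (lag i) (lag j)"
proof -
  have "ip (lag i + lag (Suc i)) (lag j - lag (Suc j)) + ip (lag i - lag (Suc i)) (lag j + lag (Suc j))
      = - (lag i - lag (Suc i)) 0 * (lag j - lag (Suc j)) 0"
  proof (rule ip_integration_by_parts)
    have "((\<lambda>t. (lag i t - lag (Suc i) t) * (lag j t - lag (Suc j) t)) \<longlongrightarrow> (0 - 0) * (0 - 0)) at_top"
      by (intro tendsto_intros lag_tendsto_0)
    then show "((\<lambda>t. (lag i - lag (Suc i)) t * (lag j - lag (Suc j)) t) \<longlongrightarrow> 0) at_top"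
      by simp
  qed (simp_all add: sqi_add sqi_diff DERIV_lag_diff' del: plus_fun_apply)
  then show ?thesis
    by (simp add: ip_add_left ip_add_right ip_diff_left ip_diff_right sqi_add sqi_diff)
qed

definition expo :: "real \<Rightarrow> real \<Rightarrow> real" where
  "expo a t = exp (- a * t)"

lemma sqi_expo: "a > 0 \<Longrightarrow> sqi (expo a)"
  by (rule sqi_exp_decay[where a = a and C = 1]) (auto simp: expo_def intro!: continuous_intros)

lemma ip_expo_lag_Suc:
  assumes "a > 0"
  shows "ip (expo a) (lag (Suc k)) = (a - 1) / (a + 1) * ip (expo a) (lag k)"
proof -
  have "ip ((- a) *\<^sub>R expo a) (lag k - lag (Suc k)) + ip (expo a) (lag k + lag (Suc k))
      = - expo a 0 * (lag k - lag (Suc k)) 0"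
  proof (rule ip_integration_by_parts)
    show "(expo a has_real_derivative ((- a) *\<^sub>R expo a) t) (at t within {0..})" for t
      unfolding expo_def[abs_def] by (auto intro!: derivative_eq_intros)
    have "((\<lambda>t::real. exp (- a * t)) \<longlongrightarrow> 0) at_top" using assms by real_asymp
    then have "((\<lambda>t. exp (- a * t) * (lag k t - lag (Suc k) t)) \<longlongrightarrow> 0 * (0 - 0)) at_top"
      by (intro tendsto_mult tendsto_diff lag_tendsto_0)
    then show "((\<lambda>t. expo a t * (lag k - lag (Suc k)) t) \<longlongrightarrow> 0) at_top"
      by (simp add: expo_def)
  qed (simp_all add: assms sqi_add sqi_diff DERIV_lag_diff' sqi_expo sqi_scaleR
      del: plus_fun_apply scaleR_minus_left)
  then show ?thesis
    using assms by (simp add: ip_add_right ip_diff_right sqi_expo field_simps)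
qed

text \<open>Pairing with \<open>expo a\<close> evaluates the Laplace transform at s = a, and each
  shift of the index contributes one factor z.\<close>

lemma ip_expo_lag:
  assumes "a > 0"
  shows "ip (expo a) (lag k) = sqrt 2 / (a + 1) * ((a - 1) / (a + 1)) ^ k"
proof (induction k)
  case 0
  have "ip (expo a) (lag 0) = (LINT t|halfline. sqrt 2 * exp (- (a + 1) * t))"
    unfolding ip_def expo_def lag_def
    by (intro Bochner_Integration.integral_cong)
      (auto simp: lagpoly_def exp_add[symmetric] algebra_simps)
  also have "\<dots> = sqrt 2 / (a + 1)"
    using integrable_exp_halfline[of "a + 1"] assms by (simp del: minus_add_distrib)
  finally show ?case by simp
qed (simp add: ip_expo_lag_Suc[OF assms])

lemma lag_0_eq: "lag 0 = sqrt 2 *\<^sub>R expo 1"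
  by (auto simp: lag_def lagpoly_def expo_def)

text \<open>The shift reduces everything to index 0, where \<open>lag 0\<close> is a multiple of
  \<open>expo 1\<close> and the ratio (a - 1) / (a + 1) is 0.\<close>

lemma ip_lag: "ip (lag i) (lag j) = (if i = j then 1 else 0)"
proof (induction i arbitrary: j)
  case 0
  have *: "ip (lag 0) (lag j) = sqrt 2 * ip (expo 1) (lag j)"
    by (subst lag_0_eq) (simp del: scaleR_fun_apply)
  show ?case by (simp add: * ip_expo_lag power_0_left)
next
  case (Suc i)
  show ?case
  proof (cases j)
    case 0
    have "ip (lag 0) (lag (Suc i)) = 0"
      by (subst lag_0_eq) (simp add: ip_expo_lag)
    with 0 show ?thesis by (simp add: ip_commute)
  qed (simp add: ip_lag_shift Suc.IH)
qed

section \<open>Polynomials in z as signals\<close>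

lemma sum_fun_apply: "(\<Sum>i\<in>I. f i) x = (\<Sum>i\<in>I. f i x)"
  for f :: "'i \<Rightarrow> 'a \<Rightarrow> 'b::comm_monoid_add"
  by (induction I rule: infinite_finite_induct) auto

text \<open>The transform of \<open>sigs p\<close> is sqrt 2 / (s + 1) * p((s - 1) / (s + 1)).
  Coefficients are real because signals are.\<close>

definition sigs :: "real poly \<Rightarrow> real \<Rightarrow> real" where
  "sigs p = (\<Sum>k\<le>degree p. coeff p k *\<^sub>R lag k)"

lemma sigs_eq: "degree p \<le> N \<Longrightarrow> sigs p = (\<Sum>k\<le>N. coeff p k *\<^sub>R lag k)"
  unfolding sigs_def by (intro sum.mono_neutral_left) (auto simp: coeff_eq_0)

lemma sigs_0 [simp]: "sigs 0 = 0"
  by (simp add: sigs_def)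

lemma sigs_add: "sigs (p + q) = sigs p + sigs q"
proof -
  define N where "N = max (degree p) (degree q)"
  have "degree (p + q) \<le> N" by (simp add: N_def degree_add_le_max)
  then show ?thesis
    using sigs_eq[of p N] sigs_eq[of q N] sigs_eq[of "p + q" N]
    by (simp add: N_def sum.distrib scaleR_add_left)
qed

lemma sigs_smult: "sigs (smult c p) = c *\<^sub>R sigs p"
  using sigs_eq[of "smult c p" "degree p"]
  by (simp add: sigs_def scaleR_sum_right degree_smult_le)

lemma sigs_diff: "sigs (p - q) = sigs p - sigs q"
proof -
  have "p - q = p + smult (-1) q" by simp
  then show ?thesis by (simp only: sigs_add sigs_smult) simp
qed

lemma sigs_sum: "sigs (\<Sum>i\<in>I. f i) = (\<Sum>i\<in>I. sigs (f i))"
  by (induction I rule: infinite_finite_induct) (simp_all add: sigs_add)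

lemma sigs_monom: "sigs (monom c k) = c *\<^sub>R lag k"
proof -
  have "sigs (monom c k) = (\<Sum>j\<le>k. coeff (monom c k) j *\<^sub>R lag j)"
    by (rule sigs_eq) (rule degree_monom_le)
  also have "\<dots> = (\<Sum>j\<in>{k}. coeff (monom c k) j *\<^sub>R lag j)"
    by (rule sum.mono_neutral_right) auto
  finally show ?thesis by simp
qed

lemma sqi_sigs [simp]: "sqi (sigs p)"
  unfolding sigs_def by (intro sqi_sum sqi_scaleR) simp

lemma ip_lag_sigs: "ip (lag k) (sigs p) = coeff p k"
proof -
  have "ip (lag k) (sigs p) = (\<Sum>j\<le>max k (degree p). coeff p j * ip (lag k) (lag j))"
    by (subst sigs_eq[where N = "max k (degree p)"]) (simp_all add: ip_sum_right sqi_scaleR)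
  also have "\<dots> = coeff p k"
    by (simp add: ip_lag if_distrib sum.delta' cong: if_cong)
  finally show ?thesis .
qed

lemma ip_sigs:
  assumes "degree p \<le> N"
  shows "ip (sigs p) (sigs q) = (\<Sum>k\<le>N. coeff p k * coeff q k)"
  by (subst sigs_eq[OF assms]) (simp add: ip_sum_left sqi_scaleR ip_lag_sigs)

lemma sigs_pCons_0: "sigs (pCons 0 p) = (\<Sum>k\<le>degree p. coeff p k *\<^sub>R lag (Suc k))"
proof -
  have "sigs (pCons 0 p) = (\<Sum>k\<le>Suc (degree p). coeff (pCons 0 p) k *\<^sub>R lag k)"
    by (rule sigs_eq) (rule degree_pCons_le)
  then show ?thesis by (subst (asm) sum.atMost_Suc_shift) simp
qed

lemma sigs_one_minus: "sigs ([:1, -1:] * p) = sigs p - sigs (pCons 0 p)"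
proof -
  have "[:1, -1:] * p = p - pCons 0 p" by simp
  then show ?thesis by (simp only: sigs_diff)
qed

text \<open>Multiplication by \<open>(1 - z) / 2\<close> is the filter \<open>1 / (s + 1)\<close> with zero initial state.\<close>

lemma DERIV_sigs:
  "(sigs ([:1, -1:] * p) has_real_derivative sigs ([:1, 1:] * p) t) (at t within S)"
proof -
  have 1: "sigs ([:1, -1:] * p) = (\<lambda>t. \<Sum>k\<le>degree p. coeff p k * (lag k t - lag (Suc k) t))"
    by (unfold sigs_one_minus) (auto simp: sigs_pCons_0 sigs_def[of p] sum_fun_apply algebra_simps sum_subtractf)
  have 2: "sigs ([:1, 1:] * p) = (\<lambda>t. \<Sum>k\<le>degree p. coeff p k * (lag k t + lag (Suc k) t))"
    by (auto simp: sigs_add sigs_pCons_0 sigs_def[of p] sum_fun_apply algebra_simps sum.distrib)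
  show ?thesis
    unfolding 1 2 by (intro DERIV_sum DERIV_cmult DERIV_lag_diff)
qed

text \<open>All \<open>lag k\<close> agree at 0, so \<open>sigs p 0\<close> is sqrt 2 * p(1), which
  the factor 1 - z kills. This supplies the zero initial states below.\<close>

lemma sigs_diff_at_0 [simp]: "sigs ([:1, -1:] * p) 0 = 0"
  by (unfold sigs_one_minus) (simp add: sigs_pCons_0 sigs_def[of p] sum_fun_apply)

section \<open>Density of the Laguerre series in L2\<close>

definition lag_span_closure :: "(real \<Rightarrow> real) set" where
  "lag_span_closure = {f. sqi f \<and> (\<forall>\<delta>>0. \<exists>p. nsq (f - sigs p) < \<delta>)}"

lemma lag_span_closure_add:
  assumes "f \<in> lag_span_closure" "g \<in> lag_span_closure"
  shows "f + g \<in> lag_span_closure"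
proof -
  have s: "sqi f" "sqi g" using assms by (auto simp: lag_span_closure_def)
  have "\<exists>r. nsq (f + g - sigs r) < \<delta>" if "\<delta> > 0" for \<delta>
  proof -
    have d4: "\<delta> / 4 > 0" using that by simp
    obtain p q where p: "nsq (f - sigs p) < \<delta> / 4" and q: "nsq (g - sigs q) < \<delta> / 4"
      using assms d4 unfolding lag_span_closure_def by blast
    have eq: "f + g - sigs (p + q) = (f - sigs p) + (g - sigs q)"
      by (simp only: sigs_add add_diff_add)
    have "nsq (f + g - sigs (p + q)) < \<delta>"
      unfolding eq using ip_self_add_le[of "f - sigs p" "g - sigs q"] p q s by (simp add: sqi_diff)
    then show ?thesis by blast
  qed
  with s show ?thesis by (simp add: lag_span_closure_def sqi_add)
qed

lemma lag_span_closure_scaleR: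
  assumes "f \<in> lag_span_closure"
  shows "c *\<^sub>R f \<in> lag_span_closure"
proof -
  have s: "sqi f" using assms by (auto simp: lag_span_closure_def)
  have "\<exists>r. nsq (c *\<^sub>R f - sigs r) < \<delta>" if "\<delta> > 0" for \<delta>
  proof -
    have "\<delta> / (1 + c\<^sup>2) > 0" using that by (simp add: add_pos_nonneg)
    then obtain p where p: "nsq (f - sigs p) < \<delta> / (1 + c\<^sup>2)"
      using assms unfolding lag_span_closure_def by blast
    have "c *\<^sub>R f - sigs (smult c p) = c *\<^sub>R (f - sigs p)" by (simp only: sigs_smult scaleR_diff_right)
    then have "nsq (c *\<^sub>R f - sigs (smult c p))
        = c\<^sup>2 * nsq (f - sigs p)"
      by (simp only: ip_scaleR_left ip_scaleR_right power2_eq_square mult.assoc)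
    also have "\<dots> \<le> (1 + c\<^sup>2) * nsq (f - sigs p)"
      by (intro mult_right_mono) auto
    also have "\<dots> < \<delta>"
      using p by (simp add: pos_less_divide_eq add_pos_nonneg mult.commute)
    finally show ?thesis by blast
  qed
  with s show ?thesis by (simp add: lag_span_closure_def sqi_scaleR)
qed

lemma lag_span_closure_0: "0 \<in> lag_span_closure"
  by (auto simp: lag_span_closure_def intro!: exI[of _ 0])

lemma lag_span_closure_sum:
  "(\<And>i. i \<in> I \<Longrightarrow> f i \<in> lag_span_closure) \<Longrightarrow> (\<Sum>i\<in>I. f i) \<in> lag_span_closure"
  by (induction I rule: infinite_finite_induct) (auto simp: lag_span_closure_0 lag_span_closure_add)

lemma lag_span_closure_closed:
  assumes "sqi f" "\<And>\<delta>. \<delta> > 0 \<Longrightarrow> \<exists>g\<in>lag_span_closure. nsq (f - g) < \<delta>"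
  shows "f \<in> lag_span_closure"
proof -
  have "\<exists>r. nsq (f - sigs r) < \<delta>" if "\<delta> > 0" for \<delta>
  proof -
    have d4: "\<delta> / 4 > 0" using that by simp
    obtain g where g: "g \<in> lag_span_closure" "nsq (f - g) < \<delta> / 4"
      using assms(2)[OF d4] by blast
    then obtain p where p: "nsq (g - sigs p) < \<delta> / 4"
      using d4 unfolding lag_span_closure_def by blast
    have "nsq (f - sigs p) < \<delta>"
      using ip_self_diff_le[of f g "sigs p"] g p assms(1) by (simp add: lag_span_closure_def)
    then show ?thesis by blast
  qed
  with assms(1) show ?thesis by (simp add: lag_span_closure_def)
qed

text \<open>The Laguerre coefficients of an exponential satisfy Bessel's inequality with equality.\<close>

lemma expo_in_lag_span_closure:
  assumes "a > 0"
  shows "expo a \<in> lag_span_closure"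
proof -
  define c where "c k = ip (expo a) (lag k)" for k
  define r where "r = ((a - 1) / (a + 1))\<^sup>2"
  have r: "r < 1" "1 - r = 4 * a / (a + 1)\<^sup>2"
  proof -
    have nz: "(a + 1)\<^sup>2 \<noteq> 0" using assms by simp
    then have "(a + 1)\<^sup>2 * r = (a - 1)\<^sup>2" unfolding r_def power_divide by simp
    moreover have "(a + 1)\<^sup>2 - (a - 1)\<^sup>2 = 4 * a" by (simp add: power2_eq_square algebra_simps)
    ultimately have "(1 - r) * (a + 1)\<^sup>2 = 4 * a" unfolding left_diff_distrib mult.commute[of r] by linarith
    with nz show "1 - r = 4 * a / (a + 1)\<^sup>2" by (rule eq_divide_imp)
    with assms have "1 - r > 0" by simp
    then show "r < 1" by simp
  qed
  have c2: "(c k)\<^sup>2 = 2 / (a + 1)\<^sup>2 * r ^ k" for k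
  proof -
    have "(c k)\<^sup>2 = (sqrt 2 / (a + 1))\<^sup>2 * (((a - 1) / (a + 1)) ^ k)\<^sup>2"
      unfolding c_def ip_expo_lag[OF assms] by (rule power_mult_distrib)
    also have "(((a - 1) / (a + 1)) ^ k)\<^sup>2 = r ^ k"
      unfolding r_def power_mult[symmetric] mult.commute[of k] ..
    finally show ?thesis by (simp only: power_divide real_sqrt_pow2_iff) simp
  qed
  have "(\<lambda>k. (c k)\<^sup>2) sums (2 / (a + 1)\<^sup>2 * (1 / (1 - r)))"
    unfolding c2 using r by (intro sums_mult geometric_sums) (simp add: r_def)
  also have "2 / (a + 1)\<^sup>2 * (1 / (1 - r)) = 1 / (2 * a)"
  proof -
    define b where "b = (a + 1)\<^sup>2"
    have "b \<noteq> 0" using assms by (simp add: b_def)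
    then show ?thesis unfolding r(2) b_def[symmetric] using assms by simp
  qed
  finally have lim: "(\<lambda>N. \<Sum>k<N. (c k)\<^sup>2) \<longlonglongrightarrow> 1 / (2 * a)" by (simp add: sums_def)
  have ee: "nsq (expo a) = 1 / (2 * a)"
  proof -
    have "expo a t * expo a t = exp (- (2 * a) * t)" for t
      by (simp add: expo_def exp_add[symmetric])
    then show ?thesis
      using integrable_exp_halfline(2)[of "2 * a"] assms by (simp add: ip_def)
  qed
  have err: "nsq (expo a - sigs (\<Sum>k<N. monom (c k) k))
      = 1 / (2 * a) - (\<Sum>k<N. (c k)\<^sup>2)" for N
  proof -
    define s where "s = sigs (\<Sum>k<N. monom (c k) k)"
    have s: "s = (\<Sum>k<N. c k *\<^sub>R lag k)" by (simp add: s_def sigs_sum sigs_monom)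
    have es: "ip (expo a) s = (\<Sum>k<N. (c k)\<^sup>2)"
      using assms by (simp add: s ip_sum_right sqi_scaleR sqi_expo c_def power2_eq_square)
    have "ip (lag k) s = c k" if "k < N" for k
      using that by (simp add: s ip_sum_right sqi_scaleR ip_lag if_distrib sum.delta' cong: if_cong)
    then have ss: "nsq s = (\<Sum>k<N. (c k)\<^sup>2)"
      by (subst (1) s) (simp add: ip_sum_left sqi_scaleR sqi_sum s_def power2_eq_square)
    have "sqi s" by (simp add: s_def)
    then show ?thesis
      using es ss ee assms unfolding s_def[symmetric]
      by (simp add: ip_diff_left ip_diff_right sqi_diff sqi_expo ip_commute[of s "expo a"])
  qed
  have "\<exists>p. nsq (expo a - sigs p) < \<delta>" if "\<delta> > 0" for \<delta>
  proof -
    have "eventually (\<lambda>N. \<bar>(\<Sum>k<N. (c k)\<^sup>2) - 1 / (2 * a)\<bar> < \<delta>) sequentially"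
      using lim that by (auto simp: tendsto_iff dist_real_def)
    then obtain N where "\<bar>(\<Sum>k<N. (c k)\<^sup>2) - 1 / (2 * a)\<bar> < \<delta>"
      by (auto simp: eventually_sequentially)
    then show ?thesis using err[of N] by (intro exI[of _ "\<Sum>k<N. monom (c k) k"]) linarith
  qed
  with assms show ?thesis by (simp add: lag_span_closure_def sqi_expo)
qed

text \<open>The substitution u = e^(-t) maps the half-line to (0, 1]. After splitting off one factor
  e^(-t), Weierstrass approximation in u becomes approximation by sums of exponentials, uniformly
  with weight e^(-t) and hence in L2.\<close>

lemma continuous_compact_in_lag_span_closure:
  fixes f :: "real \<Rightarrow> real"
  assumes cont: "continuous_on UNIV f" and supp: "\<And>t. t \<ge> m \<Longrightarrow> f t = 0"
  shows "f \<in> lag_span_closure"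
proof -
  \<comment> \<open>The clamp keeps \<open>F\<close> continuous at u = 0: below exp (- m) its value
    is the constant f(m) / exp (- m), that is 0.\<close>
  define F where "F u = f (- ln (max u (exp (- m)))) / max u (exp (- m))" for u
  have F: "f t = exp (- t) * F (exp (- t))" for t
  proof (cases "t \<le> m")
    case True
    then have "max (exp (- t)) (exp (- m)) = exp (- t)" by simp
    then show ?thesis by (simp add: F_def)
  next
    case False
    then have "max (exp (- t)) (exp (- m)) = exp (- m)" by simp
    then show ?thesis using False supp[of m] supp[of t] by (simp add: F_def)
  qed
  have mpos: "max u (exp (- m)) \<noteq> 0" "max u (exp (- m)) > 0" for u :: real
    using exp_gt_zero[of "- m"] by (auto simp: max_def simp del: exp_gt_zero)
  have contF: "continuous_on {0..1} F"
    unfolding F_def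
    by (intro continuous_on_divide continuous_on_compose2[OF cont] continuous_intros)
      (use mpos in auto)
  have bd: "\<exists>C. \<forall>t\<ge>0. norm (f t) \<le> C * exp (- 1 * t)"
  proof -
    have "bounded (F ` {0..1})"
      by (intro compact_imp_bounded compact_continuous_image contF) simp
    then obtain C where C: "\<And>u. u \<in> {0..1} \<Longrightarrow> \<bar>F u\<bar> \<le> C"
      unfolding bounded_iff real_norm_def by blast
    have "norm (f t) \<le> C * exp (- 1 * t)" if "t \<ge> 0" for t
      using C[of "exp (- t)"] that by (subst F) (simp add: abs_mult mult.commute)
    then show ?thesis by blast
  qed
  then have sf: "sqi f"
    using sqi_exp_decay[of f 1] continuous_on_subset[OF cont] by auto
  show ?thesis
  proof (rule lag_span_closure_closed[OF sf])
    fix \<delta> :: real assume d: "\<delta> > 0"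
    define \<eta> where "\<eta> = sqrt \<delta>"
    have eta: "\<eta> > 0" "\<eta>\<^sup>2 = \<delta>" using d by (auto simp: \<eta>_def)
    obtain g where g: "real_polynomial_function g" "\<And>u. u \<in> {0..1} \<Longrightarrow> \<bar>F u - g u\<bar> < \<eta>"
      using Stone_Weierstrass_real_polynomial_function[OF compact_Icc contF eta(1)] by metis
    from g(1) obtain a n where ga: "g = (\<lambda>x. \<Sum>i\<le>n. a i * x ^ i)"
      by (auto simp: real_polynomial_function_iff_sum)
    \<comment> \<open>The factor split off from \<open>f\<close> shifts the exponents: u^i becomes
      \<open>expo (real (Suc i))\<close>, so the exponent 0, which is not square integrable, never
      occurs.\<close>
    define h where "h = (\<Sum>i\<le>n. a i *\<^sub>R expo (real (Suc i)))"
    have h: "h \<in> lag_span_closure"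
      unfolding h_def
      by (intro lag_span_closure_sum lag_span_closure_scaleR expo_in_lag_span_closure) simp
    have ht: "h t = exp (- t) * g (exp (- t))" for t
      by (simp add: h_def ga sum_fun_apply expo_def sum_distrib_left exp_of_nat_mult[symmetric]
          exp_add[symmetric] algebra_simps)
    have "nsq (f - h) \<le> \<delta> * nsq (expo 1)"
    proof (rule ip_self_mono)
      show "sqi (f - h)" using sf h by (simp add: sqi_diff lag_span_closure_def)
      fix t :: real assume "t \<ge> 0"
      then have "\<bar>F (exp (- t)) - g (exp (- t))\<bar> \<le> \<eta>" using g(2)[of "exp (- t)"] by simp
      then have "\<bar>F (exp (- t)) - g (exp (- t))\<bar>\<^sup>2 \<le> \<delta>" unfolding eta(2)[symmetric] by (intro power_mono) auto
      then have "(exp (- t))\<^sup>2 * \<bar>F (exp (- t)) - g (exp (- t))\<bar>\<^sup>2 \<le> (exp (- t))\<^sup>2 * \<delta>"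
        by (intro mult_left_mono) auto
      moreover have "(f - h) t = exp (- t) * (F (exp (- t)) - g (exp (- t)))"
        by (simp add: ht F[of t] right_diff_distrib)
      ultimately show "(norm ((f - h) t))\<^sup>2 \<le> \<delta> * (norm (expo 1 t))\<^sup>2"
        by (simp add: power_mult_distrib expo_def mult.commute)
    qed (simp add: sqi_expo)
    also have "nsq (expo 1) = 1 / 2"
      using integrable_exp_halfline(2)[of 2] by (simp add: ip_def expo_def exp_add[symmetric])
    also have "\<delta> * (1 / 2) < \<delta>" using d by simp
    finally show "\<exists>g\<in>lag_span_closure. nsq (f - g) < \<delta>" using h by blast
  qed
qed

lemma ip_dominated_convergence:
  fixes f :: "real \<Rightarrow> real"
  assumes "sqi f" "\<And>n. sqi (u n)" "AE t in halfline. (\<lambda>n. u n t) \<longlonglongrightarrow> f t"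
    and "integrable halfline w" "\<And>n t. t \<ge> 0 \<Longrightarrow> \<bar>f t - u n t\<bar>\<^sup>2 \<le> w t"
  shows "(\<lambda>n. nsq (f - u n)) \<longlonglongrightarrow> 0"
proof -
  have "(\<lambda>n. LINT t|halfline. (f t - u n t)\<^sup>2) \<longlonglongrightarrow> (LINT t|halfline. 0::real)"
  proof (rule integral_dominated_convergence[where w = w])
    show "AE t in halfline. (\<lambda>n. (f t - u n t)\<^sup>2) \<longlonglongrightarrow> 0"
      using assms(3)
    proof eventually_elim
      case (elim t)
      then have "(\<lambda>n. (f t - u n t)\<^sup>2) \<longlonglongrightarrow> (f t - f t)\<^sup>2" by (intro tendsto_intros)
      then show ?case by simp
    qed
    show "AE t in halfline. norm ((f t - u n t)\<^sup>2) \<le> w t" for n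
      using assms(5) by (intro AE_I2) auto
    show "(\<lambda>t. (f t - u n t)\<^sup>2) \<in> borel_measurable halfline" for n
      using assms(1) assms(2)[of n] by (auto simp: sqi_def)
  qed (use assms in auto)
  then show ?thesis by (simp add: ip_def power2_eq_square)
qed

lemma exists_ip_less:
  assumes "(\<lambda>n. nsq (f - u n)) \<longlonglongrightarrow> 0" "\<And>n. u n \<in> S" "\<delta> > 0"
  shows "\<exists>g\<in>S. nsq (f - g) < \<delta>"
proof -
  have "eventually (\<lambda>n. nsq (f - u n) < \<delta>) sequentially"
    using assms(1,3) by (rule order_tendstoD)
  then show ?thesis using assms(2) by (auto simp: eventually_sequentially)
qed

text \<open>\<open>measurable_on\<close> supplies continuous \<open>g n\<close> converging almost
  everywhere. Clamping values by \<open>cl\<close> and cutting off in time by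
  \<open>\<theta>\<close> makes them vanish for large t under a common dominating function; letting
  m grow then recovers \<open>f\<close>.\<close>

lemma sqi_in_lag_span_closure:
  fixes f :: "real \<Rightarrow> real"
  assumes f: "sqi f"
  shows "f \<in> lag_span_closure"
proof -
  define \<theta> :: "nat \<Rightarrow> real \<Rightarrow> real" where "\<theta> m t = max 0 (min 1 (real m + 1 - t))" for m t
  define cl :: "nat \<Rightarrow> real \<Rightarrow> real" where "cl m x = max (- real m) (min (real m) x)" for m x
  have chi: "0 \<le> \<theta> m t" "\<theta> m t \<le> 1" for m t by (auto simp: \<theta>_def)
  have chi0: "\<theta> m t = 0" if "t \<ge> real m + 1" for m t using that by (auto simp: \<theta>_def)
  have cl: "\<bar>cl m x\<bar> \<le> real m" "\<bar>cl m x\<bar> \<le> \<bar>x\<bar>" for m x by (auto simp: cl_def)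
  have contcl: "continuous_on UNIV (cl m)" for m unfolding cl_def by (intro continuous_intros)
  have contchi: "continuous_on UNIV (\<theta> m)" for m unfolding \<theta>_def by (intro continuous_intros)
  have "f measurable_on {0..}"
    using f by (simp add: sqi_def measurable_on_iff_borel_measurable)
  then obtain N g where N: "negligible N" and g: "\<And>n. continuous_on UNIV (g n)"
    and lim: "\<And>x. x \<notin> N \<Longrightarrow> (\<lambda>n. g n x) \<longlonglongrightarrow> (if x \<in> {0..} then f x else 0)"
    unfolding measurable_on_def by blast
  have AE_N: "AE t in halfline. t \<notin> N"
  proof -
    have "N \<in> null_sets lebesgue" using N by (simp add: negligible_iff_null_sets)
    then have "AE t in lebesgue. t \<notin> N" by (rule AE_not_in)
    then show ?thesis by (auto simp: AE_restrict_space_iff)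
  qed
  have meas: "(\<lambda>t. cl m (f t) * \<theta> m t) \<in> borel_measurable halfline" for m
  proof (intro borel_measurable_times)
    show "(\<lambda>t. cl m (f t)) \<in> borel_measurable halfline"
      using measurable_compose[OF sqi_measurable[OF f] borel_measurable_continuous_onI[OF contcl]] .
    show "\<theta> m \<in> borel_measurable halfline"
      by (intro continuous_imp_measurable_on_sets_lebesgue continuous_on_subset[OF contchi]) auto
  qed
  have le: "\<bar>cl m x * \<theta> m t\<bar> \<le> \<bar>x\<bar>" for m x t
    using mult_mono[OF cl(2)[of m x] chi(2)[of m t]] chi[of m t] by (simp add: abs_mult)
  have s: "sqi (\<lambda>t. cl m (f t) * \<theta> m t)" for m
    unfolding sqi_def
  proof (intro conjI meas)
    show "integrable halfline (\<lambda>t. (norm (cl m (f t) * \<theta> m t))\<^sup>2)"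
    proof (rule Bochner_Integration.integrable_bound)
      show "integrable halfline (\<lambda>t. (norm (f t))\<^sup>2)" using f by (simp add: sqi_def)
      show "(\<lambda>t. (norm (cl m (f t) * \<theta> m t))\<^sup>2) \<in> borel_measurable halfline"
        using meas[of m] by measurable
      show "AE t in halfline. norm ((norm (cl m (f t) * \<theta> m t))\<^sup>2) \<le> norm ((norm (f t))\<^sup>2)"
        using le by (intro AE_I2) (auto simp: abs_le_square_iff[symmetric])
    qed
  qed
  have trunc: "(\<lambda>t. cl m (f t) * \<theta> m t) \<in> lag_span_closure" for m
  proof (rule lag_span_closure_closed[OF s])
    fix \<delta> :: real assume d: "\<delta> > 0"
    have in_cl: "(\<lambda>t. cl m (g n t) * \<theta> m t) \<in> lag_span_closure" for n
    proof (rule continuous_compact_in_lag_span_closure)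
      show "continuous_on UNIV (\<lambda>t. cl m (g n t) * \<theta> m t)"
        by (intro continuous_intros continuous_on_compose2[OF contcl] g contchi) auto
      show "cl m (g n t) * \<theta> m t = 0" if "t \<ge> real m + 1" for t using chi0[OF that] by simp
    qed
    have "(\<lambda>n. nsq ((\<lambda>t. cl m (f t) * \<theta> m t) - (\<lambda>t. cl m (g n t) * \<theta> m t))) \<longlonglongrightarrow> 0"
    proof (rule ip_dominated_convergence[OF s])
      show "sqi (\<lambda>t. cl m (g n t) * \<theta> m t)" for n
        using in_cl[of n] by (simp add: lag_span_closure_def)
      show "AE t in halfline. (\<lambda>n. cl m (g n t) * \<theta> m t) \<longlonglongrightarrow> cl m (f t) * \<theta> m t"
        using AE_N AE_space
      proof eventually_elim
        case (elim t)
        then have "(\<lambda>n. g n t) \<longlonglongrightarrow> f t" using lim[of t] by simp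
        then show ?case unfolding cl_def by (intro tendsto_intros)
      qed
      \<comment> \<open>The difference is at most 2 m and vanishes for t at least m + 1, so 2 m exp
        (m + 1 - t) dominates it.\<close>
      show "integrable halfline (\<lambda>t. (2 * real m * exp (real m + 1))\<^sup>2 * exp (- 2 * t))"
        using integrable_exp_halfline[of 2] by simp
      fix n and t :: real assume "t \<ge> 0"
      have "\<bar>cl m (f t) * \<theta> m t - cl m (g n t) * \<theta> m t\<bar> \<le> 2 * real m * exp (real m + 1) * exp (- t)"
      proof (cases "t \<ge> real m + 1")
        case False
        then have "\<bar>cl m (f t) - cl m (g n t)\<bar> * \<theta> m t \<le> (2 * real m) * 1"
          using cl(1)[of m "f t"] cl(1)[of m "g n t"] chi by (intro mult_mono) auto
        also have "\<dots> \<le> 2 * real m * exp (real m + 1 - t)"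
          using False by (intro mult_left_mono) auto
        also have "\<dots> = 2 * real m * exp (real m + 1) * exp (- t)"
          by (simp add: exp_add[symmetric])
        finally show ?thesis
          using chi(1)[of m t] by (simp add: left_diff_distrib[symmetric] abs_mult)
      qed (simp add: chi0)
      then have "\<bar>cl m (f t) * \<theta> m t - cl m (g n t) * \<theta> m t\<bar>\<^sup>2 \<le> (2 * real m * exp (real m + 1) * exp (- t))\<^sup>2"
        by (intro power_mono) auto
      then show "\<bar>cl m (f t) * \<theta> m t - cl m (g n t) * \<theta> m t\<bar>\<^sup>2
          \<le> (2 * real m * exp (real m + 1))\<^sup>2 * exp (- 2 * t)"
        by (simp add: power_mult_distrib exp_double[symmetric])
    qed
    then show "\<exists>h\<in>lag_span_closure. nsq ((\<lambda>t. cl m (f t) * \<theta> m t) - h) < \<delta>"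
      by (rule exists_ip_less[OF _ in_cl d])
  qed
  show ?thesis
  proof (rule lag_span_closure_closed[OF f])
    fix \<delta> :: real assume d: "\<delta> > 0"
    have "(\<lambda>m. nsq (f - (\<lambda>t. cl m (f t) * \<theta> m t))) \<longlonglongrightarrow> 0"
    proof (rule ip_dominated_convergence[OF f s])
      show "AE t in halfline. (\<lambda>m. cl m (f t) * \<theta> m t) \<longlonglongrightarrow> f t"
      proof (intro AE_I2 tendsto_eventually)
        fix t
        obtain M where M: "max \<bar>f t\<bar> t \<le> real M" using real_arch_simple by blast
        have "cl m (f t) * \<theta> m t = f t" if "m \<ge> M" for m
        proof -
          have "max \<bar>f t\<bar> t \<le> real m" using M that by linarith
          then show ?thesis by (auto simp: cl_def \<theta>_def)
        qed
        then show "\<forall>\<^sub>F m in sequentially. cl m (f t) * \<theta> m t = f t"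
          by (auto simp: eventually_sequentially)
      qed
      show "integrable halfline (\<lambda>t. 4 * (norm (f t))\<^sup>2)" using f by (simp add: sqi_def)
      show "\<bar>f t - cl m (f t) * \<theta> m t\<bar>\<^sup>2 \<le> 4 * (norm (f t))\<^sup>2" for m t
      proof -
        have "\<bar>f t - cl m (f t) * \<theta> m t\<bar>\<^sup>2 \<le> (2 * \<bar>f t\<bar>)\<^sup>2"
          using le[of m "f t" t] by (intro power_mono) auto
        then show ?thesis by (simp add: power_mult_distrib)
      qed
    qed
    then show "\<exists>h\<in>lag_span_closure. nsq (f - h) < \<delta>"
      by (rule exists_ip_less[OF _ trunc d])
  qed
qed

lemma sigs_dense:
  assumes "sqi f" "\<delta> > 0"
  obtains p where "nsq (f - sigs p) < \<delta>"
  using sqi_in_lag_span_closure[OF assms(1)] assms(2) by (auto simp: lag_span_closure_def)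

subsection \<open>Polynomials on the unit circle\<close>

text \<open>The adjugate, with cofactors written as determinants with row j replaced by a unit
  vector. It exists over any commutative ring, hence for polynomial matrices, where it plays the
  part of an inverse up to the determinant.\<close>

definition adjp :: "'a::comm_ring_1^'n^'n \<Rightarrow> 'a^'n^'n" where
  "adjp A = (\<chi> k j. det (\<chi> i. if i = j then axis k 1 else A $ i))"

text \<open>Linearity in row j collects the sum into the determinant of \<open>A\<close> with row j
  replaced by row i, which has two equal rows unless i = j.\<close>

lemma matrix_mul_adjp: "A ** adjp A = mat (det A)"
proof -
  have "(A ** adjp A) $ i $ j = mat (det A) $ i $ j" for i j
  proof -
    have "(A ** adjp A) $ i $ j
        = (\<Sum>k\<in>UNIV. det (\<chi> r. if r = j then A $ i $ k *s axis k 1 else A $ r))"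
      by (simp add: matrix_matrix_mult_def adjp_def det_row_mul)
    also have "\<dots> = det (\<chi> r. if r = j then (\<Sum>k\<in>UNIV. A $ i $ k *s axis k 1) else A $ r)"
      by (rule det_linear_row_sum[symmetric]) simp
    also have "(\<Sum>k\<in>UNIV. A $ i $ k *s axis k 1) = A $ i"
      by (simp add: vec_eq_iff axis_def if_distrib sum.delta cong: if_cong)
    also have "det (\<chi> r. if r = j then A $ i else A $ r) = mat (det A) $ i $ j"
    proof (cases "i = j")
      case True
      then have "(\<chi> r. if r = j then A $ i else A $ r) = A" by (simp add: vec_eq_iff)
      with True show ?thesis by (simp add: mat_def)
    next
      case False
      have "det (\<chi> r. if r = j then A $ i else A $ r) = 0"
        by (rule det_identical_rows[OF False]) (use False in \<open>simp add: row_def vec_eq_iff\<close>)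
      with False show ?thesis by (simp add: mat_def)
    qed
    finally show ?thesis .
  qed
  then show ?thesis by (simp add: vec_eq_iff)
qed

lemma mat_mult_vector: "mat c *v x = c *s (x :: 'a::comm_ring_1^'n)"
  by (simp add: vec_eq_iff matrix_vector_mult_def mat_def if_distrib if_distribR sum.delta' cong: if_cong)

lemma mult_adjp_vector: "A *v (adjp A *v x) = det A *s x"
  by (simp add: matrix_vector_mul_assoc matrix_mul_adjp mat_mult_vector)

section \<open>Evaluation on the unit circle and the discrete Parseval identity\<close>

definition cp :: "real poly \<Rightarrow> complex \<Rightarrow> complex" where
  "cp p z = poly (map_poly complex_of_real p) z"

lemma cp_pCons [simp]: "cp (pCons a p) z = of_real a + z * cp p z"
  by (simp add: cp_def map_poly_pCons)

lemma cp_0 [simp]: "cp 0 z = 0" and cp_1 [simp]: "cp 1 z = 1"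
  by (simp_all add: cp_def)

lemma cp_add [simp]: "cp (p + q) z = cp p z + cp q z"
  by (induction p q rule: poly_induct2) (simp_all add: algebra_simps)

lemma cp_smult [simp]: "cp (smult a p) z = of_real a * cp p z"
  by (induction p) (simp_all add: algebra_simps)

lemma cp_minus [simp]: "cp (- p) z = - cp p z"
  using cp_add[of p "- p" z] by (simp add: add_eq_0_iff2)

lemma cp_diff [simp]: "cp (p - q) z = cp p z - cp q z"
  using cp_add[of p "- q" z] by simp

lemma cp_mult [simp]: "cp (p * q) z = cp p z * cp q z"
  by (induction p) (simp_all add: algebra_simps)

lemma cp_sum [simp]: "cp (sum f I) z = (\<Sum>i\<in>I. cp (f i) z)"
  by (induction I rule: infinite_finite_induct) simp_all

lemma cp_prod [simp]: "cp (prod f I) z = (\<Prod>i\<in>I. cp (f i) z)"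
  by (induction I rule: infinite_finite_induct) simp_all

lemma cp_of_int [simp]: "cp (of_int k) z = of_int k"
  by (simp add: of_int_poly)

definition cev :: "real poly^'m \<Rightarrow> complex \<Rightarrow> complex^'m" where
  "cev U z = (\<chi> i. cp (U $ i) z)"

definition cem :: "real poly^'m^'n \<Rightarrow> complex \<Rightarrow> complex^'m^'n" where
  "cem M z = (\<chi> i j. cp (M $ i $ j) z)"

lemma cev_mult: "cev (M *v U) z = cem M z *v cev U z"
  by (simp add: cev_def cem_def vec_eq_iff matrix_vector_mult_def)

lemma cev_scale: "cev (p *s U) z = cp p z *s cev U z"
  by (simp add: cev_def vec_eq_iff)

lemma cp_det: "cp (det M) z = det (cem M z)"
  by (simp add: det_def cem_def)

text \<open>The roots of \<open>z ^ N = - 1\<close>; they avoid the point 1, the image of infinity under the Cayley transform.\<close>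

definition circ :: "nat \<Rightarrow> nat \<Rightarrow> complex" where
  "circ N j = cis (pi * (2 * real j + 1) / real N)"

lemma norm_circ [simp]: "cmod (circ N j) = 1"
  by (simp add: circ_def)

lemma circ_neq_1 [simp]: "N > 0 \<Longrightarrow> circ N j \<noteq> 1"
proof
  assume "N > 0" "circ N j = 1"
  have "circ N j ^ N = cis (pi * (2 * real j + 1))"
    using \<open>N > 0\<close> unfolding circ_def Complex.DeMoivre by simp
  also have "pi * (2 * real j + 1) = 2 * pi * real j + pi" by (simp add: algebra_simps)
  also have "cis (2 * pi * real j + pi) = - 1"
    by (simp add: cis_mult[symmetric] cis_multiple_2pi)
  finally show False using \<open>circ N j = 1\<close> by simp
qed

text \<open>A geometric sum: the half-step offset of the nodes contributes only the common factor
  \<open>w\<close>, and the ratio \<open>w\<^sup>2\<close> is an N-th root of unity, different from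
  1 because 0 < b - a < N.\<close>

lemma sum_circ_aux:
  assumes "a \<le> b" "b < N"
  shows "(\<Sum>j<N. cnj (circ N j ^ a) * circ N j ^ b) = (if a = b then of_nat N else 0)"
proof -
  define w where "w = cis (pi * real (b - a) / real N)"
  have N: "N > 0" using assms by simp
  have *: "cnj (circ N j ^ a) * circ N j ^ b = w * (w\<^sup>2) ^ j" for j
  proof -
    have "cnj (circ N j ^ a) * circ N j ^ b
        = cis (- (real a * (pi * (2 * real j + 1) / real N)) + real b * (pi * (2 * real j + 1) / real N))"
      unfolding circ_def Complex.DeMoivre complex_cnj_power cis_cnj cis_mult by simp
    also have "- (real a * (pi * (2 * real j + 1) / real N)) + real b * (pi * (2 * real j + 1) / real N)
        = pi * real (b - a) / real N + real (2 * j) * (pi * real (b - a) / real N)"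
      using assms N by (simp add: field_simps of_nat_diff)
    also have "cis \<dots> = w * w ^ (2 * j)"
      by (simp only: w_def Complex.DeMoivre cis_mult)
    finally show ?thesis by (simp add: power_mult)
  qed
  show ?thesis
  proof (cases "a = b")
    case True
    then show ?thesis unfolding * by (simp add: w_def)
  next
    case False
    have "w\<^sup>2 \<noteq> 1"
    proof
      assume "w\<^sup>2 = 1"
      then have "cis (2 * (pi * real (b - a) / real N)) = 1"
        unfolding w_def Complex.DeMoivre by simp
      then have "cos (2 * (pi * real (b - a) / real N)) = 1"
        by (simp add: complex_eq_iff)
      then obtain k :: int where k: "2 * (pi * real (b - a) / real N) = real_of_int k * 2 * pi"
        by (auto simp: cos_one_2pi_int)
      then have "2 * pi * (real (b - a) / real N) = 2 * pi * real_of_int k" by (simp add: mult_ac)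
      then have e: "real (b - a) / real N = real_of_int k"
        by (metis mult_cancel_left mult_eq_0_iff pi_neq_zero zero_neq_numeral)
      have "0 < real (b - a) / real N" "real (b - a) / real N < 1"
        using False assms N by auto
      then show False unfolding e by simp
    qed
    moreover have "(w\<^sup>2) ^ N = 1"
    proof -
      have "(w\<^sup>2) ^ N = cis (real (2 * N) * (pi * real (b - a) / real N))"
        unfolding power_mult[symmetric] w_def Complex.DeMoivre by (simp add: mult_ac)
      also have "real (2 * N) * (pi * real (b - a) / real N) = 2 * pi * real (b - a)"
        using N by simp
      finally show ?thesis by (simp add: cis_multiple_2pi)
    qed
    ultimately have "(\<Sum>j<N. (w\<^sup>2) ^ j) = 0"
      by (simp add: sum_gp_strict)
    with False show ?thesis unfolding * by (simp add: sum_distrib_left[symmetric])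
  qed
qed

lemma sum_circ:
  assumes "a < N" "b < N"
  shows "(\<Sum>j<N. cnj (circ N j ^ a) * circ N j ^ b) = (if a = b then of_nat N else 0)"
proof (cases "a \<le> b")
  case False
  then have "cnj (\<Sum>j<N. cnj (circ N j ^ b) * circ N j ^ a) = 0"
    using sum_circ_aux[of b a N] assms by simp
  then show ?thesis using False by (simp add: mult.commute)
qed (use sum_circ_aux assms in simp)

lemma poly_eq_sum_lessThan:
  fixes p :: "complex poly"
  assumes "degree p < N"
  shows "poly p z = (\<Sum>k<N. coeff p k * z ^ k)"
proof -
  have "{..degree p} \<subseteq> {..<N}" using assms by auto
  then have "(\<Sum>k\<le>degree p. coeff p k * z ^ k) = (\<Sum>k<N. coeff p k * z ^ k)"
    by (rule sum.mono_neutral_left[OF finite_lessThan]) (auto simp: coeff_eq_0 not_le)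
  then show ?thesis by (simp only: poly_altdef)
qed

text \<open>Below degree N the average over N nodes is exact, so integrals over the circle are
  replaced by finite sums and the point 1 is never sampled.\<close>

lemma circ_Parseval:
  assumes "degree p < N" "degree q < N"
  shows "(\<Sum>j<N. cnj (poly p (circ N j)) * poly q (circ N j))
    = of_nat N * (\<Sum>k<N. cnj (coeff p k) * coeff q k)"
proof -
  have "(\<Sum>j<N. cnj (poly p (circ N j)) * poly q (circ N j))
      = (\<Sum>j<N. \<Sum>a<N. \<Sum>b<N. cnj (coeff p a) * coeff q b * (cnj (circ N j ^ a) * circ N j ^ b))"
    unfolding poly_eq_sum_lessThan[OF assms(1)] poly_eq_sum_lessThan[OF assms(2)]
    by (simp add: sum_product mult.assoc mult.left_commute)
  also have "\<dots> = (\<Sum>a<N. \<Sum>b<N. \<Sum>j<N. cnj (coeff p a) * coeff q b * (cnj (circ N j ^ a) * circ N j ^ b))"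
  proof -
    have "(\<Sum>j<N. \<Sum>a<N. \<Sum>b<N. F a b j) = (\<Sum>a<N. \<Sum>b<N. \<Sum>j<N. F a b j)" for F :: "nat \<Rightarrow> nat \<Rightarrow> nat \<Rightarrow> complex"
      by (subst sum.swap) (intro sum.cong refl sum.swap)
    then show ?thesis .
  qed
  also have "\<dots> = (\<Sum>a<N. \<Sum>b<N. cnj (coeff p a) * coeff q b * (if a = b then of_nat N else 0))"
    by (intro sum.cong refl) (simp only: sum_distrib_left[symmetric] sum_circ lessThan_iff)
  also have "\<dots> = (\<Sum>a<N. of_nat N * (cnj (coeff p a) * coeff q a))"
    by (intro sum.cong refl) (simp add: if_distrib sum.delta' algebra_simps cong: if_cong)
  finally show ?thesis by (simp add: sum_distrib_left)
qed

section \<open>The coefficient norm and dense multiples of a polynomial\<close>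

definition n2 :: "complex poly \<Rightarrow> real" where
  "n2 p = (\<Sum>k\<le>degree p. (cmod (coeff p k))\<^sup>2)"

lemma n2_eq: "degree p < N \<Longrightarrow> n2 p = (\<Sum>k<N. (cmod (coeff p k))\<^sup>2)"
  unfolding n2_def by (intro sum.mono_neutral_left) (auto simp: coeff_eq_0)

lemma n2_nonneg [simp]: "0 \<le> n2 p"
  by (simp add: n2_def sum_nonneg)

lemma n2_circ:
  assumes "degree p < N"
  shows "(\<Sum>j<N. (cmod (poly p (circ N j)))\<^sup>2) = real N * n2 p"
proof -
  have "complex_of_real (\<Sum>j<N. (cmod (poly p (circ N j)))\<^sup>2) = complex_of_real (real N * n2 p)"
    using circ_Parseval[OF assms assms]
    by (simp add: n2_eq[OF assms] complex_norm_square[symmetric] mult.commute[of "cnj _"] del: of_real_power)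
  then show ?thesis by (simp only: of_real_eq_iff)
qed

lemma n2_le_circ:
  assumes "\<And>z. cmod z = 1 \<Longrightarrow> z \<noteq> 1 \<Longrightarrow> (cmod (poly p z))\<^sup>2 \<le> c * (cmod (poly q z))\<^sup>2"
  shows "n2 p \<le> c * n2 q"
proof -
  define N where "N = Suc (max (degree p) (degree q))"
  have N: "degree p < N" "degree q < N" "N > 0" by (auto simp: N_def)
  have "real N * n2 p \<le> real N * (c * n2 q)"
    using sum_mono[of "{..<N}" "\<lambda>j. (cmod (poly p (circ N j)))\<^sup>2" "\<lambda>j. c * (cmod (poly q (circ N j)))\<^sup>2"]
      assms N by (simp add: n2_circ sum_distrib_left[symmetric] mult.left_commute)
  then show ?thesis using N by simp
qed

lemma poly_bounded_circ:
  fixes p :: "complex poly"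
  obtains K where "K > 0" "\<And>z. cmod z = 1 \<Longrightarrow> cmod (poly p z) \<le> K"
proof -
  have "bounded (poly p ` sphere 0 1)"
    by (intro compact_imp_bounded compact_continuous_image continuous_intros) simp
  then obtain K where "K > 0" "\<And>z. z \<in> sphere 0 1 \<Longrightarrow> cmod (poly p z) \<le> K"
    by (auto simp: bounded_pos)
  then show ?thesis by (intro that[of K]) auto
qed

lemma n2_mult_le:
  obtains K where "K > 0" "\<And>q. n2 (p * q) \<le> K * n2 q"
proof -
  obtain K where K: "K > 0" "\<And>z. cmod z = 1 \<Longrightarrow> cmod (poly p z) \<le> K"
    using poly_bounded_circ by blast
  have "n2 (p * q) \<le> K\<^sup>2 * n2 q" for q
    by (rule n2_le_circ) (use K in \<open>auto simp: norm_mult power_mult_distrib intro!: mult_right_mono power_mono\<close>)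
  with K(1) show ?thesis by (intro that[of "K\<^sup>2"]) auto
qed

lemma n2_add_le: "n2 (p + q) \<le> 2 * n2 p + 2 * n2 q"
proof -
  define N where "N = Suc (max (degree p) (degree q))"
  have N: "degree p < N" "degree q < N" "degree (p + q) < N"
    by (auto simp: N_def less_Suc_eq_le intro: degree_add_le_max)
  have "(cmod (x + y))\<^sup>2 \<le> 2 * (cmod x)\<^sup>2 + 2 * (cmod y)\<^sup>2" for x y
  proof -
    have "(cmod (x + y))\<^sup>2 \<le> (cmod x + cmod y)\<^sup>2" by (intro power_mono norm_triangle_ineq) simp
    also have "\<dots> \<le> 2 * (cmod x)\<^sup>2 + 2 * (cmod y)\<^sup>2"
      using sum_squares_bound[of "cmod x" "cmod y"] by (simp add: power2_sum)
    finally show ?thesis .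
  qed
  then show ?thesis
    by (auto simp: n2_eq[OF N(1)] n2_eq[OF N(2)] n2_eq[OF N(3)] sum_distrib_left
        sum.distrib[symmetric] intro!: sum_mono)
qed

text \<open>Cesaro means of the geometric series for the inverse of a linear factor.\<close>

lemma linear_factor_almost_invertible:
  assumes "cmod \<zeta> \<ge> 1" "N > 0"
  obtains s where "n2 ([:- \<zeta>, 1:] * s - 1) \<le> 1 / real N"
proof -
  \<comment> \<open>Coefficients of the series -(1 / \<zeta>) * sum of (z / \<zeta>)^j for 1 / (z -
    \<zeta>), damped by 1 - j / N. The damping spreads the residual over N coefficients of size at
    most 1 / N, whose squares sum to at most 1 / N.\<close>
  define f where "f j = - complex_of_real (1 - real j / real N) * (1 / \<zeta>) ^ Suc j" for j
  define s where "s = (\<Sum>j<N. monom (f j) j)"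
  have z: "\<zeta> \<noteq> 0" using assms by auto
  have cs: "coeff s k = (if k < N then f k else 0)" for k
    by (simp add: s_def coeff_sum sum.delta)
  \<comment> \<open>The weight at index N is 0, so \<open>coeff s\<close> may be read with either
    bound and the last coefficient of the residual is no exception.\<close>
  have fN: "f N = 0" using assms by (simp add: f_def)
  have cs': "coeff s k = (if k \<le> N then f k else 0)" for k
    using fN by (auto simp: cs le_less)
  define r where "r = [:- \<zeta>, 1:] * s - 1"
  have r: "coeff r k = (if 1 \<le> k \<and> k \<le> N then - (1 / of_nat N) * (1 / \<zeta>) ^ k else 0)" for k
  proof (cases k)
    case 0
    then show ?thesis using z assms by (simp add: r_def cs f_def)
  next
    case (Suc j)
    have "coeff r k = coeff s j - \<zeta> * coeff s (Suc j)" by (simp add: r_def Suc)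
    also have "\<dots> = (if j < N then f j - \<zeta> * f (Suc j) else 0)"
      unfolding cs[of j] cs'[of "Suc j"] by simp
    also have "f j - \<zeta> * f (Suc j) = - (1 / of_nat N) * (1 / \<zeta>) ^ k"
      using z assms by (simp add: f_def Suc field_simps)
    finally show ?thesis using Suc by simp
  qed
  have deg: "degree r \<le> N" by (rule degree_le) (simp add: r)
  have "n2 r = (\<Sum>k<Suc N. (cmod (coeff r k))\<^sup>2)"
    using deg by (intro n2_eq) simp
  also have "\<dots> = (\<Sum>k\<in>{1..N}. (cmod (coeff r k))\<^sup>2)"
    by (intro sum.mono_neutral_right) (auto simp: r)
  also have "\<dots> \<le> (\<Sum>k\<in>{1..N}. (1 / real N)\<^sup>2)"
  proof (rule sum_mono)
    fix k assume "k \<in> {1..N}"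
    have "cmod (coeff r k) = 1 / real N * (1 / cmod \<zeta>) ^ k"
      using \<open>k \<in> {1..N}\<close> by (simp add: r norm_mult norm_divide norm_power)
    also have "\<dots> \<le> 1 / real N * 1"
      using assms by (intro mult_left_mono power_le_one) (auto simp: divide_le_eq_1)
    finally show "(cmod (coeff r k))\<^sup>2 \<le> (1 / real N)\<^sup>2" by (intro power_mono) auto
  qed
  also have "\<dots> = 1 / real N" using assms by (simp add: power2_eq_square)
  finally show ?thesis using that[of s] by (simp add: r_def)
qed

lemma complex_poly_root_induct [consumes 1, case_names const root]:
  fixes p :: "complex poly"
  assumes "p \<noteq> 0" "\<And>c. c \<noteq> 0 \<Longrightarrow> P [:c:]"
    and "\<And>\<zeta> q. q \<noteq> 0 \<Longrightarrow> P q \<Longrightarrow> P ([:- \<zeta>, 1:] * q)"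
  shows "P p"
  using assms(1)
proof (induction "degree p" arbitrary: p)
  case 0
  then obtain c where "p = [:c:]" by (metis degree_eq_zeroE)
  with 0 assms(2) show ?case by auto
next
  case (Suc n)
  have "\<not> constant (poly p)" using Suc by (simp add: constant_degree)
  then obtain \<zeta> where "poly p \<zeta> = 0" using fundamental_theorem_of_algebra by blast
  then obtain q where q: "p = [:- \<zeta>, 1:] * q" by (metis dvdE poly_eq_0_iff_dvd)
  with Suc have "q \<noteq> 0" by auto
  moreover have "degree p = Suc (degree q)" using q \<open>q \<noteq> 0\<close> by (simp add: degree_mult_eq del: mult_pCons_left)
  ultimately have "P q" using Suc by simp
  with \<open>q \<noteq> 0\<close> show ?case unfolding q by (intro assms(3))
qed

text \<open>A polynomial without zeros in the open disc is outer, hence cyclic in the Hardy space.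
  Roots are added one at a time; roots on the circle are allowed, where division is possible only
  approximately.\<close>

lemma complex_multiples_dense:
  assumes "\<And>z. cmod z < 1 \<Longrightarrow> poly q z \<noteq> 0" "\<delta> > 0"
  shows "\<exists>r. n2 (q * r - y) < \<delta>"
proof -
  have "q \<noteq> 0" using assms(1)[of 0] by auto
  then have "(\<forall>z. cmod z < 1 \<longrightarrow> poly q z \<noteq> 0) \<longrightarrow> (\<forall>y. \<forall>\<delta>>0. \<exists>r. n2 (q * r - y) < \<delta>)"
  proof (induction q rule: complex_poly_root_induct)
    case (const c)
    have "n2 ([:c:] * smult (1 / c) y - y) < \<delta>" if "\<delta> > 0" for y \<delta>
      using const that by (simp add: n2_def)
    then show ?case by blast
  next
    case (root \<zeta> q)
    show ?case
    proof (intro impI allI)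
      fix y and \<delta> :: real
      assume nz: "\<forall>z. cmod z < 1 \<longrightarrow> poly ([:- \<zeta>, 1:] * q) z \<noteq> 0" and d: "\<delta> > 0"
      have "\<zeta> \<noteq> z" if "cmod z < 1" for z using nz that by auto
      then have zeta: "cmod \<zeta> \<ge> 1" using not_le by blast
      have d4: "\<delta> / 4 > 0" using d by simp
      then obtain r1 where r1: "n2 (q * r1 - y) < \<delta> / 4"
        using root.IH nz unfolding poly_mult mult_eq_0_iff by blast
      obtain K where K: "K > 0" "\<And>s. n2 (q * r1 * s) \<le> K * n2 s" using n2_mult_le by blast
      obtain N where N: "real N > 4 * K / \<delta>" using reals_Archimedean2 by blast
      have Npos: "N > 0"
      proof (rule ccontr)
        assume "\<not> N > 0"
        with N K d show False by (simp add: field_simps)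
      qed
      obtain s where s: "n2 ([:- \<zeta>, 1:] * s - 1) \<le> 1 / real N"
        using linear_factor_almost_invertible[OF zeta Npos] by blast
      \<comment> \<open>The approximant \<open>q * r1\<close> found for the smaller polynomial is
        kept; the new factor times \<open>s\<close> is close to 1, and multiplication by the fixed
        polynomial \<open>q * r1\<close> is bounded.\<close>
      have eq: "[:- \<zeta>, 1:] * q * (r1 * s) - y = q * r1 * ([:- \<zeta>, 1:] * s - 1) + (q * r1 - y)"
        by (simp add: algebra_simps del: mult_pCons_left mult_pCons_right)
      have "K * n2 ([:- \<zeta>, 1:] * s - 1) \<le> K * (1 / real N)"
        using s K by (intro mult_left_mono) auto
      also have "\<dots> < \<delta> / 4" using N Npos d by (simp add: field_simps)
      finally have "n2 (q * r1 * ([:- \<zeta>, 1:] * s - 1)) < \<delta> / 4"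
        using K(2) by (rule le_less_trans[rotated])
      then have "n2 ([:- \<zeta>, 1:] * q * (r1 * s) - y) < \<delta>"
        unfolding eq using n2_add_le[of "q * r1 * ([:- \<zeta>, 1:] * s - 1)" "q * r1 - y"] r1 by linarith
      then show "\<exists>r. n2 ([:- \<zeta>, 1:] * q * r - y) < \<delta>" by blast
    qed
  qed
  with assms show ?thesis by blast
qed

lemma coeff_mult_Re:
  "Re (coeff (map_poly complex_of_real q * r) k) = coeff (q * map_poly Re r) k"
  by (simp add: coeff_mult coeff_map_poly)

text \<open>As \<open>q\<close> and \<open>y\<close> are real, taking real parts of the coefficients
  of a complex multiplier takes real parts of the error, which can only shrink.\<close>

lemma sigs_multiples_dense:
  fixes q y :: "real poly"
  assumes "\<And>z. cmod z < 1 \<Longrightarrow> cp q z \<noteq> 0" "\<delta> > 0"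
  obtains r where "nsq (sigs (q * r) - sigs y) < \<delta>"
proof -
  obtain r where r: "n2 (map_poly complex_of_real q * r - map_poly complex_of_real y) < \<delta>"
    using complex_multiples_dense[of "map_poly complex_of_real q" \<delta>] assms by (auto simp: cp_def)
  let ?e = "map_poly complex_of_real q * r - map_poly complex_of_real y"
  define e where "e = q * map_poly Re r - y"
  have ce: "coeff e k = Re (coeff ?e k)" for k
    by (simp add: e_def coeff_mult_Re coeff_map_poly)
  have "degree e \<le> degree ?e" by (rule degree_le) (auto simp: ce coeff_eq_0 simp del: coeff_diff minus_complex.sel)
  then have "nsq (sigs e) = (\<Sum>k\<le>degree ?e. (coeff e k)\<^sup>2)"
    by (simp add: ip_sigs power2_eq_square)
  also have "\<dots> \<le> n2 ?e"
    unfolding n2_def ce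
    by (intro sum_mono) (metis abs_Re_le_cmod abs_le_square_iff abs_norm_cancel)
  finally show ?thesis using r that[of "map_poly Re r"] by (simp add: e_def sigs_diff)
qed

text \<open>Laurent polynomials on the unit circle. Values elsewhere are ignored, which makes the
  class closed under conjugation, and degrees stay hidden in the quantifier.\<close>

definition trigfun :: "(complex \<Rightarrow> complex) \<Rightarrow> bool" where
  "trigfun f \<longleftrightarrow> (\<exists>m q. \<forall>z. cmod z = 1 \<longrightarrow> z ^ m * f z = poly q z)"

lemma trigfunI: "(\<And>z. cmod z = 1 \<Longrightarrow> z ^ m * f z = poly q z) \<Longrightarrow> trigfun f"
  unfolding trigfun_def by blast

lemma trigfun_const: "trigfun (\<lambda>z. c)"
  by (rule trigfunI[where m = 0 and q = "[:c:]"]) simp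

lemma trigfun_cp: "trigfun (cp p)"
  by (rule trigfunI[where m = 0]) (simp add: cp_def)

lemma trigfun_add:
  assumes "trigfun f" "trigfun g" shows "trigfun (\<lambda>z. f z + g z)"
proof -
  obtain m p n q where f: "\<And>z. cmod z = 1 \<Longrightarrow> z ^ m * f z = poly p z"
    and g: "\<And>z. cmod z = 1 \<Longrightarrow> z ^ n * g z = poly q z"
    using assms unfolding trigfun_def by blast
  show ?thesis
    by (rule trigfunI[where m = "m + n" and q = "monom 1 n * p + monom 1 m * q"])
      (simp add: f[symmetric] g[symmetric] poly_monom power_add algebra_simps)
qed

lemma trigfun_mult:
  assumes "trigfun f" "trigfun g" shows "trigfun (\<lambda>z. f z * g z)"
proof -
  obtain m p n q where f: "\<And>z. cmod z = 1 \<Longrightarrow> z ^ m * f z = poly p z"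
    and g: "\<And>z. cmod z = 1 \<Longrightarrow> z ^ n * g z = poly q z"
    using assms unfolding trigfun_def by blast
  show ?thesis
    by (rule trigfunI[where m = "m + n" and q = "p * q"])
      (simp add: f[symmetric] g[symmetric] power_add)
qed

lemma trigfun_sum: "(\<And>i. i \<in> I \<Longrightarrow> trigfun (f i)) \<Longrightarrow> trigfun (\<lambda>z. \<Sum>i\<in>I. f i z)"
  by (induction I rule: infinite_finite_induct) (auto simp: trigfun_const trigfun_add)

lemma trigfun_prod: "(\<And>i. i \<in> I \<Longrightarrow> trigfun (f i)) \<Longrightarrow> trigfun (\<lambda>z. \<Prod>i\<in>I. f i z)"
  by (induction I rule: infinite_finite_induct) (auto simp: trigfun_const trigfun_mult)

lemma trigfun_det: "(\<And>i j. trigfun (\<lambda>z. M z $ i $ j)) \<Longrightarrow> trigfun (\<lambda>z. det (M z))"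
  unfolding det_def by (intro trigfun_sum trigfun_mult trigfun_const trigfun_prod)

lemma trigfun_cnj:
  assumes "trigfun f" shows "trigfun (\<lambda>z. cnj (f z))"
proof -
  obtain m p where f: "\<And>z. cmod z = 1 \<Longrightarrow> z ^ m * f z = poly p z"
    using assms unfolding trigfun_def by blast
  define d where "d = degree p"
  \<comment> \<open>The reversed polynomial: since the conjugate of z is 1 / z on the circle, it
    equals z^d times the conjugate of p(z) there.\<close>
  define q where "q = (\<Sum>k\<le>d. monom (cnj (coeff p k)) (d - k))"
  have "z ^ d * cnj (f z) = poly (monom 1 m * q) z" if z: "cmod z = 1" for z
  proof -
    have zz: "z * cnj z = 1" using z complex_norm_square[of z] by simp
    have q: "poly q z = z ^ d * cnj (poly p z)"
    proof -
      have "poly q z = (\<Sum>k\<le>d. cnj (coeff p k) * z ^ (d - k))"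
        by (simp add: q_def poly_sum poly_monom)
      also have "\<dots> = (\<Sum>k\<le>d. z ^ d * (cnj (coeff p k) * cnj z ^ k))"
      proof (intro sum.cong refl)
        fix k assume "k \<in> {..d}"
        then have "z ^ d = z ^ (d - k) * z ^ k" by (simp add: power_add[symmetric])
        moreover have "z ^ k * cnj z ^ k = 1" using zz by (simp add: power_mult_distrib[symmetric])
        ultimately show "cnj (coeff p k) * z ^ (d - k) = z ^ d * (cnj (coeff p k) * cnj z ^ k)"
          by (metis (no_types, opaque_lifting) mult.assoc mult.commute mult.right_neutral)
      qed
      also have "\<dots> = z ^ d * cnj (poly p z)"
        by (simp add: sum_distrib_left poly_altdef d_def)
      finally show ?thesis .
    qed
    have "z ^ m * cnj z ^ m = 1" using zz by (simp add: power_mult_distrib[symmetric])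
    then have "cnj (f z) = z ^ m * (cnj z ^ m * cnj (f z))" by (simp add: mult.assoc[symmetric])
    also have "cnj z ^ m * cnj (f z) = cnj (poly p z)" by (simp add: f[OF z, symmetric])
    finally have "z ^ d * cnj (f z) = z ^ m * (z ^ d * cnj (poly p z))" by simp
    then show ?thesis by (simp add: q poly_monom)
  qed
  then show ?thesis by (rule trigfunI)
qed

lemma trigfun_bounded:
  assumes "trigfun f"
  obtains K where "K > 0" "\<And>z. cmod z = 1 \<Longrightarrow> cmod (f z) \<le> K"
proof -
  obtain m p where f: "\<And>z. cmod z = 1 \<Longrightarrow> z ^ m * f z = poly p z"
    using assms unfolding trigfun_def by blast
  obtain K where K: "K > 0" "\<And>z. cmod z = 1 \<Longrightarrow> cmod (poly p z) \<le> K"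
    using poly_bounded_circ by blast
  have "cmod (f z) \<le> K" if "cmod z = 1" for z
    using K(2)[OF that] f[OF that, symmetric] that by (simp add: norm_mult norm_power)
  with K(1) show ?thesis by (rule that)
qed

lemma trigfun_bounded_finite:
  assumes "\<And>i. trigfun (f (i :: 'i::finite))"
  obtains K where "K > 0" "\<And>i z. cmod z = 1 \<Longrightarrow> cmod (f i z) \<le> K"
proof -
  have "\<forall>i. \<exists>K>0. \<forall>z. cmod z = 1 \<longrightarrow> cmod (f i z) \<le> K"
  proof
    fix i
    show "\<exists>K>0. \<forall>z. cmod z = 1 \<longrightarrow> cmod (f i z) \<le> K"
      using trigfun_bounded[OF assms[of i]] by blast
  qed
  then obtain K where K: "\<And>i. K i > 0" "\<And>i z. cmod z = 1 \<Longrightarrow> cmod (f i z) \<le> K i" by metis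
  have "K i \<le> sum K UNIV" for i by (intro member_le_sum) (auto intro: less_imp_le K)
  moreover have "sum K UNIV > 0" by (intro sum_pos K) auto
  ultimately show ?thesis using K(2) by (intro that[of "sum K UNIV"]) (auto intro: order_trans)
qed

lemma circle_root_factorization:
  fixes q :: "complex poly"
  assumes "q \<noteq> 0"
  shows "\<exists>h g. q = h * g \<and> (\<forall>z. poly h z = 0 \<longrightarrow> cmod z = 1) \<and> (\<forall>z. cmod z = 1 \<longrightarrow> poly g z \<noteq> 0)"
  using assms
proof (induction q rule: complex_poly_root_induct)
  case (const c)
  then show ?case by (intro exI[of _ 1] exI[of _ "[:c:]"]) auto
next
  case (root \<zeta> q)
  then obtain h g where hg: "q = h * g" "\<And>z. poly h z = 0 \<Longrightarrow> cmod z = 1"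
    "\<And>z. cmod z = 1 \<Longrightarrow> poly g z \<noteq> 0" by blast
  show ?case
  proof (cases "cmod \<zeta> = 1")
    case True
    then show ?thesis
      using hg by (intro exI[of _ "[:- \<zeta>, 1:] * h"] exI[of _ g])
        (auto simp del: mult_pCons_left simp: mult.assoc)
  next
    case False
    then show ?thesis
      using hg by (intro exI[of _ h] exI[of _ "[:- \<zeta>, 1:] * g"])
        (auto simp del: mult_pCons_left simp: mult.left_commute)
  qed
qed

text \<open>One point where \<open>f\<close> is nonzero leaves only finitely many zeros on the
  circle. The polynomial \<open>h\<close> collects them, and the cofactor is bounded away from 0 by
  compactness.\<close>

lemma trigfun_lower_bound:
  assumes "trigfun f" "cmod z0 = 1" "f z0 \<noteq> 0"
  obtains h c where "c > 0" "\<And>z. poly h z = 0 \<Longrightarrow> cmod z = 1"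
    "\<And>z. cmod z = 1 \<Longrightarrow> c * cmod (poly h z) \<le> cmod (f z)" "h \<noteq> 0"
proof -
  obtain m q where f: "\<And>z. cmod z = 1 \<Longrightarrow> z ^ m * f z = poly q z"
    using assms unfolding trigfun_def by blast
  have "z0 \<noteq> 0" using assms(2) by auto
  then have "q \<noteq> 0" using f[OF assms(2)] assms(3) by auto
  then obtain h g where hg: "q = h * g" "\<And>z. poly h z = 0 \<Longrightarrow> cmod z = 1"
    "\<And>z. cmod z = 1 \<Longrightarrow> poly g z \<noteq> 0" using circle_root_factorization by blast
  obtain x where x: "x \<in> sphere 0 1" "\<And>z. z \<in> sphere 0 1 \<Longrightarrow> cmod (poly g x) \<le> cmod (poly g z)"
  proof -
    have "\<exists>x\<in>sphere 0 1. \<forall>y\<in>sphere 0 1. cmod (poly g x) \<le> cmod (poly g y)"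
      by (rule continuous_attains_inf) (auto intro!: continuous_intros simp del: mem_sphere_0)
    with that show ?thesis by blast
  qed
  show ?thesis
  proof (rule that[of "cmod (poly g x)" h])
    show "cmod (poly g x) > 0" using hg(3)[of x] x(1) by simp
    fix z :: complex assume z: "cmod z = 1"
    have "cmod (f z) = cmod (poly q z)" using z by (simp add: f[OF z, symmetric] norm_mult norm_power)
    also have "\<dots> = cmod (poly g z) * cmod (poly h z)" by (simp add: hg norm_mult)
    also have "\<dots> \<ge> cmod (poly g x) * cmod (poly h z)"
      using x(2)[of z] z by (intro mult_right_mono) auto
    finally show "cmod (poly g x) * cmod (poly h z) \<le> cmod (f z)" .
  qed (use hg \<open>q \<noteq> 0\<close> in auto)
qed

section \<open>Hermitian forms and a lower bound by the determinant\<close>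

definition ses :: "complex^'n^'n \<Rightarrow> complex^'n \<Rightarrow> complex^'n \<Rightarrow> complex" where
  "ses T x y = (\<Sum>i\<in>UNIV. cnj (x $ i) * (T *v y) $ i)"

lemma cquad_eq_ses: "cquad T x = ses T x x"
  by (simp add: cquad_def ses_def matrix_vector_mult_def sum_distrib_left mult.assoc)

lemma ses_add: "ses T (x + x') y = ses T x y + ses T x' y" "ses T x (y + y') = ses T x y + ses T x y'"
  by (simp_all add: ses_def algebra_simps sum.distrib matrix_vector_right_distrib)

lemma ses_scale: "ses T (c *s x) y = cnj c * ses T x y" "ses T x (c *s y) = c * ses T x y"
  by (simp_all add: ses_def matrix_vector_mult_def algebra_simps sum_distrib_left)

lemma ses_hermitian:
  assumes "cadj T = T"
  shows "ses T y x = cnj (ses T x y)"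
proof -
  have "cnj (T $ j $ i) = T $ i $ j" for i j
    using assms by (metis (no_types, lifting) cadj_def vec_lambda_beta)
  then have "cnj (ses T x y) = (\<Sum>i\<in>UNIV. \<Sum>j\<in>UNIV. cnj (y $ j) * (T $ j $ i * x $ i))"
    by (simp add: ses_def matrix_vector_mult_def sum_distrib_left algebra_simps)
  also have "\<dots> = ses T y x"
    by (subst sum.swap) (simp add: ses_def matrix_vector_mult_def sum_distrib_left algebra_simps)
  finally show ?thesis ..
qed

lemma ses_Cauchy_Schwarz:
  assumes "cpsd T"
  shows "(cmod (ses T x y))\<^sup>2 \<le> Re (ses T x x) * Re (ses T y y)"
proof -
  define w where "w = ses T x y"
  have "0 \<le> Re (ses T x x) + 2 * t * (cmod w)\<^sup>2 + t\<^sup>2 * ((cmod w)\<^sup>2 * Re (ses T y y))" for t :: real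
  proof -
    \<comment> \<open>The phase of \<open>c\<close> makes the cross term the real number t |w|^2, so
      that the real discriminant criterion applies.\<close>
    define c where "c = complex_of_real t * cnj w"
    have "0 \<le> Re (ses T (x + c *s y) (x + c *s y))"
      using assms by (simp add: cpsd_def cquad_eq_ses)
    also have "ses T (x + c *s y) (x + c *s y)
        = ses T x x + c * w + cnj (c * w) + cnj c * c * ses T y y"
      using ses_hermitian[of T y x] assms by (simp add: ses_add ses_scale cpsd_def w_def algebra_simps)
    also have "c * w = complex_of_real (t * (cmod w)\<^sup>2)"
      unfolding c_def of_real_mult complex_norm_square by (simp add: mult_ac)
    also have "cnj c * c = complex_of_real (t\<^sup>2 * (cmod w)\<^sup>2)"
      unfolding c_def of_real_mult complex_norm_square by (simp add: mult_ac power2_eq_square)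
    finally show ?thesis by (simp add: algebra_simps)
  qed
  then have "((cmod w)\<^sup>2)\<^sup>2 \<le> Re (ses T x x) * ((cmod w)\<^sup>2 * Re (ses T y y))"
    by (rule quadratic_nonneg_discriminant)
  then have *: "(cmod w)\<^sup>2 * (cmod w)\<^sup>2 \<le> (cmod w)\<^sup>2 * (Re (ses T x x) * Re (ses T y y))"
    by (simp add: power2_eq_square[of "(cmod w)\<^sup>2"] algebra_simps)
  show ?thesis
  proof (cases "w = 0")
    case True
    have "0 \<le> Re (ses T x x)" "0 \<le> Re (ses T y y)"
      using assms by (simp_all add: cpsd_def cquad_eq_ses)
    with True show ?thesis by (simp add: w_def)
  next
    case False
    then have "(cmod w)\<^sup>2 > 0" by simp
    then show ?thesis using * unfolding w_def by (rule mult_left_le_imp_le[rotated])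
  qed
qed

lemma power2_norm_complex_vec: "(norm (x :: complex^'n))\<^sup>2 = (\<Sum>i\<in>UNIV. (cmod (x $ i))\<^sup>2)"
  by (simp add: norm_vec_def L2_set_def sum_nonneg)

lemma norm_mult_vec_le_entries:
  fixes M :: "complex^'m^'n"
  assumes "\<And>i j. cmod (M $ i $ j) \<le> a" "a \<ge> 0"
  shows "norm (M *v x) \<le> real CARD('n) * (real CARD('m) * a) * norm x"
proof -
  have "cmod ((M *v x) $ i) \<le> real CARD('m) * a * norm x" for i
  proof -
    have "cmod ((M *v x) $ i) \<le> (\<Sum>j\<in>UNIV. cmod (M $ i $ j * x $ j))"
      unfolding matrix_vector_mult_def by (simp add: norm_sum)
    also have "\<dots> \<le> (\<Sum>j\<in>(UNIV::'m set). a * norm x)"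
      using assms Finite_Cartesian_Product.norm_nth_le[of x]
      by (intro sum_mono) (auto simp: norm_mult intro!: mult_mono)
    finally show ?thesis by simp
  qed
  then have "(\<Sum>i\<in>UNIV. norm ((M *v x) $ i)) \<le> (\<Sum>i\<in>(UNIV::'n set). real CARD('m) * a * norm x)"
    by (intro sum_mono) auto
  moreover have "norm (M *v x) \<le> (\<Sum>i\<in>UNIV. norm ((M *v x) $ i))"
    unfolding norm_vec_def by (rule L2_set_le_sum) simp
  ultimately show ?thesis by simp
qed

text \<open>A polynomial substitute for the smallest eigenvalue, valid for singular \<open>T\<close>
  too: Cauchy-Schwarz for the form of \<open>T\<close> at x and y = adj(T) x, where T y = det(T) x,
  so the mixed term is det(T) |x|^2 and the form at y is bounded through the entries of the
  adjugate.\<close>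

lemma psd_det_lower_bound:
  fixes T :: "complex^'n^'n"
  assumes "cpsd T" "\<And>i j. cmod (adjp T $ i $ j) \<le> a" "cmod (det T) \<le> d" "a > 0" "d > 0"
  shows "(cmod (det T))\<^sup>2 * (norm x)\<^sup>2 \<le> d * (real CARD('n) * (real CARD('n) * a)) * Re (cquad T x)"
proof (cases "x = 0")
  case True
  then show ?thesis using assms by (simp add: cpsd_def)
next
  case False
  define y where "y = adjp T *v x"
  define \<nu> where "\<nu> = norm x"
  have "\<nu> > 0" using False by (simp add: \<nu>_def)
  have ses: "ses T u y = det T * (\<Sum>i\<in>UNIV. cnj (u $ i) * x $ i)" for u
    by (simp add: ses_def y_def mult_adjp_vector sum_distrib_left algebra_simps)
  have "ses T x y = det T * complex_of_real (\<nu>\<^sup>2)"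
    unfolding ses by (simp add: \<nu>_def power2_norm_complex_vec complex_norm_square mult.commute del: of_real_power)
  then have 1: "(cmod (ses T x y))\<^sup>2 = (cmod (det T))\<^sup>2 * \<nu>\<^sup>2 * \<nu>\<^sup>2"
    by (simp add: norm_mult power_mult_distrib power2_eq_square norm_power)
  have "cmod (\<Sum>i\<in>UNIV. cnj (y $ i) * x $ i) \<le> norm y * norm x"
  proof -
    have "cmod (\<Sum>i\<in>UNIV. cnj (y $ i) * x $ i) \<le> (\<Sum>i\<in>UNIV. \<bar>cmod (y $ i)\<bar> * \<bar>cmod (x $ i)\<bar>)"
      by (rule order_trans[OF norm_sum]) (simp add: norm_mult)
    also have "\<dots> \<le> norm y * norm x"
      unfolding norm_vec_def by (rule L2_set_mult_ineq)
    finally show ?thesis .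
  qed
  also have "norm y \<le> real CARD('n) * (real CARD('n) * a) * \<nu>"
    unfolding y_def \<nu>_def using assms by (intro norm_mult_vec_le_entries) auto
  finally have "cmod (\<Sum>i\<in>UNIV. cnj (y $ i) * x $ i) \<le> real CARD('n) * (real CARD('n) * a) * \<nu> * \<nu>"
    by (simp add: \<nu>_def mult_right_mono)
  then have "cmod (ses T y y) \<le> d * (real CARD('n) * (real CARD('n) * a) * \<nu> * \<nu>)"
    unfolding ses norm_mult using assms by (intro mult_mono) auto
  then have 2: "Re (ses T y y) \<le> d * (real CARD('n) * (real CARD('n) * a)) * \<nu>\<^sup>2"
    using complex_Re_le_cmod[of "ses T y y"] by (simp add: power2_eq_square algebra_simps)
  have "(cmod (det T))\<^sup>2 * \<nu>\<^sup>2 * \<nu>\<^sup>2 \<le> Re (ses T x x) * Re (ses T y y)"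
    using ses_Cauchy_Schwarz[OF assms(1), of x y] 1 by simp
  also have "\<dots> \<le> Re (ses T x x) * (d * (real CARD('n) * (real CARD('n) * a)) * \<nu>\<^sup>2)"
    using assms(1) 2 by (intro mult_left_mono) (auto simp: cpsd_def cquad_eq_ses)
  finally have "((cmod (det T))\<^sup>2 * \<nu>\<^sup>2) * \<nu>\<^sup>2
      \<le> (d * (real CARD('n) * (real CARD('n) * a)) * Re (cquad T x)) * \<nu>\<^sup>2"
    by (simp add: cquad_eq_ses algebra_simps)
  then show ?thesis
    using \<open>\<nu> > 0\<close> by (simp add: \<nu>_def)
qed

subsection \<open>Linear differential equations\<close>

lemma sqi_component: "sqi f \<Longrightarrow> sqi (\<lambda>t. f t $ i)" for f :: "real \<Rightarrow> real^'m"
  by (rule sqi_bounded_linear[OF bounded_linear_vec_nth])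

lemma sqi_vec:
  fixes f :: "real \<Rightarrow> real^'m"
  assumes "\<And>i. sqi (\<lambda>t. f t $ i)"
  shows "sqi f"
proof -
  have f: "f = (\<Sum>i\<in>UNIV. (\<lambda>t. (f t $ i) *\<^sub>R axis i 1))"
    by (auto simp: fun_eq_iff sum_fun_apply vec_eq_iff axis_def if_distrib sum.delta' cong: if_cong)
  show ?thesis
    by (subst f) (intro sqi_sum sqi_bounded_linear[OF bounded_linear_scaleR_left] assms)
qed

lemma ip_vec:
  fixes f g :: "real \<Rightarrow> real^'m"
  assumes "sqi f" "sqi g"
  shows "ip f g = (\<Sum>i\<in>UNIV. ip (\<lambda>t. f t $ i) (\<lambda>t. g t $ i))"
  unfolding ip_def inner_vec_def
  by (intro Bochner_Integration.integral_sum integrable_inner sqi_component assms)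

lemma ip_diff_vec:
  fixes f g :: "real \<Rightarrow> real^'m"
  assumes "sqi f" "sqi g"
  shows "nsq (f - g)
    = (\<Sum>i\<in>UNIV. nsq ((\<lambda>t. f t $ i) - (\<lambda>t. g t $ i)))"
  by (subst ip_vec[OF sqi_diff[OF assms] sqi_diff[OF assms]]) (simp add: fun_diff_def)

definition sig :: "real poly^'m \<Rightarrow> real \<Rightarrow> real^'m" where
  "sig U t = (\<chi> i. sigs (U $ i) t)"

lemma sig_nth [simp]: "sig U t $ i = sigs (U $ i) t"
  by (simp add: sig_def)

lemma sqi_sig [simp]: "sqi (sig U)"
  by (intro sqi_vec) simp

lemma sig_0 [simp]: "sig 0 = 0"
  by (simp add: fun_eq_iff vec_eq_iff)

lemma sig_add: "sig (U + V) = sig U + sig V"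
  by (simp add: fun_eq_iff vec_eq_iff sigs_add)

lemma sig_diff: "sig (U - V) = sig U - sig V"
  by (simp add: fun_eq_iff vec_eq_iff sigs_diff)

lemma sig_dense:
  fixes f :: "real \<Rightarrow> real^'m"
  assumes "sqi f" "\<delta> > 0"
  obtains U where "nsq (f - sig U) < \<delta>"
proof -
  have "\<forall>i. \<exists>p. nsq ((\<lambda>t. f t $ i) - sigs p) < \<delta> / real CARD('m)"
    using sigs_dense[OF sqi_component[OF assms(1)]] assms(2)
    by (metis of_nat_0_less_iff zero_less_card_finite zero_less_divide_iff)
  then obtain p where p: "\<And>i. nsq ((\<lambda>t. f t $ i) - sigs (p i)) < \<delta> / real CARD('m)"
    by metis
  have "nsq (f - sig (\<chi> i. p i))
      = (\<Sum>i\<in>UNIV. nsq ((\<lambda>t. f t $ i) - sigs (p i)))"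
    using ip_diff_vec[OF assms(1) sqi_sig, of "\<chi> i. p i"] by simp
  also have "\<dots> < (\<Sum>i\<in>(UNIV::'m set). \<delta> / real CARD('m))"
    by (intro sum_strict_mono p) auto
  also have "\<dots> = \<delta>" by simp
  finally show ?thesis by (rule that)
qed

lemma sig_multiples_dense:
  fixes f :: "real \<Rightarrow> real^'m"
  assumes f: "sqi f" and d: "\<delta> > 0" and q: "\<And>z. cmod z < 1 \<Longrightarrow> cp q z \<noteq> 0"
  obtains R where "nsq (f - sig (q *s R)) < \<delta>"
proof -
  have d4: "\<delta> / 4 > 0" using d by simp
  obtain U where U: "nsq (f - sig U) < \<delta> / 4" using sig_dense[OF f d4] .
  have "\<forall>i. \<exists>r. nsq (sigs (q * r) - sigs (U $ i)) < \<delta> / 4 / real CARD('m)"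
  proof
    fix i
    have "\<delta> / 4 / real CARD('m) > 0" using d by simp
    then show "\<exists>r. nsq (sigs (q * r) - sigs (U $ i)) < \<delta> / 4 / real CARD('m)"
      using sigs_multiples_dense[of q _ "U $ i"] q by metis
  qed
  then obtain r where r: "\<And>i. nsq (sigs (q * r i) - sigs (U $ i)) < \<delta> / 4 / real CARD('m)"
    by metis
  let ?R = "\<chi> i. r i"
  have "nsq (sig (q *s ?R) - sig U)
      = (\<Sum>i\<in>UNIV. nsq (sigs (q * r i) - sigs (U $ i)))"
    using ip_diff_vec[OF sqi_sig sqi_sig, of "q *s ?R" U] by simp
  also have "\<dots> < (\<Sum>i\<in>(UNIV::'m set). \<delta> / 4 / real CARD('m))"
    by (intro sum_strict_mono r) auto
  also have "\<dots> = \<delta> / 4" by simp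
  finally have "nsq (sig U - sig (q *s ?R)) < \<delta> / 4"
    by (simp add: ip_self_diff_commute)
  then have "nsq (f - sig (q *s ?R)) < \<delta>"
    using ip_self_diff_le[of f "sig U" "sig (q *s ?R)"] f U by simp
  then show ?thesis by (rule that)
qed

definition constp :: "real^'m^'n \<Rightarrow> real poly^'m^'n" where
  "constp M = (\<chi> i j. [:M $ i $ j:])"

lemma sig_constp: "sig (constp M *v U) t = M *v sig U t"
  by (simp add: vec_eq_iff constp_def matrix_vector_mult_def sigs_sum sum_fun_apply sigs_smult)

lemma cem_constp [simp]: "cem (constp M) z = cmat M"
  by (simp add: cem_def constp_def cmat_def)

lemma degree_map_of_real: "degree (map_poly complex_of_real p) \<le> degree p"
  by (rule degree_le) (simp add: coeff_map_poly coeff_eq_0)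

lemma ip_sigs_circ:
  assumes "degree p < N" "degree q < N"
  shows "complex_of_real (real N * ip (sigs p) (sigs q)) = (\<Sum>j<N. cnj (cp p (circ N j)) * cp q (circ N j))"
proof -
  have "(\<Sum>j<N. cnj (cp p (circ N j)) * cp q (circ N j))
      = of_nat N * (\<Sum>k<N. cnj (complex_of_real (coeff p k)) * complex_of_real (coeff q k))"
    unfolding cp_def by (subst circ_Parseval) (auto simp: coeff_map_poly intro: le_less_trans[OF degree_map_of_real] assms)
  also have "(\<Sum>k<N. cnj (complex_of_real (coeff p k)) * complex_of_real (coeff q k))
      = complex_of_real (\<Sum>k<N. coeff p k * coeff q k)" by simp
  also have "(\<Sum>k<N. coeff p k * coeff q k) = ip (sigs p) (sigs q)"
    using assms ip_sigs[of p "N - 1" q] by (cases N) (simp_all add: lessThan_Suc_atMost)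
  finally show ?thesis by simp
qed

lemma ip_sig_circ:
  assumes "\<And>i. degree (U $ i) < N" "\<And>i. degree (V $ i) < N"
  shows "complex_of_real (real N * ip (sig U) (sig V))
    = (\<Sum>j<N. \<Sum>i\<in>UNIV. cnj (cev U (circ N j) $ i) * cev V (circ N j) $ i)"
proof -
  have "complex_of_real (real N * ip (sig U) (sig V))
      = (\<Sum>i\<in>UNIV. complex_of_real (real N * ip (sigs (U $ i)) (sigs (V $ i))))"
    by (simp add: ip_vec sum_distrib_left)
  then show ?thesis
    by (simp only: ip_sigs_circ assms cev_def vec_lambda_beta) (rule sum.swap)
qed

definition degb :: "real poly^'m \<Rightarrow> nat" where
  "degb U = (MAX i. degree (U $ i))"

lemma degree_le_degb: "degree (U $ i) \<le> degb U"
  unfolding degb_def by (intro Max_ge) auto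

lemma ip_sig_quad_circ:
  assumes "degb U < N" "degb V < N" "degb (constp Q *v V) < N"
  shows "real N * ip (sig U) (\<lambda>t. Q *v sig V t)
    = (\<Sum>j<N. Re (ses (cmat Q) (cev U (circ N j)) (cev V (circ N j))))"
proof -
  have "(\<lambda>t. Q *v sig V t) = sig (constp Q *v V)" by (simp add: fun_eq_iff sig_constp)
  moreover have "complex_of_real (real N * ip (sig U) (sig (constp Q *v V)))
      = (\<Sum>j<N. ses (cmat Q) (cev U (circ N j)) (cev V (circ N j)))"
    using assms by (subst ip_sig_circ) (auto intro: le_less_trans[OF degree_le_degb] simp: ses_def cev_mult)
  ultimately show ?thesis
    by (metis Re_complex_of_real Re_sum)
qed

text \<open>The sample points avoid 1, so a pointwise estimate on the image of the finite imaginary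
  axis suffices.\<close>

lemma ip_sig_le_circ:
  assumes "\<And>z. cmod z = 1 \<Longrightarrow> z \<noteq> 1 \<Longrightarrow> (norm (cev U z))\<^sup>2 \<le> c * (norm (cev V z))\<^sup>2"
  shows "nsq (sig U) \<le> c * nsq (sig V)"
proof -
  define N where "N = Suc (max (degb U) (degb V))"
  have "degb U < N" "degb V < N" by (auto simp: N_def)
  then have N: "degree (U $ i) < N" "degree (V $ j) < N" "N > 0" for i j
    using degree_le_degb[of U i] degree_le_degb[of V j] by auto
  have eq: "real N * nsq (sig W) = (\<Sum>j<N. (norm (cev W (circ N j)))\<^sup>2)"
    if "\<And>i. degree (W $ i) < N" for W :: "real poly^'x"
  proof -
    have "complex_of_real (real N * nsq (sig W)) = complex_of_real (\<Sum>j<N. (norm (cev W (circ N j)))\<^sup>2)"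
      unfolding ip_sig_circ[OF that that] power2_norm_complex_vec of_real_sum complex_norm_square
      by (simp add: mult.commute)
    then show ?thesis by (simp only: of_real_eq_iff)
  qed
  have "real N * nsq (sig U) \<le> real N * (c * nsq (sig V))"
    using sum_mono[of "{..<N}" "\<lambda>j. (norm (cev U (circ N j)))\<^sup>2" "\<lambda>j. c * (norm (cev V (circ N j)))\<^sup>2"]
      assms N by (simp add: eq mult.left_commute[of "real N" c] sum_distrib_left)
  then show ?thesis using N by simp
qed

lemma cem_bounded_circ:
  fixes M :: "real poly^'m^'n"
  obtains K where "K > 0" "\<And>z u. cmod z = 1 \<Longrightarrow> norm (cem M z *v u) \<le> K * norm u"
proof -
  obtain a where a: "a > 0" "\<And>i z. cmod z = 1 \<Longrightarrow> cmod (cp (M $ fst i $ snd i) z) \<le> a"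
    using trigfun_bounded_finite[of "\<lambda>i. cp (M $ fst i $ snd i)"] trigfun_cp by blast
  have "norm (cem M z *v u) \<le> real CARD('n) * (real CARD('m) * a) * norm u" if "cmod z = 1" for z u
    by (rule norm_mult_vec_le_entries) (use a(1) a(2)[OF that, of "(_, _)"] in \<open>auto simp: cem_def\<close>)
  with a(1) that[of "real CARD('n) * (real CARD('m) * a)"] show ?thesis by auto
qed

lemma cp_lower_bound_circ:
  assumes "\<And>z. cmod z = 1 \<Longrightarrow> cp p z \<noteq> 0"
  obtains c where "c > 0" "\<And>z. cmod z = 1 \<Longrightarrow> c \<le> cmod (cp p z)"
proof -
  have "\<exists>x\<in>sphere 0 1. \<forall>y\<in>sphere 0 1. cmod (cp p x) \<le> cmod (cp p y)"
    unfolding cp_def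
    by (rule continuous_attains_inf) (auto intro!: continuous_intros simp del: mem_sphere_0)
  then obtain x where "cmod x = 1" "\<And>y. cmod y = 1 \<Longrightarrow> cmod (cp p x) \<le> cmod (cp p y)" by auto
  then show ?thesis using assms[of x] by (intro that[of "cmod (cp p x)"]) auto
qed

text \<open>Equals (1 - z) (s - A) for s = (1 + z) / (1 - z), but is polynomial and hence defined at
  z = 1, the image of s = infinity.\<close>

definition Epoly :: "real^'n^'n \<Rightarrow> real poly^'n^'n" where
  "Epoly A = (\<chi> i j. (if i = j then [:1, 1:] else 0) - [:1, -1:] * [:A $ i $ j:])"

lemma mat_mult_nth: "(mat c ** M) $ i $ j = c * M $ i $ j" for M :: "'a::comm_semiring_1^'m^'n"
proof -
  have "(mat c ** M) $ i $ j = (\<Sum>k\<in>UNIV. (if i = k then c else 0) * M $ k $ j)"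
    by (simp add: matrix_matrix_mult_def mat_def)
  also have "\<dots> = (\<Sum>k\<in>UNIV. if i = k then c * M $ k $ j else 0)"
    by (intro sum.cong) auto
  finally show ?thesis by simp
qed

lemma cem_Epoly: "cem (Epoly A) z = mat (1 + z) - mat (1 - z) ** cmat A"
  by (simp add: vec_eq_iff cem_def Epoly_def mat_mult_nth cmat_def) (simp add: mat_def algebra_simps)

lemma cem_Epoly_eq:
  assumes "z \<noteq> 1"
  shows "cem (Epoly A) z = mat (1 - z) ** (mat ((1 + z) / (1 - z)) - cmat A)"
proof -
  have "1 - z \<noteq> 0" using assms by simp
  then show ?thesis
    unfolding cem_Epoly vec_eq_iff
    by (auto simp only: mat_mult_nth vector_minus_component right_diff_distrib) (auto simp: mat_def)
qed

lemma Re_Cayley: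
  "Re ((1 + z) / (1 - z)) = (1 - (cmod z)\<^sup>2) / (cmod (1 - z))\<^sup>2"
  unfolding cmod_power2 by (simp add: Re_divide power2_eq_square algebra_simps)

lemma invertible_mat: "c \<noteq> 0 \<Longrightarrow> invertible (mat c :: 'a::field^'n^'n)"
  by (simp add: invertible_det_nz det_diagonal mat_def)

text \<open>Away from 1 the closed disc is mapped to the closed right half-plane, where the Hurwitz
  property applies; at 1 the matrix is twice the identity.\<close>

lemma cp_det_Epoly_neq_0:
  assumes "hurwitz A" "cmod z \<le> 1"
  shows "cp (det (Epoly A)) z \<noteq> 0"
proof (cases "z = 1")
  case True
  then have "cem (Epoly A) z = mat 2" by (simp add: cem_Epoly matrix_matrix_mult_def mat_def vec_eq_iff)
  then have "invertible (cem (Epoly A) z)" using invertible_mat[of "2::complex"] by simp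
  then show ?thesis by (simp add: cp_det invertible_det_nz)
next
  case False
  have "Re ((1 + z) / (1 - z)) \<ge> 0"
    unfolding Re_Cayley using assms(2) by (intro divide_nonneg_nonneg) (auto simp: power_le_one)
  then have "invertible (mat ((1 + z) / (1 - z)) - cmat A)" using assms(1) by (simp add: hurwitz_def)
  then have "invertible (cem (Epoly A) z)"
    unfolding cem_Epoly_eq[OF False] using False
    by (intro invertible_mult invertible_mat) auto
  then show ?thesis by (simp add: cp_det invertible_det_nz)
qed

section \<open>Uniqueness, zero-state response and free response\<close>

definition ode :: "real^'n^'n \<Rightarrow> (real \<Rightarrow> real^'n) \<Rightarrow> real^'n \<Rightarrow> (real \<Rightarrow> real^'n) \<Rightarrow> bool" where
  "ode A f \<xi> x \<longleftrightarrow> (\<forall>t\<ge>0. ((\<lambda>s. A *v x s + f s) has_integral (x t - \<xi>)) {0..t})"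

lemma solves_state_iff_ode:
  "solves_state A B1 B2 \<xi> v w x \<longleftrightarrow> ode A (\<lambda>t. B1 *v v t + B2 *v w t) \<xi> x"
  by (simp add: solves_state_def ode_def add.assoc)

lemma ode_add:
  assumes "ode A f \<xi> x" "ode A g \<eta> y"
  shows "ode A (f + g) (\<xi> + \<eta>) (x + y)"
proof -
  have "((\<lambda>s. (A *v x s + f s) + (A *v y s + g s)) has_integral ((x t - \<xi>) + (y t - \<eta>))) {0..t}" if "t \<ge> 0" for t
    using assms that by (intro has_integral_add) (auto simp: ode_def)
  then show ?thesis by (simp add: ode_def matrix_vector_right_distrib algebra_simps)
qed

lemma ode_scaleR:
  assumes "ode A f \<xi> x"
  shows "ode A (c *\<^sub>R f) (c *\<^sub>R \<xi>) (c *\<^sub>R x)"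
proof -
  have "((\<lambda>s. c *\<^sub>R (A *v x s + f s)) has_integral c *\<^sub>R (x t - \<xi>)) {0..t}" if "t \<ge> 0" for t
    using assms that by (intro has_integral_cmul) (auto simp: ode_def)
  then show ?thesis by (simp add: ode_def matrix_vector_mult_scaleR algebra_simps)
qed

lemma ode_diff:
  assumes "ode A f \<xi> x" "ode A g \<eta> y"
  shows "ode A (f - g) (\<xi> - \<eta>) (x - y)"
  using ode_add[OF assms(1) ode_scaleR[OF assms(2), of "-1"]] by simp

lemma ode_has_vector_derivative:
  assumes x: "ode A (\<lambda>_. 0) \<xi> x" and t: "t \<ge> 0"
  shows "(x has_vector_derivative A *v x t) (at t within {0..})"
proof -
  define b where "b = t + 1"
  have b: "b \<ge> 0" using t by (simp add: b_def)
  have int: "((\<lambda>s. A *v x s) has_integral (x t - \<xi>)) {0..t}" if "t \<ge> 0" for t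
    using x that by (simp add: ode_def)
  have xeq: "x t = \<xi> + integral {0..t} (\<lambda>s. A *v x s)" if "t \<ge> 0" for t
    using int[OF that] by (simp add: integral_unique)
  have "continuous_on {0..b} (\<lambda>t. \<xi> + integral {0..t} (\<lambda>s. A *v x s))"
    using int[OF b] by (intro continuous_intros indefinite_integral_continuous_1) auto
  then have contx: "continuous_on {0..b} x"
    by (subst continuous_on_cong[OF refl, of _ _ "\<lambda>t. \<xi> + integral {0..t} (\<lambda>s. A *v x s)"]) (auto simp: xeq)
  have "continuous_on {0..b} (\<lambda>s. A *v x s)"
    by (intro continuous_on_compose2[OF linear_continuous_on[OF matrix_vector_mul_bounded_linear] contx]) auto
  then have "((\<lambda>u. integral {0..u} (\<lambda>s. A *v x s)) has_vector_derivative A *v x t) (at t within {0..b})"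
    using t by (intro integral_has_vector_derivative) (auto simp: b_def)
  then have "((\<lambda>u. \<xi> + integral {0..u} (\<lambda>s. A *v x s)) has_vector_derivative A *v x t) (at t within {0..b})"
    by (auto intro!: derivative_eq_intros)
  then have "(x has_vector_derivative A *v x t) (at t within {0..b})"
    by (rule has_vector_derivative_transform[rotated 2]) (use t in \<open>auto simp: b_def xeq\<close>)
  moreover have "at t within {0..b} = at t within {0..}"
    by (rule at_within_nhd[of t "{..<b}"]) (auto simp: b_def)
  ultimately show ?thesis by simp
qed

text \<open>Gronwall: with \<open>K\<close> bounding the operator norm, exp (- 2 K t) |z|^2 is
  nonincreasing and starts at 0.\<close>

lemma ode_unique_0:
  assumes z: "ode A (\<lambda>_. 0) 0 z" and t: "t \<ge> 0"
  shows "z t = 0"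
proof -
  obtain K where K: "K > 0" "\<And>x. norm (A *v x) \<le> norm x * K"
    using bounded_linear.pos_bounded[OF matrix_vector_mul_bounded_linear[of A]] by blast
  define \<phi> where "\<phi> s = exp (- (2 * K) * s) * (z s \<bullet> z s)" for s
  have "((\<lambda>s. A *v z s) has_integral z 0) {0}" using z by (auto simp: ode_def dest!: spec[of _ 0])
  then have z0: "z 0 = 0" by (rule has_integral_unique[OF _ has_integral_refl(2)])
  have dz: "(\<phi> has_real_derivative
      exp (- (2 * K) * s) * (2 * (z s \<bullet> (A *v z s)) - 2 * K * (z s \<bullet> z s))) (at s within {0..})"
    if "s \<ge> 0" for s
  proof -
    have "((\<lambda>s. z s \<bullet> z s) has_vector_derivative (z s \<bullet> (A *v z s) + (A *v z s) \<bullet> z s)) (at s within {0..})"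
      using ode_has_vector_derivative[OF z that]
      by (intro bounded_bilinear.has_vector_derivative[OF bounded_bilinear_inner]) auto
    then have "((\<lambda>s. z s \<bullet> z s) has_real_derivative 2 * (z s \<bullet> (A *v z s))) (at s within {0..})"
      by (simp add: has_real_derivative_iff_has_vector_derivative inner_commute)
    then show ?thesis
      unfolding \<phi>_def by (auto intro!: derivative_eq_intros simp: algebra_simps)
  qed
  have "\<phi> t \<le> \<phi> 0"
  proof (rule DERIV_nonpos_imp_decreasing_open[OF t])
    fix s assume s: "0 < s" "s < t"
    have "z s \<bullet> (A *v z s) \<le> norm (z s) * (norm (z s) * K)"
      by (rule order_trans[OF norm_cauchy_schwarz mult_left_mono[OF K(2)]]) simp
    then have "exp (- (2 * K) * s) * (2 * (z s \<bullet> (A *v z s)) - 2 * K * (z s \<bullet> z s)) \<le> 0"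
      by (intro mult_nonneg_nonpos) (auto simp: power2_norm_eq_inner[symmetric] power2_eq_square algebra_simps)
    moreover have "at s within {0..} = at s"
      using s by (intro at_within_nhd[of s "{0<..}" _ UNIV, simplified]) auto
    ultimately show "\<exists>y. DERIV \<phi> s :> y \<and> y \<le> 0" using dz[of s] s by auto
  next
    show "continuous_on {0..t} \<phi>"
      by (rule continuous_on_subset[OF DERIV_continuous_on[of "{0..}"]]) (use dz in auto)
  qed
  then have "z t \<bullet> z t \<le> 0" by (simp add: \<phi>_def z0 mult_le_0_iff)
  then show ?thesis using inner_ge_zero[of "z t"] inner_eq_zero_iff[of "z t"] by linarith
qed


lemma ode_unique:
  assumes "ode A f \<xi> x" "ode A f \<xi> y" "t \<ge> 0"
  shows "x t = y t"
proof -
  have "ode A (\<lambda>_. 0) 0 (x - y)" using ode_diff[OF assms(1,2)] by (simp add: zero_fun_def)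
  from ode_unique_0[OF this assms(3)] show ?thesis by simp
qed

text \<open>Cauchy-Schwarz against the indicator of \<open>{0..t}\<close>, whose squared norm is
  t.\<close>

lemma sqi_integral_bound:
  fixes h :: "real \<Rightarrow> real^'n"
  assumes h: "sqi h" and t: "t \<ge> 0"
  shows "h integrable_on {0..t}" "(norm (integral {0..t} h))\<^sup>2 \<le> t * nsq h"
proof -
  define I where "I = (indicator {0..t} :: real \<Rightarrow> real)"
  have mI: "I \<in> borel_measurable halfline"
    unfolding I_def by (intro borel_measurable_indicator) (simp add: sets_restrict_space_iff)
  have iI: "integrable lebesgue (\<lambda>s. indicator {0..t} s * (1::real))"
    by (simp add: fmeasurable_def emeasure_lborel_Icc_eq)
  have eqI: "indicator {0..} s * (I s)\<^sup>2 = indicator {0..t} s * (1::real)" for s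
    by (auto simp: I_def indicator_def)
  have sI: "sqi I"
    using mI iI by (simp add: sqi_def integrable_restrict_space eqI)
  have II: "nsq I = t"
  proof -
    have "nsq I = (LINT s|lebesgue. indicator {0..t} s * (1::real))"
      unfolding ip_def by (subst integral_restrict_space) (auto simp: eqI power2_eq_square[symmetric])
    then show ?thesis using t by simp
  qed
  have sN: "sqi (\<lambda>s. norm (h s))"
    using h by (auto simp: sqi_def)
  have NN: "nsq (\<lambda>s. norm (h s)) = nsq h"
    by (simp add: ip_def power2_norm_eq_inner[symmetric] power2_eq_square)
  have "integrable halfline (\<lambda>s. I s *\<^sub>R h s)"
  proof (rule Bochner_Integration.integrable_bound[OF integrable_inner[OF sI sN]])
    show "(\<lambda>s. I s *\<^sub>R h s) \<in> borel_measurable halfline" using mI h by (auto simp: sqi_def)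
  qed (auto simp: I_def indicator_def)
  then have "integrable lebesgue (\<lambda>s. indicator {0..} s *\<^sub>R I s *\<^sub>R h s)"
    by (simp add: integrable_restrict_space)
  also have "(\<lambda>s. indicator {0..} s *\<^sub>R I s *\<^sub>R h s) = (\<lambda>s. indicator {0..t} s *\<^sub>R h s)"
    by (auto simp: I_def indicator_def)
  finally have si: "h absolutely_integrable_on {0..t}" by (simp add: set_integrable_def)
  then show "h integrable_on {0..t}" by (simp add: absolutely_integrable_on_def)
  have "norm (integral {0..t} h) \<le> integral {0..t} (\<lambda>s. norm (h s))"
    using si by (intro integral_norm_bound_integral) (auto simp: absolutely_integrable_on_def)
  also have "\<dots> = ip I (\<lambda>s. norm (h s))"
  proof -
    have "ip I (\<lambda>s. norm (h s)) = (LINT s|lebesgue. indicator {0..t} s *\<^sub>R norm (h s))"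
      unfolding ip_def
      by (subst integral_restrict_space) (auto simp: I_def indicator_def intro!: Bochner_Integration.integral_cong)
    also have "\<dots> = integral {0..t} (\<lambda>s. norm (h s))"
      using set_lebesgue_integral_eq_integral(2)[OF absolutely_integrable_norm[OF si]]
      by (simp add: set_lebesgue_integral_def o_def)
    finally show ?thesis ..
  qed
  finally have "(norm (integral {0..t} h))\<^sup>2 \<le> (ip I (\<lambda>s. norm (h s)))\<^sup>2" by (intro power_mono) auto
  also have "\<dots> \<le> t * nsq h"
    using ip_Cauchy_Schwarz[OF sI sN] by (simp add: II NN)
  finally show "(norm (integral {0..t} h))\<^sup>2 \<le> t * nsq h" .
qed

lemma norm_vector_scale: "norm (c *s x) = cmod c * norm x" for x :: "complex^'n"
  by (simp add: norm_vec_def norm_mult L2_set_right_distrib)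

lemma matrix_vector_mult_scale: "M *v (c *s x) = c *s (M *v x)" for x :: "'a::comm_semiring_1^'m"
  by (simp add: vec_eq_iff matrix_vector_mult_def sum_distrib_left mult.left_commute)

text \<open>The derivative of the signal of (1 - z) Y is that of (1 + z) Y, and the equation for
  \<open>F\<close> says precisely that this is A (1 - z) Y + F. The factor 1 - z also makes the
  initial state 0.\<close>

lemma ode_sig:
  assumes "Epoly A *v Y = F"
  shows "ode A (sig F) 0 (sig ([:1, -1:] *s Y))"
  unfolding ode_def
proof (intro allI impI)
  fix t :: real assume t: "t \<ge> 0"
  have comp: "[:1, 1:] * Y $ i = [:1, -1:] * (constp A *v Y) $ i + F $ i" for i
  proof -
    have "F $ i = (\<Sum>j\<in>UNIV. ((if i = j then [:1, 1:] else 0) - [:1, -1:] * [:A $ i $ j:]) * Y $ j)"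
      unfolding assms[symmetric] by (simp add: matrix_vector_mult_def Epoly_def)
    also have "\<dots> = (\<Sum>j\<in>UNIV. if i = j then [:1, 1:] * Y $ j else 0) - [:1, -1:] * (\<Sum>j\<in>UNIV. [:A $ i $ j:] * Y $ j)"
      unfolding sum_distrib_left sum_subtractf[symmetric] by (intro sum.cong refl) (simp only: left_diff_distrib mult.assoc, simp)
    finally show ?thesis by (simp add: matrix_vector_mult_def constp_def)
  qed
  have "((sig ([:1, -1:] *s Y)) has_vector_derivative A *v sig ([:1, -1:] *s Y) s + sig F s) (at s within {0..t})" for s
  proof -
    have sum_axis: "v = (\<Sum>i\<in>UNIV. (v $ i) *\<^sub>R axis i 1)" for v :: "real^'a"
      by (simp add: vec_eq_iff axis_def if_distrib sum.delta' cong: if_cong)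
    have d: "(A *v sig ([:1, -1:] *s Y) s + sig F s) $ i = sigs ([:1, 1:] * Y $ i) s" for i
      unfolding comp sig_constp[symmetric] sigs_add
      by (simp add: matrix_vector_mult_scale del: mult_pCons_left)
    have "((\<lambda>s. \<Sum>i\<in>UNIV. sigs ([:1, -1:] * Y $ i) s *\<^sub>R axis i 1) has_vector_derivative
        (\<Sum>i\<in>UNIV. sigs ([:1, 1:] * Y $ i) s *\<^sub>R axis i (1::real))) (at s within {0..t})"
      using DERIV_sigs unfolding has_real_derivative_iff_has_vector_derivative
      by (intro has_vector_derivative_sum
          bounded_linear.has_vector_derivative[OF bounded_linear_scaleR_left]) blast
    also have "(\<lambda>s. \<Sum>i\<in>UNIV. sigs ([:1, -1:] * Y $ i) s *\<^sub>R axis i 1) = sig ([:1, -1:] *s Y)"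
      by (rule ext) (subst (2) sum_axis, simp del: mult_pCons_left)
    also have "(\<Sum>i\<in>UNIV. sigs ([:1, 1:] * Y $ i) s *\<^sub>R axis i 1) = A *v sig ([:1, -1:] *s Y) s + sig F s"
      unfolding d[symmetric] by (rule sum_axis[symmetric])
    finally show ?thesis .
  qed
  from fundamental_theorem_of_calculus[OF t this]
  have "((\<lambda>s. A *v sig ([:1, -1:] *s Y) s + sig F s) has_integral
      sig ([:1, -1:] *s Y) t - sig ([:1, -1:] *s Y) 0) {0..t}" .
  moreover have "sig ([:1, -1:] *s Y) 0 = 0"
    by (simp add: vec_eq_iff del: mult_pCons_left)
  ultimately show "((\<lambda>s. A *v sig ([:1, -1:] *s Y) s + sig F s) has_integral
      sig ([:1, -1:] *s Y) t - 0) {0..t}" by simp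
qed

text \<open>Boundedness is read off from the transfer matrix on the unit circle, where \<open>Epoly A\<close> is
  invertible.\<close>

lemma poly_zero_state:
  fixes A :: "real^'n^'n"
  assumes "hurwitz A"
  obtains C where "C > 0"
    "\<And>R. ode A (sig (det (Epoly A) *s R)) 0 (sig ([:1, -1:] *s (adjp (Epoly A) *v R)))"
    "\<And>R. nsq (sig ([:1, -1:] *s (adjp (Epoly A) *v R)))
      \<le> C * nsq (sig (det (Epoly A) *s R))"
proof -
  have nz: "cp (det (Epoly A)) z \<noteq> 0" if "cmod z = 1" for z
    using cp_det_Epoly_neq_0[OF assms, of z] that by simp
  obtain c where c: "c > 0" "\<And>z. cmod z = 1 \<Longrightarrow> c \<le> cmod (cp (det (Epoly A)) z)"
    using cp_lower_bound_circ[OF nz] by blast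
  obtain K where K: "K > 0" "\<And>z u. cmod z = 1 \<Longrightarrow> norm (cem (adjp (Epoly A)) z *v u) \<le> K * norm u"
    using cem_bounded_circ by blast
  show ?thesis
  \<comment> \<open>On the circle |1 - z| is at most 2, \<open>K\<close> bounds the adjugate, and c
    bounds the determinant from below.\<close>
  proof (rule that[of "(2 * K / c)\<^sup>2"])
    show "0 < (2 * K / c)\<^sup>2" using K c by simp
  next
    fix R
    show "ode A (sig (det (Epoly A) *s R)) 0 (sig ([:1, -1:] *s (adjp (Epoly A) *v R)))"
      by (rule ode_sig) (simp add: mult_adjp_vector)
  next
    fix R :: "real poly^'n"
    show "nsq (sig ([:1, -1:] *s (adjp (Epoly A) *v R)))
      \<le> (2 * K / c)\<^sup>2 * nsq (sig (det (Epoly A) *s R))"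
    proof (rule ip_sig_le_circ)
      fix z :: complex assume z: "cmod z = 1"
      have "norm (cev ([:1, -1:] *s (adjp (Epoly A) *v R)) z) = cmod (1 - z) * norm (cem (adjp (Epoly A)) z *v cev R z)"
        unfolding cev_scale cev_mult norm_vector_scale by simp
      also have "\<dots> \<le> 2 * (K * norm (cev R z))"
        using norm_triangle_ineq4[of 1 z] z K by (intro mult_mono) auto
      also have "\<dots> = 2 * K / c * (c * norm (cev R z))" using c by simp
      also have "\<dots> \<le> 2 * K / c * (cmod (cp (det (Epoly A)) z) * norm (cev R z))"
        using c K z by (intro mult_left_mono mult_right_mono) auto
      also have "\<dots> = 2 * K / c * norm (cev (det (Epoly A) *s R) z)"
        by (simp add: cev_scale norm_vector_scale)
      finally show "(norm (cev ([:1, -1:] *s (adjp (Epoly A) *v R)) z))\<^sup>2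
        \<le> (2 * K / c)\<^sup>2 * (norm (cev (det (Epoly A) *s R) z))\<^sup>2"
        unfolding power_mult_distrib[symmetric] by (intro power_mono) auto
    qed
  qed
qed

text \<open>Converts mean-square convergence of inputs and states into convergence of the states at
  each time, by integrating A x + f over \<open>{0..t}\<close>.\<close>

lemma ode_pointwise_bound:
  fixes A :: "real^'n^'n"
  obtains K where "K > 0" "\<And>f x t. sqi f \<Longrightarrow> sqi x \<Longrightarrow> ode A f 0 x \<Longrightarrow> t \<ge> 0 \<Longrightarrow>
    (norm (x t))\<^sup>2 \<le> t * (K * nsq x + 2 * nsq f)"
proof -
  obtain K where K: "K > 0" "\<And>f. sqi f \<Longrightarrow> nsq (\<lambda>t. A *v f t) \<le> K * nsq f"
    using ip_matrix_bound by blast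
  have "(norm (x t))\<^sup>2 \<le> t * (2 * K * nsq x + 2 * nsq f)"
    if s: "sqi f" "sqi x" and o: "ode A f 0 x" and t: "t \<ge> 0" for f x t
  proof -
    define h where "h = (\<lambda>t. A *v x t) + f"
    have sA: "sqi (\<lambda>t. A *v x t)" by (rule sqi_bounded_linear[OF matrix_vector_mul_bounded_linear s(2)])
    have h: "sqi h" unfolding h_def by (rule sqi_add[OF sA s(1)])
    have "x t = integral {0..t} h"
      using o t unfolding ode_def h_def plus_fun_def by (auto intro!: integral_unique[symmetric])
    then have "(norm (x t))\<^sup>2 \<le> t * nsq h" using sqi_integral_bound(2)[OF h t] by simp
    also have "nsq h \<le> 2 * K * nsq x + 2 * nsq f"
      unfolding h_def using ip_self_add_le[OF sA s(1)] K(2)[OF s(2)] by linarith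
    finally show ?thesis using t by (simp add: mult_left_mono)
  qed
  with K(1) show ?thesis by (intro that[of "2 * K"]) auto
qed

text \<open>Inputs divisible by the determinant have explicit states with a uniform bound, and they
  are dense. The states of an approximating sequence are Cauchy at each time; Fatou carries the
  bound to their limit.\<close>

lemma zero_state_response_exists:
  fixes A :: "real^'n^'n"
  assumes A: "hurwitz A"
  obtains C where "C > 0" "\<And>f. sqi f \<Longrightarrow> \<exists>x. sqi x \<and> ode A f 0 x \<and> nsq x \<le> C * nsq f"
proof -
  obtain C where C: "C > 0"
    "\<And>R. ode A (sig (det (Epoly A) *s R)) 0 (sig ([:1, -1:] *s (adjp (Epoly A) *v R)))"
    "\<And>R. nsq (sig ([:1, -1:] *s (adjp (Epoly A) *v R)))
      \<le> C * nsq (sig (det (Epoly A) *s R))"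
    using poly_zero_state[OF A] by blast
  obtain K where K: "K > 0" "\<And>f x t. sqi f \<Longrightarrow> sqi x \<Longrightarrow> ode A f 0 x \<Longrightarrow> t \<ge> 0 \<Longrightarrow>
    (norm (x t))\<^sup>2 \<le> t * (K * nsq x + 2 * nsq f)"
    using ode_pointwise_bound by blast
  \<comment> \<open>The factor 2 comes from estimating the norms of the approximating inputs by
    \<open>2 * nsq f\<close> plus a null sequence.\<close>
  have "\<exists>x. sqi x \<and> ode A f 0 x \<and> nsq x \<le> 2 * C * nsq f" if f: "sqi f" for f
  proof -
    define e where "e i = 1 / real (Suc i)" for i
    have e: "e i > 0" "e \<longlonglongrightarrow> 0" for i
      using LIMSEQ_inverse_real_of_nat by (simp_all add: e_def[abs_def] inverse_eq_divide del: of_nat_Suc)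
    have e_mono: "e j \<le> e i" if "i \<le> j" for i j using that by (simp add: e_def frac_le)
    have nz: "cp (det (Epoly A)) z \<noteq> 0" if "cmod z < 1" for z
      using cp_det_Epoly_neq_0[OF A, of z] that by simp
    have "\<exists>R. nsq (f - sig (det (Epoly A) *s R)) < e i" for i
      by (rule sig_multiples_dense[OF f e(1)[of i] nz], assumption) (rule exI)
    then obtain R where R: "\<And>i. nsq (f - sig (det (Epoly A) *s R i)) < e i"
      by metis
    define u where "u i = sig (det (Epoly A) *s R i)" for i
    define y where "y i = sig ([:1, -1:] *s (adjp (Epoly A) *v R i))" for i
    have s: "sqi (u i)" "sqi (y i)" for i by (simp_all add: u_def y_def)
    have oy: "ode A (u i) 0 (y i)" for i unfolding u_def y_def by (rule C)
    have yb: "nsq (y i) \<le> C * nsq (u i)" for i unfolding u_def y_def by (rule C)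
    have fu: "nsq (f - u i) < e i" for i unfolding u_def by (rule R)
    have uu: "nsq (u i - u j) \<le> 2 * e i + 2 * e j" for i j
      using ip_self_diff_le[of "u i" f "u j"] fu[of i] fu[of j] f s ip_self_diff_commute[of f "u i"] by simp
    have sub: "y i - y j = sig ([:1, -1:] *s (adjp (Epoly A) *v (R i - R j)))"
      "u i - u j = sig (det (Epoly A) *s (R i - R j))" for i j
      unfolding y_def u_def sig_diff[symmetric]
      by (simp_all only: matrix_vector_mult_diff_distrib vector_ssub_ldistrib)
    have ode_sub: "ode A (u i - u j) 0 (y i - y j)" for i j unfolding sub by (rule C)
    have yy: "nsq (y i - y j) \<le> C * (2 * e i + 2 * e j)" for i j
    proof -
      have "nsq (y i - y j) \<le> C * nsq (u i - u j)" unfolding sub by (rule C)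
      also have "\<dots> \<le> C * (2 * e i + 2 * e j)" using uu C(1) by (intro mult_left_mono) auto
      finally show ?thesis .
    qed
    have pw: "(norm (y i t - y j t))\<^sup>2 \<le> t * ((K * C + 2) * (2 * e i + 2 * e j))" if "t \<ge> 0" for i j t
    proof -
      have "(norm ((y i - y j) t))\<^sup>2 \<le> t * (K * nsq (y i - y j) + 2 * nsq (u i - u j))"
        by (intro K(2) ode_sub sqi_diff s that)
      also have "\<dots> \<le> t * (K * (C * (2 * e i + 2 * e j)) + 2 * (2 * e i + 2 * e j))"
        using yy uu K(1) that by (intro mult_left_mono add_mono) auto
      finally show ?thesis by (simp add: algebra_simps)
    qed
    have "Cauchy (\<lambda>i. y i t)" if t: "t \<ge> 0" for t
    proof (rule metric_CauchyI)
      fix \<delta> :: real assume d: "\<delta> > 0"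
      define M where "M = t * ((K * C + 2) * 4)"
      have "(\<lambda>i. M * e i) \<longlonglongrightarrow> M * 0" by (intro tendsto_intros e)
      then have "eventually (\<lambda>i. M * e i < \<delta>\<^sup>2) sequentially"
        using d by (intro order_tendstoD(2)) auto
      then obtain n where n: "M * e n < \<delta>\<^sup>2" by (auto simp: eventually_sequentially)
      have "dist (y i t) (y j t) < \<delta>" if "i \<ge> n" "j \<ge> n" for i j
      proof -
        have "(norm (y i t - y j t))\<^sup>2 \<le> t * ((K * C + 2) * (2 * e i + 2 * e j))" by (rule pw[OF t])
        also have "\<dots> \<le> t * ((K * C + 2) * (2 * e n + 2 * e n))"
          using e_mono[OF that(1)] e_mono[OF that(2)] t K(1) C(1)
          by (intro mult_left_mono add_mono) auto
        also have "\<dots> = M * e n" by (simp add: M_def)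
        finally have "(norm (y i t - y j t))\<^sup>2 < \<delta>\<^sup>2" using n by simp
        then show ?thesis using d by (simp add: dist_norm power_less_imp_less_base)
      qed
      then show "\<exists>M. \<forall>m\<ge>M. \<forall>n\<ge>M. dist (y m t) (y n t) < \<delta>" by blast
    qed
    then have "\<exists>l. (\<lambda>i. y i t) \<longlonglongrightarrow> l" if "t \<ge> 0" for t
      using that by (simp add: Cauchy_convergent_iff convergent_def)
    then obtain x where x: "\<And>t. t \<ge> 0 \<Longrightarrow> (\<lambda>i. y i t) \<longlonglongrightarrow> x t" by metis
    have ub: "nsq (u i) \<le> 2 * nsq f + 2 * e i" for i
      using ip_self_add_le[of f "u i - f"] f s fu[of i] ip_self_diff_commute[of f "u i"] by (simp add: sqi_diff)
    have bd: "sqi x \<and> nsq x \<le> 2 * C * nsq f + \<delta>" if d: "\<delta> > 0" for \<delta>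
    proof -
      have "(\<lambda>i. 2 * C * e i) \<longlonglongrightarrow> 2 * C * 0" by (intro tendsto_intros e)
      then have "eventually (\<lambda>i. 2 * C * e i < \<delta>) sequentially" using d by (intro order_tendstoD(2)) auto
      then have "eventually (\<lambda>i. nsq (y i) \<le> 2 * C * nsq f + \<delta>) sequentially"
      proof eventually_elim
        case (elim i)
        have "nsq (y i) \<le> C * nsq (u i)" by (rule yb)
        also have "\<dots> \<le> C * (2 * nsq f + 2 * e i)" using ub C(1) by (intro mult_left_mono) auto
        finally show ?case using elim by (simp add: algebra_simps)
      qed
      then show ?thesis using sqi_limit[OF x s(2)] by blast
    qed
    from bd[OF zero_less_one] have sx: "sqi x" ..
    have xx: "nsq x \<le> 2 * C * nsq f"
      by (rule field_le_epsilon) (rule conjunct2[OF bd])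
    \<comment> \<open>Fatou once more, with i fixed and j growing: this gives a rate in norm, with
      which the integral equation passes to the limit.\<close>
    have yx: "nsq (x - y i) \<le> C * (4 * e i)" for i
    proof (rule sqi_limit(2)[of "\<lambda>j. y j - y i"])
      show "(\<lambda>j. (y j - y i) t) \<longlonglongrightarrow> (x - y i) t" if "t \<ge> 0" for t
        using x[OF that] by (auto intro!: tendsto_intros)
      show "sqi (y j - y i)" for j by (intro sqi_diff s)
      have "nsq (y j - y i) \<le> C * (4 * e i)" if "j \<ge> i" for j
      proof -
        have "C * (2 * e j + 2 * e i) \<le> C * (4 * e i)" using e_mono[OF that] C(1) by (intro mult_left_mono) auto
        with yy[of j i] show ?thesis by linarith
      qed
      then show "\<forall>\<^sub>F j in sequentially. nsq (y j - y i) \<le> C * (4 * e i)"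
        by (auto simp: eventually_sequentially)
    qed
    have "ode A f 0 x"
      unfolding ode_def
    proof (intro allI impI)
      fix t :: real assume t: "t \<ge> 0"
      have lin: "sqi (\<lambda>s. A *v g s)" if "sqi g" for g
        by (rule sqi_bounded_linear[OF matrix_vector_mul_bounded_linear that])
      obtain K' where K': "K' > 0" "\<And>f. sqi f \<Longrightarrow> nsq (\<lambda>t. A *v f t) \<le> K' * nsq f"
        using ip_matrix_bound[of A] by blast
      define h where "h = (\<lambda>s. A *v x s) + f"
      define hi where "hi i = (\<lambda>s. A *v y i s) + u i" for i
      have sh: "sqi h" "sqi (hi i)" for i
        unfolding h_def hi_def by (intro sqi_add lin sx s f)+
      have int_hi: "integral {0..t} (hi i) = y i t" for i
        using oy[of i] t by (simp add: ode_def hi_def integral_unique plus_fun_def)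
      have "(norm (integral {0..t} h - y i t))\<^sup>2 \<le> t * ((2 * K' * (C * 4) + 2) * e i)" for i
      proof -
        have eq: "h - hi i = (\<lambda>s. A *v (x - y i) s) + (f - u i)"
          by (simp add: h_def hi_def fun_eq_iff matrix_vector_mult_diff_distrib)
        have "integral {0..t} h - y i t = integral {0..t} (h - hi i)"
          unfolding int_hi[symmetric] fun_diff_def
          by (rule Henstock_Kurzweil_Integration.integral_diff[symmetric]) (intro sqi_integral_bound sh t)+
        then have "(norm (integral {0..t} h - y i t))\<^sup>2 \<le> t * nsq (h - hi i)"
          using sqi_integral_bound(2)[OF sqi_diff[OF sh(1) sh(2)[of i]] t] by simp
        also have "nsq (h - hi i) \<le> 2 * (K' * (C * (4 * e i))) + 2 * e i"
        proof -
          have "nsq (h - hi i) \<le> 2 * nsq (\<lambda>s. A *v (x - y i) s) + 2 * nsq (f - u i)"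
            unfolding eq by (intro ip_self_add_le lin sqi_diff sx s f)
          also have "nsq (\<lambda>s. A *v (x - y i) s) \<le> K' * (C * (4 * e i))"
            using K'(2)[OF sqi_diff[OF sx s(2)[of i]]] mult_left_mono[OF yx[of i], of K'] K'(1) by linarith
          finally show ?thesis using fu[of i] by linarith
        qed
        finally have "(norm (integral {0..t} h - y i t))\<^sup>2 \<le> t * (2 * (K' * (C * (4 * e i))) + 2 * e i)"
          using t by (simp add: mult_left_mono)
        then show ?thesis by (simp add: algebra_simps)
      qed
      then have le: "(norm (integral {0..t} h - y i t))\<^sup>2 \<le> t * ((2 * K' * (C * 4) + 2) * e i)" for i .
      have "(\<lambda>i. t * ((2 * K' * (C * 4) + 2) * e i)) \<longlonglongrightarrow> t * ((2 * K' * (C * 4) + 2) * 0)"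
        by (intro tendsto_intros e)
      then have lim: "(\<lambda>i. t * ((2 * K' * (C * 4) + 2) * e i)) \<longlonglongrightarrow> 0" by simp
      have "(\<lambda>i. (norm (integral {0..t} h - y i t))\<^sup>2) \<longlonglongrightarrow> 0"
        by (rule tendsto_sandwich[OF always_eventually always_eventually tendsto_const lim])
          (use le in auto)
      moreover have "(\<lambda>i. (norm (integral {0..t} h - y i t))\<^sup>2) \<longlonglongrightarrow> (norm (integral {0..t} h - x t))\<^sup>2"
        by (intro tendsto_intros x t)
      ultimately have "(norm (integral {0..t} h - x t))\<^sup>2 = 0" by (rule LIMSEQ_unique[symmetric])
      then have "integral {0..t} h = x t" by simp
      moreover have "h integrable_on {0..t}" by (rule sqi_integral_bound(1)[OF sh(1) t])
      ultimately show "((\<lambda>s. A *v x s + f s) has_integral x t - 0) {0..t}"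
        using integrable_integral[of h "{0..t}"] by (simp add: h_def plus_fun_def)
    qed
    with sx xx show ?thesis by (intro exI[of _ x] conjI)
  qed
  with C(1) show ?thesis by (intro that[of "2 * C"]) auto
qed

lemma zero_state_response:
  fixes A :: "real^'n^'n"
  assumes A: "hurwitz A"
  obtains C where "C > 0" "\<And>f. sqi f \<Longrightarrow> \<exists>x. sqi x \<and> ode A f 0 x"
    "\<And>f x. sqi f \<Longrightarrow> ode A f 0 x \<Longrightarrow> sqi x \<and> nsq x \<le> C * nsq f"
proof -
  obtain C where C: "C > 0" "\<And>f. sqi f \<Longrightarrow> \<exists>x. sqi x \<and> ode A f 0 x \<and> nsq x \<le> C * nsq f"
    using zero_state_response_exists[OF A] by blast
  have "sqi x \<and> nsq x \<le> C * nsq f" if "sqi f" "ode A f 0 x" for f x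
  proof -
    obtain y where y: "sqi y" "ode A f 0 y" "nsq y \<le> C * nsq f" using C(2)[OF \<open>sqi f\<close>] by blast
    have eq: "x t = y t" if "t \<ge> 0" for t using ode_unique[OF \<open>ode A f 0 x\<close> y(2) that] .
    then show ?thesis using y(1,3) sqi_cong[of x y] ip_cong[of x y x y] by simp
  qed
  with C that show ?thesis by blast
qed

text \<open>Reduction to zero initial state: e^(-t) \<xi> has the right initial value and solves the
  equation up to the input -(A e + e), which a zero-state response compensates.\<close>

lemma free_response:
  fixes A :: "real^'n^'n"
  assumes A: "hurwitz A"
  obtains x where "sqi x" "ode A 0 \<xi> x"
proof -
  define e where "e t = exp (- t) *\<^sub>R \<xi>" for t
  have se: "sqi e"
    unfolding e_def[abs_def]
    by (rule sqi_bounded_linear[OF bounded_linear_scaleR_left])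
      (use sqi_expo[of 1] in \<open>simp add: expo_def[abs_def]\<close>)
  have lin: "sqi (\<lambda>s. A *v g s)" if "sqi g" for g
    by (rule sqi_bounded_linear[OF matrix_vector_mul_bounded_linear that])
  have "sqi ((\<lambda>s. A *v e s) + e)" by (intro sqi_add lin se)
  then obtain y where y: "sqi y" "ode A ((\<lambda>s. A *v e s) + e) 0 y"
    using zero_state_response[OF A] by metis
  have "ode A (- ((\<lambda>s. A *v e s) + e)) \<xi> e"
    unfolding ode_def
  proof (intro allI impI)
    fix t :: real assume t: "t \<ge> 0"
    have "((\<lambda>s. - e s) has_integral e t - e 0) {0..t}"
      by (rule fundamental_theorem_of_calculus[OF t])
        (auto simp: e_def[abs_def] intro!: derivative_eq_intros)
    then show "((\<lambda>s. A *v e s + (- ((\<lambda>s. A *v e s) + e)) s) has_integral e t - \<xi>) {0..t}"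
      by (simp add: e_def)
  qed
  then have "ode A 0 \<xi> (y + e)"
    using ode_add[OF y(2)] by fastforce
  then show ?thesis using that sqi_add[OF y(1) se] by blast
qed

subsection \<open>Trajectories and the frequency domain inequality\<close>

lemma sum_UNIV_sum_type:
  "(\<Sum>i\<in>(UNIV :: ('a::finite + 'b::finite) set). f i) = (\<Sum>a\<in>UNIV. f (Inl a)) + (\<Sum>b\<in>UNIV. f (Inr b))"
  using sum.Plus[of "UNIV :: 'a set" "UNIV :: 'b set" f] by (simp add: o_def)

text \<open>State and inputs form one function into a product, so that trajectories are vectors of a
  single space, as the locale \<open>saddle\<close> requires.\<close>

definition xp :: "(real \<Rightarrow> 'x \<times> 'v \<times> 'w) \<Rightarrow> real \<Rightarrow> 'x" where "xp y t = fst (y t)"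
definition vp :: "(real \<Rightarrow> 'x \<times> 'v \<times> 'w) \<Rightarrow> real \<Rightarrow> 'v" where "vp y t = fst (snd (y t))"
definition wp :: "(real \<Rightarrow> 'x \<times> 'v \<times> 'w) \<Rightarrow> real \<Rightarrow> 'w" where "wp y t = snd (snd (y t))"
definition trip :: "(real \<Rightarrow> 'x) \<Rightarrow> (real \<Rightarrow> 'v) \<Rightarrow> (real \<Rightarrow> 'w) \<Rightarrow> real \<Rightarrow> 'x \<times> 'v \<times> 'w"
  where "trip x v w t = (x t, v t, w t)"

lemma trip_proj [simp]: "xp (trip x v w) = x" "vp (trip x v w) = v" "wp (trip x v w) = w"
  by (auto simp: xp_def vp_def wp_def trip_def)

lemma trip_eq: "trip (xp y) (vp y) (wp y) = y"
  by (auto simp: xp_def vp_def wp_def trip_def)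

lemma proj_add [simp]: "xp (y + y') = xp y + xp y'" "vp (y + y') = vp y + vp y'" "wp (y + y') = wp y + wp y'"
  by (auto simp: xp_def vp_def wp_def)

lemma proj_diff [simp]: "xp (y - y') = xp y - xp y'" "vp (y - y') = vp y - vp y'" "wp (y - y') = wp y - wp y'"
  by (auto simp: xp_def vp_def wp_def)

lemma proj_scaleR [simp]: "xp (c *\<^sub>R y) = c *\<^sub>R xp y" "vp (c *\<^sub>R y) = c *\<^sub>R vp y" "wp (c *\<^sub>R y) = c *\<^sub>R wp y"
  by (auto simp: xp_def vp_def wp_def)

lemma proj_0 [simp]: "xp 0 = 0" "vp 0 = 0" "wp 0 = 0"
  by (auto simp: xp_def vp_def wp_def)

lemma sqi_trip_iff:
  fixes x :: "real \<Rightarrow> 'x::euclidean_space" and v :: "real \<Rightarrow> 'v::euclidean_space" and w :: "real \<Rightarrow> 'w::euclidean_space"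
  shows "sqi (trip x v w) \<longleftrightarrow> sqi x \<and> sqi v \<and> sqi w"
proof
  assume s: "sqi (trip x v w)"
  have "sqi (\<lambda>t. fst (trip x v w t))" "sqi (\<lambda>t. fst (snd (trip x v w t)))" "sqi (\<lambda>t. snd (snd (trip x v w t)))"
    by (intro sqi_bounded_linear[OF _ s] bounded_linear_fst bounded_linear_snd
        bounded_linear_compose[of fst snd, unfolded o_def] bounded_linear_compose[of snd snd, unfolded o_def])+
  then show "sqi x \<and> sqi v \<and> sqi w" by (simp add: trip_def)
next
  assume s: "sqi x \<and> sqi v \<and> sqi w"
  have "bounded_linear (\<lambda>a::'x. (a, 0::'v, 0::'w))" "bounded_linear (\<lambda>a::'v. (0::'x, a, 0::'w))"
    "bounded_linear (\<lambda>a::'w. (0::'x, 0::'v, a))"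
    by (intro bounded_linear_Pair bounded_linear_ident bounded_linear_zero)+
  then have "sqi ((\<lambda>t. (x t, 0::'v, 0::'w)) + (\<lambda>t. (0::'x, v t, 0::'w)) + (\<lambda>t. (0::'x, 0::'v, w t)))"
    using s by (intro sqi_add) (auto intro: sqi_bounded_linear)
  also have "(\<lambda>t. (x t, 0::'v, 0::'w)) + (\<lambda>t. (0::'x, v t, 0::'w)) + (\<lambda>t. (0::'x, 0::'v, w t)) = trip x v w"
    by (auto simp: trip_def)
  finally show "sqi (trip x v w)" .
qed

lemma sqi_proj:
  fixes y :: "real \<Rightarrow> 'x::euclidean_space \<times> 'v::euclidean_space \<times> 'w::euclidean_space"
  assumes "sqi y" shows "sqi (xp y)" "sqi (vp y)" "sqi (wp y)"
  using assms sqi_trip_iff[of "xp y" "vp y" "wp y"] by (simp_all add: trip_eq)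

lemma ip_trip:
  fixes y :: "real \<Rightarrow> 'x::euclidean_space \<times> 'v::euclidean_space \<times> 'w::euclidean_space"
  assumes "sqi y" shows "nsq y = nsq (xp y) + nsq (vp y) + nsq (wp y)"
proof -
  note s = sqi_proj[OF assms]
  have "nsq y = (LINT t|halfline. xp y t \<bullet> xp y t + vp y t \<bullet> vp y t + wp y t \<bullet> wp y t)"
    by (simp add: ip_def inner_prod_def xp_def vp_def wp_def add.assoc)
  then show ?thesis
    by (simp add: ip_def integrable_inner s)
qed

definition stk :: "(real^'n) \<times> (real^'k) \<times> (real^'q) \<Rightarrow> real^('n + ('k + 'q))" where
  "stk y = stack3 (fst y) (fst (snd y)) (snd (snd y))"

lemma bounded_linear_stk: "bounded_linear stk"
proof -
  have "linear stk"
    by (rule linearI) (auto simp: stk_def stack3_def vec_eq_iff split: sum.splits)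
  then show ?thesis by (simp add: linear_conv_bounded_linear)
qed

lemma stk_add: "stk (a + b) = stk a + stk b"
  by (rule linear_add[OF bounded_linear.linear[OF bounded_linear_stk]])

lemma stk_scaleR: "stk (c *\<^sub>R a) = c *\<^sub>R stk a"
  by (rule linear_scale[OF bounded_linear.linear[OF bounded_linear_stk]])

text \<open>The cost is polarised between whole trajectories, so that convexity in v, concavity in w
  and their coupling all concern one symmetric bilinear form.\<close>

definition Bq :: "real^('n + ('k + 'q))^('n + ('k + 'q)) \<Rightarrow>
    (real \<Rightarrow> (real^'n) \<times> (real^'k) \<times> (real^'q)) \<Rightarrow> (real \<Rightarrow> (real^'n) \<times> (real^'k) \<times> (real^'q)) \<Rightarrow> real" where
  "Bq Q y y' = ip (\<lambda>t. stk (y t)) (\<lambda>t. Q *v stk (y' t))"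

lemma sqi_stk: "sqi y \<Longrightarrow> sqi (\<lambda>t. stk (y t))"
  by (rule sqi_bounded_linear[OF bounded_linear_stk])

lemma sqi_Q_stk: "sqi y \<Longrightarrow> sqi (\<lambda>t. Q *v stk (y t))"
  by (rule sqi_bounded_linear[OF matrix_vector_mul_bounded_linear sqi_stk])

lemma Bq_add_left: "sqi y \<Longrightarrow> sqi y' \<Longrightarrow> sqi u \<Longrightarrow> Bq Q (y + y') u = Bq Q y u + Bq Q y' u"
  using ip_add_left[OF sqi_stk sqi_stk sqi_Q_stk, of y y' u Q]
  by (simp add: Bq_def stk_add plus_fun_def)

lemma Bq_scaleR_left: "Bq Q (c *\<^sub>R y) u = c * Bq Q y u"
  using ip_scaleR_left[of c "\<lambda>t. stk (y t)"] by (simp add: Bq_def stk_scaleR scaleR_fun_def)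

lemma Bq_diff_right: "sqi y \<Longrightarrow> sqi u \<Longrightarrow> sqi u' \<Longrightarrow> Bq Q y (u - u') = Bq Q y u - Bq Q y u'"
proof -
  assume s: "sqi y" "sqi u" "sqi u'"
  have "(\<lambda>t. Q *v stk ((u - u') t)) = (\<lambda>t. Q *v stk (u t)) - (\<lambda>t. Q *v stk (u' t))"
    using stk_add[of "u t" "(-1) *\<^sub>R u' t" for t] stk_scaleR[of "-1" "u' t" for t]
    by (simp add: fun_eq_iff matrix_vector_mult_diff_distrib)
  then show ?thesis
    using s by (simp add: Bq_def ip_diff_right sqi_stk sqi_Q_stk)
qed

lemma Bq_sym: "transpose Q = Q \<Longrightarrow> Bq Q y u = Bq Q u y"
proof -
  assume Q: "transpose Q = Q"
  have "a \<bullet> (Q *v b) = b \<bullet> (Q *v a)" for a b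
  proof -
    have "a \<bullet> (Q *v b) = (transpose Q *v a) \<bullet> b"
      by (simp only: dot_lmul_matrix[symmetric] transpose_matrix_vector)
    then show ?thesis by (simp only: Q inner_commute)
  qed
  then show ?thesis by (simp only: Bq_def ip_def)
qed

lemma Bq_eq_integral: "Bq Q y y = (LINT t|halfline. sigma_Q Q (xp y t) (vp y t) (wp y t))"
  by (simp add: Bq_def ip_def sigma_Q_def stk_def xp_def vp_def wp_def)

lemma Bq_bounded:
  fixes Q :: "real^('n::finite + ('k::finite + 'q::finite))^('n + ('k + 'q))"
  obtains K where "K > 0" "\<And>y u. sqi y \<Longrightarrow> sqi u \<Longrightarrow> (Bq Q y u)\<^sup>2 \<le> K * nsq y * nsq u"
proof -
  obtain K1 where K1: "K1 > 0" "\<And>x. norm (stk x :: real^('n + ('k + 'q))) \<le> norm x * K1"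
    using bounded_linear.pos_bounded[OF bounded_linear_stk] by blast
  obtain K2 where K2: "K2 > 0"
    "\<And>f. sqi f \<Longrightarrow> nsq (\<lambda>t. Q *v f t) \<le> K2 * nsq f"
    using ip_matrix_bound[of Q] by blast
  have stk: "nsq (\<lambda>t. stk (y t)) \<le> K1\<^sup>2 * nsq y" if "sqi y"
    for y :: "real \<Rightarrow> (real^'n) \<times> (real^'k) \<times> (real^'q)"
  proof (rule ip_self_mono[OF sqi_stk[OF that] that])
    show "(norm (stk (y t)))\<^sup>2 \<le> K1\<^sup>2 * (norm (y t))\<^sup>2" for t
      using power_mono[OF K1(2)[of "y t"] norm_ge_zero, of 2] by (simp add: power_mult_distrib mult.commute)
  qed
  have "(Bq Q y u)\<^sup>2 \<le> (K1\<^sup>2 * (K2 * K1\<^sup>2)) * nsq y * nsq u" if s: "sqi y" "sqi u" for y u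
  proof -
    have "(Bq Q y u)\<^sup>2 \<le> nsq (\<lambda>t. stk (y t)) * nsq (\<lambda>t. Q *v stk (u t))"
      unfolding Bq_def by (intro ip_Cauchy_Schwarz sqi_stk sqi_Q_stk s)
    also have "\<dots> \<le> (K1\<^sup>2 * nsq y) * (K2 * (K1\<^sup>2 * nsq u))"
    proof (intro mult_mono stk s)
      show "nsq (\<lambda>t. Q *v stk (u t)) \<le> K2 * (K1\<^sup>2 * nsq u)"
        using K2(2)[OF sqi_stk[OF s(2)]] mult_left_mono[OF stk[OF s(2)], of K2] K2(1) by linarith
    qed auto
    finally show ?thesis by (simp add: mult_ac)
  qed
  with K1(1) K2(1) show ?thesis by (intro that[of "K1\<^sup>2 * (K2 * K1\<^sup>2)"]) auto
qed

section \<open>Square-integrable trajectories and their polynomial approximations\<close>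

definition traj :: "real^'n^'n \<Rightarrow> real^'k^'n \<Rightarrow> real^'q^'n \<Rightarrow> real^'n \<Rightarrow>
    (real \<Rightarrow> (real^'n) \<times> (real^'k) \<times> (real^'q)) \<Rightarrow> bool" where
  "traj A B1 B2 \<xi> y \<longleftrightarrow> sqi y \<and> solves_state A B1 B2 \<xi> (vp y) (wp y) (xp y)"

lemma traj_sqi: "traj A B1 B2 \<xi> y \<Longrightarrow> sqi y"
  by (simp add: traj_def)

lemma traj_add:
  assumes "traj A B1 B2 \<xi> y" "traj A B1 B2 \<eta> u"
  shows "traj A B1 B2 (\<xi> + \<eta>) (y + u)"
proof -
  have "ode A ((\<lambda>t. B1 *v vp y t + B2 *v wp y t) + (\<lambda>t. B1 *v vp u t + B2 *v wp u t)) (\<xi> + \<eta>) (xp y + xp u)"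
    using assms by (intro ode_add) (auto simp: traj_def solves_state_iff_ode)
  also have "(\<lambda>t. B1 *v vp y t + B2 *v wp y t) + (\<lambda>t. B1 *v vp u t + B2 *v wp u t)
      = (\<lambda>t. B1 *v vp (y + u) t + B2 *v wp (y + u) t)"
    unfolding proj_add by (simp add: fun_eq_iff matrix_vector_right_distrib algebra_simps)
  finally show ?thesis
    using assms unfolding traj_def solves_state_iff_ode proj_add by (simp add: sqi_add del: plus_fun_apply)
qed

lemma traj_scaleR:
  assumes "traj A B1 B2 \<xi> y"
  shows "traj A B1 B2 (c *\<^sub>R \<xi>) (c *\<^sub>R y)"
proof -
  have "ode A (c *\<^sub>R (\<lambda>t. B1 *v vp y t + B2 *v wp y t)) (c *\<^sub>R \<xi>) (c *\<^sub>R xp y)"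
    using assms by (intro ode_scaleR) (auto simp: traj_def solves_state_iff_ode)
  also have "c *\<^sub>R (\<lambda>t. B1 *v vp y t + B2 *v wp y t) = (\<lambda>t. B1 *v vp (c *\<^sub>R y) t + B2 *v wp (c *\<^sub>R y) t)"
    by (simp add: fun_eq_iff matrix_vector_mult_scaleR scaleR_right_distrib)
  finally show ?thesis
    using assms unfolding traj_def solves_state_iff_ode proj_scaleR by (simp add: sqi_scaleR del: scaleR_fun_apply)
qed

lemma traj_diff:
  assumes "traj A B1 B2 \<xi> y" "traj A B1 B2 \<eta> u"
  shows "traj A B1 B2 (\<xi> - \<eta>) (y - u)"
  using traj_add[OF assms(1) traj_scaleR[OF assms(2), of "-1"]] by simp

lemma sqi_input:
  fixes B1 :: "real^'k^'n" and B2 :: "real^'q^'n"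
  assumes "sqi v" "sqi w"
  shows "sqi (\<lambda>t. B1 *v v t + B2 *v w t)"
  using sqi_add[OF sqi_bounded_linear[OF matrix_vector_mul_bounded_linear assms(1)]
      sqi_bounded_linear[OF matrix_vector_mul_bounded_linear assms(2)]]
  by (simp add: plus_fun_def)

lemma zero_state_exists:
  fixes A :: "real^'n^'n"
  assumes "hurwitz A" "sqi f"
  shows "\<exists>x. sqi x \<and> ode A f 0 x"
proof -
  obtain C where C: "C > 0" "\<And>f. sqi f \<Longrightarrow> \<exists>x. sqi x \<and> ode A f 0 x \<and> nsq x \<le> C * nsq f"
    using zero_state_response_exists[OF assms(1)] by blast
  from C(2)[OF assms(2)] show ?thesis by (elim exE conjE) (intro exI conjI)
qed

lemma traj_exists:
  fixes A :: "real^'n^'n"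
  assumes A: "hurwitz A" and s: "sqi v" "sqi w"
  obtains x where "traj A B1 B2 \<xi> (trip x v w)"
proof -
  obtain x0 where x0: "sqi x0" "ode A 0 \<xi> x0" using free_response[OF A] by blast
  obtain x1 where x1: "sqi x1" "ode A (\<lambda>t. B1 *v v t + B2 *v w t) 0 x1"
    using zero_state_exists[OF A sqi_input[OF s, of B1 B2]] by (elim exE conjE)
  have "ode A (\<lambda>t. B1 *v v t + B2 *v w t) \<xi> (x0 + x1)"
    using ode_add[OF x0(2) x1(2)] by simp
  then have "traj A B1 B2 \<xi> (trip (x0 + x1) v w)"
    using s x0(1) x1(1) by (simp add: traj_def solves_state_iff_ode sqi_trip_iff sqi_add)
  then show ?thesis by (rule that)
qed

lemma traj_bound:
  fixes A :: "real^'n^'n" and B1 :: "real^'k^'n" and B2 :: "real^'q^'n"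
  assumes A: "hurwitz A"
  obtains C where "C > 0" "\<And>y. traj A B1 B2 0 y \<Longrightarrow> nsq y \<le> C * (nsq (vp y) + nsq (wp y))"
proof -
  obtain C where C: "C > 0" "\<And>f x. sqi f \<Longrightarrow> ode A f 0 x \<Longrightarrow> sqi x \<and> nsq x \<le> C * nsq f"
    by (rule zero_state_response[OF A]) blast
  obtain K1 where K1: "K1 > 0" "\<And>f. sqi f \<Longrightarrow> nsq (\<lambda>t. B1 *v f t) \<le> K1 * nsq f"
    using ip_matrix_bound[of B1] by blast
  obtain K2 where K2: "K2 > 0" "\<And>f. sqi f \<Longrightarrow> nsq (\<lambda>t. B2 *v f t) \<le> K2 * nsq f"
    using ip_matrix_bound[of B2] by blast
  have "nsq y \<le> (C * (2 * K1 + 2 * K2) + 1) * (nsq (vp y) + nsq (wp y))"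
    if "traj A B1 B2 0 y" for y
  proof -
    have s: "sqi y" using that by (rule traj_sqi)
    note p = sqi_proj[OF s]
    have lin: "sqi (\<lambda>t. B1 *v vp y t)" "sqi (\<lambda>t. B2 *v wp y t)"
      by (intro sqi_bounded_linear[OF matrix_vector_mul_bounded_linear] p)+
    have "nsq (xp y) \<le> C * nsq (\<lambda>t. B1 *v vp y t + B2 *v wp y t)"
      using that C(2)[OF sqi_input[OF p(2,3)]] by (auto simp: traj_def solves_state_iff_ode)
    also have "\<dots> \<le> C * (2 * (K1 * nsq (vp y)) + 2 * (K2 * nsq (wp y)))"
      using ip_self_add_le[OF lin] K1(2)[OF p(2)] K2(2)[OF p(3)] C(1)
      by (intro mult_left_mono) (auto simp: plus_fun_def)
    also have "\<dots> \<le> C * ((2 * K1 + 2 * K2) * (nsq (vp y) + nsq (wp y)))"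
      using C(1) K1(1) K2(1) by (intro mult_left_mono) (auto simp: algebra_simps)
    finally show ?thesis unfolding ip_trip[OF s] by (simp add: algebra_simps)
  qed
  with C(1) K1(1) K2(1) show ?thesis
    by (intro that[of "C * (2 * K1 + 2 * K2) + 1"]) (auto intro!: add_nonneg_pos)
qed

definition join :: "'a^'k \<Rightarrow> 'a^'q \<Rightarrow> 'a^('k + 'q)" where
  "join v w = (\<chi> i. case i of Inl a \<Rightarrow> v $ a | Inr b \<Rightarrow> w $ b)"

lemma join_nth [simp]: "join v w $ Inl a = v $ a" "join v w $ Inr b = w $ b"
  by (simp_all add: join_def)

lemma scale_join: "c *s join v w = join (c *s v) (c *s w)"
  by (auto simp: vec_eq_iff join_def split: sum.splits)

text \<open>State of the inputs det * V and det * W, with det the determinant of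
  \<open>Epoly A\<close>: this factor clears the denominator of the resolvent, leaving the adjugate,
  and 1 - z is the factor from \<open>ode_sig\<close>.\<close>

definition Xpoly :: "real^'n^'n \<Rightarrow> real^'k^'n \<Rightarrow> real^'q^'n \<Rightarrow> real poly^'k \<Rightarrow> real poly^'q \<Rightarrow> real poly^'n" where
  "Xpoly A B1 B2 V W = [:1, -1:] *s (adjp (Epoly A) *v (constp B1 *v V + constp B2 *v W))"

definition Spoly :: "real^'n^'n \<Rightarrow> real^'k^'n \<Rightarrow> real^'q^'n \<Rightarrow> real poly^'k \<Rightarrow> real poly^'q \<Rightarrow>
    real poly^('n + ('k + 'q))" where
  "Spoly A B1 B2 V W = join (Xpoly A B1 B2 V W) (join (det (Epoly A) *s V) (det (Epoly A) *s W))"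

definition ptraj :: "real^'n^'n \<Rightarrow> real^'k^'n \<Rightarrow> real^'q^'n \<Rightarrow> real poly^'k \<Rightarrow> real poly^'q \<Rightarrow>
    real \<Rightarrow> (real^'n) \<times> (real^'k) \<times> (real^'q)" where
  "ptraj A B1 B2 V W = trip (sig (Xpoly A B1 B2 V W)) (sig (det (Epoly A) *s V)) (sig (det (Epoly A) *s W))"

lemma stk_ptraj: "stk (ptraj A B1 B2 V W t) = sig (Spoly A B1 B2 V W) t"
  by (auto simp: vec_eq_iff stk_def stack3_def ptraj_def trip_def Spoly_def split: sum.splits)

lemma traj_ptraj:
  fixes A :: "real^'n^'n"
  assumes A: "hurwitz A"
  shows "traj A B1 B2 0 (ptraj A B1 B2 V W)"
proof -
  have "ode A (sig (det (Epoly A) *s (constp B1 *v V + constp B2 *v W))) 0 (sig (Xpoly A B1 B2 V W))"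
    unfolding Xpoly_def by (rule ode_sig) (simp add: mult_adjp_vector)
  also have "sig (det (Epoly A) *s (constp B1 *v V + constp B2 *v W))
      = (\<lambda>t. B1 *v sig (det (Epoly A) *s V) t + B2 *v sig (det (Epoly A) *s W) t)"
    by (simp add: vector_add_ldistrib sig_add fun_eq_iff sig_constp[symmetric] matrix_vector_mult_scale)
  finally show ?thesis
    by (simp add: traj_def ptraj_def solves_state_iff_ode sqi_trip_iff)
qed

text \<open>An input that is zero is approximated by zero itself, so responses to v alone or to w
  alone are approximated by responses of the same kind.\<close>

lemma ptraj_dense:
  fixes A :: "real^'n^'n"
  assumes A: "hurwitz A" and y: "traj A B1 B2 0 y" and d: "\<delta> > 0"
  obtains V W where "nsq (y - ptraj A B1 B2 V W) < \<delta>"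
    "vp y = 0 \<Longrightarrow> V = 0" "wp y = 0 \<Longrightarrow> W = 0"
proof -
  obtain C where C: "C > 0" "\<And>y. traj A B1 B2 0 y \<Longrightarrow> nsq y \<le> C * (nsq (vp y) + nsq (wp y))"
    using traj_bound[OF A] by blast
  define \<eta> where "\<eta> = \<delta> / (2 * C)"
  have eta: "\<eta> > 0" using C(1) d by (simp add: \<eta>_def)
  note p = sqi_proj[OF traj_sqi[OF y]]
  have nz: "cp (det (Epoly A)) z \<noteq> 0" if "cmod z < 1" for z
    using cp_det_Epoly_neq_0[OF A, of z] that by simp
  have ap: "\<exists>V. nsq (f - sig (det (Epoly A) *s V)) < \<eta> \<and> (f = 0 \<longrightarrow> V = 0)"
    if f: "sqi f" for f :: "real \<Rightarrow> real^'m"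
  proof (cases "f = 0")
    case True
    then show ?thesis using eta by (intro exI[of _ 0]) simp
  next
    case False
    obtain V where "nsq (f - sig (det (Epoly A) *s V)) < \<eta>"
      by (rule sig_multiples_dense[OF f eta nz])
    with False show ?thesis by (intro exI[of _ V]) simp
  qed
  obtain V where V: "nsq (vp y - sig (det (Epoly A) *s V)) < \<eta>" "vp y = 0 \<longrightarrow> V = 0"
    using ap[OF p(2)] by (elim exE conjE)
  obtain W where W: "nsq (wp y - sig (det (Epoly A) *s W)) < \<eta>" "wp y = 0 \<longrightarrow> W = 0"
    using ap[OF p(3)] by (elim exE conjE)
  have t: "traj A B1 B2 0 (y - ptraj A B1 B2 V W)"
    using traj_diff[OF y traj_ptraj[OF A]] by simp
  have "nsq (y - ptraj A B1 B2 V W)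
      \<le> C * (nsq (vp y - sig (det (Epoly A) *s V))
        + nsq (wp y - sig (det (Epoly A) *s W)))"
    using C(2)[OF t] by (simp add: ptraj_def)
  also have "\<dots> < C * (\<eta> + \<eta>)" using V W C(1) by (intro mult_strict_left_mono add_strict_mono) auto
  also have "\<dots> = \<delta>" using C(1) by (simp add: \<eta>_def)
  finally show ?thesis using that V(2) W(2) by blast
qed

section \<open>The frequency domain inequality for trajectories\<close>

definition Mfreq :: "real^'n^'n \<Rightarrow> real^'k^'n \<Rightarrow> real^'q^'n \<Rightarrow> complex \<Rightarrow> complex^('k + 'q)^('n + ('k + 'q))" where
  "Mfreq A B1 B2 s = (\<chi> i j. case i of
               Inl r \<Rightarrow> (matrix_inv (mat s - cmat A) ** cmat (Bcat B1 B2)) $ r $ j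
             | Inr r \<Rightarrow> (if r = j then 1 else 0))"

lemma PiQ_eq: "PiQ A B1 B2 Q s = cadj (Mfreq A B1 B2 s) ** cmat Q ** Mfreq A B1 B2 s"
  unfolding PiQ_def Mfreq_def Let_def ..

lemma ses_congruence: "ses (cadj M ** N ** M) u u' = ses N (M *v u) (M *v u')"
proof -
  have "ses (cadj M ** N ** M) u u' = (\<Sum>i\<in>UNIV. cnj (u $ i) * (cadj M *v (N *v (M *v u'))) $ i)"
    by (simp add: ses_def matrix_vector_mul_assoc matrix_mul_assoc)
  also have "\<dots> = (\<Sum>i\<in>UNIV. \<Sum>r\<in>UNIV. cnj (u $ i) * (cnj (M $ r $ i) * (N *v (M *v u')) $ r))"
    unfolding matrix_vector_mult_def[of "cadj M"] by (simp add: cadj_def sum_distrib_left)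
  also have "\<dots> = (\<Sum>r\<in>UNIV. \<Sum>i\<in>UNIV. cnj (u $ i) * (cnj (M $ r $ i) * (N *v (M *v u')) $ r))"
    by (rule sum.swap)
  also have "\<dots> = ses N (M *v u) (M *v u')"
    unfolding ses_def matrix_vector_mult_def[of M u]
    by (simp add: sum_distrib_right sum_distrib_left mult_ac)
  finally show ?thesis .
qed

lemma Mfreq_mult:
  "Mfreq A B1 B2 s *v u = join (matrix_inv (mat s - cmat A) *v (cmat (Bcat B1 B2) *v u)) u"
proof -
  have "(Mfreq A B1 B2 s *v u) $ i = join (matrix_inv (mat s - cmat A) *v (cmat (Bcat B1 B2) *v u)) u $ i" for i
  proof (cases i)
    case (Inl a)
    then show ?thesis
      by (simp add: Mfreq_def matrix_vector_mul_assoc) (simp add: matrix_vector_mult_def)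
  next
    case (Inr b)
    have "(\<Sum>j\<in>UNIV. (if b = j then 1 else 0) * u $ j) = (\<Sum>j\<in>UNIV. if b = j then u $ j else 0)"
      by (intro sum.cong) auto
    with Inr show ?thesis by (simp add: Mfreq_def matrix_vector_mult_def)
  qed
  then show ?thesis by (simp add: vec_eq_iff)
qed

lemma cmat_Bcat_join: "cmat (Bcat B1 B2) *v join v w = cmat B1 *v v + cmat B2 *v w"
  by (simp add: vec_eq_iff matrix_vector_mult_def cmat_def Bcat_def sum_UNIV_sum_type)

lemma cev_join: "cev (join V W) z = join (cev V z) (cev W z)"
  by (auto simp: vec_eq_iff cev_def join_def split: sum.splits)

lemma cev_add: "cev (U + V) z = cev U z + cev V z"
  by (simp add: vec_eq_iff cev_def)

lemma matrix_inv_left: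
  assumes "invertible M"
  shows "matrix_inv M ** M = mat 1"
  using assms unfolding invertible_def matrix_inv_def by (rule someI2_ex) simp

text \<open>The Cayley transform takes the unit circle without 1 to the imaginary axis.\<close>

lemma Cayley_resolvent:
  fixes A :: "real^'n^'n"
  assumes A: "hurwitz A" and z: "cmod z = 1" "z \<noteq> 1"
  shows "(1 - z) *s (cem (adjp (Epoly A)) z *v f)
    = matrix_inv (mat ((1 + z) / (1 - z)) - cmat A) *v (cp (det (Epoly A)) z *s f)"
proof -
  define s where "s = (1 + z) / (1 - z)"
  define d where "d = cp (det (Epoly A)) z"
  define X where "X = (1 - z) *s (cem (adjp (Epoly A)) z *v f)"
  have inv: "invertible (mat s - cmat A)"
    using A z unfolding hurwitz_def s_def by (auto simp: Re_Cayley)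
  have "cem (Epoly A) z *v X = (1 - z) *s (cem (Epoly A) z *v (cem (adjp (Epoly A)) z *v f))"
    unfolding X_def matrix_vector_mult_scale ..
  also have "cem (Epoly A) z *v (cem (adjp (Epoly A)) z *v f) = d *s f"
  proof -
    have "cem (Epoly A) z ** cem (adjp (Epoly A)) z = cem (Epoly A ** adjp (Epoly A)) z"
      by (simp add: vec_eq_iff cem_def matrix_matrix_mult_def)
    also have "\<dots> = mat d" by (simp add: matrix_mul_adjp vec_eq_iff cem_def mat_def d_def)
    finally show ?thesis by (simp add: matrix_vector_mul_assoc mat_mult_vector)
  qed
  finally have "mat (1 - z) *v ((mat s - cmat A) *v X) = (1 - z) *s (d *s f)"
    by (simp add: cem_Epoly_eq[OF z(2)] s_def matrix_vector_mul_assoc)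
  then have "(1 - z) *s ((mat s - cmat A) *v X) = (1 - z) *s (d *s f)" by (simp add: mat_mult_vector)
  then have *: "(mat s - cmat A) *v X = d *s f" using z(2) unfolding vector_mul_lcancel by simp
  have "X = matrix_inv (mat s - cmat A) *v ((mat s - cmat A) *v X)"
    using inv by (simp add: matrix_vector_mul_assoc matrix_inv_left)
  then show ?thesis unfolding * unfolding X_def s_def d_def .
qed

lemma cev_Spoly:
  fixes A :: "real^'n^'n"
  assumes A: "hurwitz A" and z: "cmod z = 1" "z \<noteq> 1"
  shows "cev (Spoly A B1 B2 V W) z
    = Mfreq A B1 B2 ((1 + z) / (1 - z)) *v (cp (det (Epoly A)) z *s join (cev V z) (cev W z))"
  unfolding Mfreq_mult matrix_vector_mult_scale[of "cmat (Bcat B1 B2)"] cmat_Bcat_join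
    Cayley_resolvent[OF assms, symmetric] Spoly_def cev_join Xpoly_def cev_scale cev_mult cev_add
  by (simp add: scale_join)

text \<open>With N above all degrees the sampled average is exact, and the nodes correspond to
  points of the imaginary axis, where the form is that of Pi at the inputs multiplied by the
  determinant.\<close>

lemma Bq_ptraj:
  fixes A :: "real^'n^'n"
  assumes A: "hurwitz A" and N: "degb (Spoly A B1 B2 V W) < N" "degb (Spoly A B1 B2 V' W') < N"
    "degb (constp Q *v Spoly A B1 B2 V' W') < N"
  shows "real N * Bq Q (ptraj A B1 B2 V W) (ptraj A B1 B2 V' W')
    = (\<Sum>j<N. Re (ses (PiQ A B1 B2 Q ((1 + circ N j) / (1 - circ N j)))
        (cp (det (Epoly A)) (circ N j) *s join (cev V (circ N j)) (cev W (circ N j)))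
        (cp (det (Epoly A)) (circ N j) *s join (cev V' (circ N j)) (cev W' (circ N j)))))"
  using ip_sig_quad_circ[OF N] N(1)
  by (simp add: Bq_def stk_ptraj cev_Spoly[OF A] PiQ_eq ses_congruence)

lemma cquad_blk_eps:
  "cquad (blk_eps \<epsilon> P) (join v w) = ses P (join v 0) (join v 0)
    + complex_of_real \<epsilon> * (ses P (join v 0) (join 0 w) + ses P (join 0 w) (join v 0))
    - ses P (join 0 w) (join 0 w)"
  unfolding cquad_def ses_def matrix_vector_mult_def blk_eps_def
  by (simp add: sum_UNIV_sum_type algebra_simps sum.distrib sum_distrib_left sum_negf)

lemma ses_blk22: "ses P (join 0 w) (join 0 w) = - cquad (- blk22 P) w"
  unfolding cquad_def ses_def matrix_vector_mult_def blk22_def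
  by (simp add: sum_UNIV_sum_type algebra_simps sum_distrib_left sum_negf)

lemma cev_0 [simp]: "cev 0 z = 0"
  by (simp add: vec_eq_iff cev_def)

text \<open>Hypothesis (a) is averaged over the nodes. The trajectories with W = 0 and V = 0 isolate
  the blocks of Pi, and the two conjugate off-diagonal blocks make up the factor 2.\<close>

lemma frequency_inequality_poly:
  fixes A :: "real^'n^'n"
  assumes A: "hurwitz A" and Q: "transpose Q = Q"
    and fdi: "\<And>s. Re s = 0 \<Longrightarrow> cpsd (blk_eps \<epsilon> (PiQ A B1 B2 Q s))"
  shows "0 \<le> Bq Q (ptraj A B1 B2 V 0) (ptraj A B1 B2 V 0)
    + 2 * \<epsilon> * Bq Q (ptraj A B1 B2 V 0) (ptraj A B1 B2 0 W)
    - Bq Q (ptraj A B1 B2 0 W) (ptraj A B1 B2 0 W)" (is "0 \<le> ?J")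
proof -
  define N where "N = Suc (Max {degb (Spoly A B1 B2 V 0), degb (Spoly A B1 B2 0 W),
    degb (constp Q *v Spoly A B1 B2 V 0), degb (constp Q *v Spoly A B1 B2 0 W)})"
  have N: "degb (Spoly A B1 B2 V 0) < N" "degb (Spoly A B1 B2 0 W) < N"
    "degb (constp Q *v Spoly A B1 B2 V 0) < N" "degb (constp Q *v Spoly A B1 B2 0 W) < N" "N > 0"
    by (auto simp: N_def)
  let ?s = "\<lambda>j. (1 + circ N j) / (1 - circ N j)"
  let ?d = "\<lambda>j. cp (det (Epoly A)) (circ N j)"
  let ?P = "\<lambda>j. PiQ A B1 B2 Q (?s j)"
  have "?J = Bq Q (ptraj A B1 B2 V 0) (ptraj A B1 B2 V 0)
    + \<epsilon> * (Bq Q (ptraj A B1 B2 V 0) (ptraj A B1 B2 0 W) + Bq Q (ptraj A B1 B2 0 W) (ptraj A B1 B2 V 0))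
    - Bq Q (ptraj A B1 B2 0 W) (ptraj A B1 B2 0 W)"
    using Bq_sym[OF Q, of "ptraj A B1 B2 0 W" "ptraj A B1 B2 V 0"] by simp
  then have J: "?J = Bq Q (ptraj A B1 B2 V 0) (ptraj A B1 B2 V 0)
    + \<epsilon> * (Bq Q (ptraj A B1 B2 V 0) (ptraj A B1 B2 0 W) + Bq Q (ptraj A B1 B2 0 W) (ptraj A B1 B2 V 0))
    - Bq Q (ptraj A B1 B2 0 W) (ptraj A B1 B2 0 W)" .
  have "real N * ?J = real N * Bq Q (ptraj A B1 B2 V 0) (ptraj A B1 B2 V 0)
    + \<epsilon> * (real N * Bq Q (ptraj A B1 B2 V 0) (ptraj A B1 B2 0 W) + real N * Bq Q (ptraj A B1 B2 0 W) (ptraj A B1 B2 V 0))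
    - real N * Bq Q (ptraj A B1 B2 0 W) (ptraj A B1 B2 0 W)"
    unfolding J by (simp only: distrib_left right_diff_distrib mult.left_commute[of "real N" \<epsilon>])
  also have "\<dots> = (\<Sum>j<N. Re (cquad (blk_eps \<epsilon> (?P j)) (join (?d j *s cev V (circ N j)) (?d j *s cev W (circ N j)))))"
    unfolding cquad_blk_eps Bq_ptraj[OF A N(1) N(1) N(3)] Bq_ptraj[OF A N(1) N(2) N(4)]
      Bq_ptraj[OF A N(2) N(1) N(3)] Bq_ptraj[OF A N(2) N(2) N(4)]
    by (simp add: scale_join sum_distrib_left sum.distrib sum_subtractf algebra_simps)
  also have "\<dots> \<ge> 0"
    using fdi N(5) by (intro sum_nonneg) (auto simp: cpsd_def Re_Cayley)
  finally show ?thesis using N(5) by (simp add: zero_le_mult_iff)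
qed

lemma power2_less_imp_abs: "a\<^sup>2 < b\<^sup>2 \<Longrightarrow> \<bar>a\<bar> < \<bar>b\<bar>" for a b :: real
  using abs_le_square_iff[of b a] by linarith

lemma Bq_approx:
  fixes Q :: "real^('n::finite + ('k::finite + 'q::finite))^('n + ('k + 'q))"
  assumes "sqi y" "sqi u" "e > 0"
  obtains \<delta> where "\<delta> > 0" "\<And>y' u'. sqi y' \<Longrightarrow> sqi u' \<Longrightarrow> nsq (y - y') < \<delta> \<Longrightarrow> nsq (u - u') < \<delta>
    \<Longrightarrow> \<bar>Bq Q y' u' - Bq Q y u\<bar> < e"
proof -
  obtain K where K: "K > 0" "\<And>y u. sqi y \<Longrightarrow> sqi u \<Longrightarrow> (Bq Q y u)\<^sup>2 \<le> K * nsq y * nsq u"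
    using Bq_bounded by blast
  define M where "M = 1 + nsq y + nsq u"
  have M: "M \<ge> 1" by (simp add: M_def)
  \<comment> \<open>The 16 makes \<open>K * \<delta> * (2 * M)\<close> at most
    \<open>e\<^sup>2 / 8\<close>, hence below the square of e / 2; there is one error of size e / 2
    for each argument of the form.\<close>
  define \<delta> where "\<delta> = min 1 (e\<^sup>2 / (16 * K * M))"
  have d: "\<delta> > 0" "\<delta> \<le> 1" "K * \<delta> * (2 * M) < (e / 2)\<^sup>2"
  proof -
    show "\<delta> > 0" "\<delta> \<le> 1" using K(1) M assms(3) by (auto simp: \<delta>_def)
    have "K * \<delta> * (2 * M) \<le> K * (e\<^sup>2 / (16 * K * M)) * (2 * M)"
      using K(1) M by (intro mult_right_mono mult_left_mono) (auto simp: \<delta>_def)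
    also have "\<dots> = e\<^sup>2 / 8" using K(1) M by simp
    also have "\<dots> < (e / 2)\<^sup>2" using assms(3) by (simp add: power_divide)
    finally show "K * \<delta> * (2 * M) < (e / 2)\<^sup>2" .
  qed
  show ?thesis
  proof (rule that[OF d(1)])
    fix y' u' :: "real \<Rightarrow> (real^'n) \<times> (real^'k) \<times> (real^'q)"
    assume s: "sqi y'" "sqi u'" and dy: "nsq (y - y') < \<delta>" and du: "nsq (u - u') < \<delta>"
    have small: "\<bar>b\<bar> < e / 2" if "b\<^sup>2 \<le> K * a * c" "0 \<le> a" "a \<le> \<delta>" "0 \<le> c" "c \<le> 2 * M" for a b c
    proof -
      have "K * a * c \<le> K * \<delta> * (2 * M)" using that K(1) d by (intro mult_mono) auto
      with that(1) d(3) have "b\<^sup>2 < (e / 2)\<^sup>2" by linarith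
      then have "\<bar>b\<bar> < \<bar>e / 2\<bar>" by (simp only: power2_less_imp_abs)
      then show ?thesis using assms(3) by simp
    qed
    have "nsq u' \<le> 2 * nsq u + 2"
      using ip_self_add_le[of u "u' - u"] assms(1,2) s du d(2) ip_self_diff_commute[of u u']
      by (simp add: sqi_diff)
    then have uu: "nsq u' \<le> 2 * M"
    proof -
      have aux: "a \<le> 2 * (1 + c + b)" if "a \<le> 2 * b + 2" "0 \<le> c" for a b c :: real
        using that by simp
      show ?thesis unfolding M_def by (rule aux[OF \<open>nsq u' \<le> 2 * nsq u + 2\<close> ip_nonneg])
    qed
    have yu: "nsq y \<le> 2 * M"
    proof -
      have aux: "a \<le> 2 * (1 + a + b)" if "0 \<le> a" "0 \<le> b" for a b :: real
        using that by simp
      show ?thesis unfolding M_def by (rule aux[OF ip_nonneg ip_nonneg])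
    qed
    have 1: "\<bar>Bq Q (y - y') u'\<bar> < e / 2"
      using K(2)[of "y - y'" u'] assms s dy uu by (intro small) (auto simp: sqi_diff)
    have "(Bq Q y (u - u'))\<^sup>2 \<le> K * nsq (u - u') * nsq y"
      using K(2)[of y "u - u'"] assms s by (simp add: sqi_diff mult_ac)
    then have 2: "\<bar>Bq Q y (u - u')\<bar> < e / 2"
      using du yu by (intro small) auto
    have "Bq Q (y - y') u' = Bq Q y u' - Bq Q y' u'"
      using Bq_add_left[of y "(-1) *\<^sub>R y'" u' Q] Bq_scaleR_left[of Q "-1" y' u'] assms s
      by (simp add: sqi_scaleR[of y' "-1", simplified])
    moreover have "Bq Q y (u - u') = Bq Q y u - Bq Q y u'"
      using Bq_diff_right[of y u u' Q] assms s by simp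
    ultimately show "\<bar>Bq Q y' u' - Bq Q y u\<bar> < e" using 1 2 by linarith
  qed
qed

lemma frequency_inequality:
  fixes A :: "real^'n^'n"
  assumes A: "hurwitz A" and Q: "transpose Q = Q"
    and fdi: "\<And>s. Re s = 0 \<Longrightarrow> cpsd (blk_eps \<epsilon> (PiQ A B1 B2 Q s))"
    and h: "traj A B1 B2 0 h" "wp h = 0" and k: "traj A B1 B2 0 k" "vp k = 0"
  shows "0 \<le> Bq Q h h + 2 * \<epsilon> * Bq Q h k - Bq Q k k"
proof (rule ccontr)
  define m where "m = - (Bq Q h h + 2 * \<epsilon> * Bq Q h k - Bq Q k k)"
  assume "\<not> 0 \<le> Bq Q h h + 2 * \<epsilon> * Bq Q h k - Bq Q k k"
  then have m: "m > 0" by (simp add: m_def)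
  \<comment> \<open>The errors in the three terms enter with weights 1, 2 |\<epsilon>| and
    1.\<close>
  define e where "e = m / (2 + 2 * \<bar>\<epsilon>\<bar>)"
  have e: "e > 0" using m by (simp add: e_def)
  note s = traj_sqi[OF h(1)] traj_sqi[OF k(1)]
  obtain d1 where d1: "d1 > 0" "\<And>y' u'. sqi y' \<Longrightarrow> sqi u' \<Longrightarrow> nsq (h - y') < d1 \<Longrightarrow> nsq (h - u') < d1
    \<Longrightarrow> \<bar>Bq Q y' u' - Bq Q h h\<bar> < e" using Bq_approx[OF s(1) s(1) e] by blast
  obtain d2 where d2: "d2 > 0" "\<And>y' u'. sqi y' \<Longrightarrow> sqi u' \<Longrightarrow> nsq (h - y') < d2 \<Longrightarrow> nsq (k - u') < d2
    \<Longrightarrow> \<bar>Bq Q y' u' - Bq Q h k\<bar> < e" using Bq_approx[OF s(1) s(2) e] by blast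
  obtain d3 where d3: "d3 > 0" "\<And>y' u'. sqi y' \<Longrightarrow> sqi u' \<Longrightarrow> nsq (k - y') < d3 \<Longrightarrow> nsq (k - u') < d3
    \<Longrightarrow> \<bar>Bq Q y' u' - Bq Q k k\<bar> < e" using Bq_approx[OF s(2) s(2) e] by blast
  define d where "d = min d1 (min d2 d3)"
  have d: "d > 0" using d1 d2 d3 by (simp add: d_def)
  obtain V where V: "nsq (h - ptraj A B1 B2 V 0) < d"
    using ptraj_dense[OF A h(1) d] h(2) by metis
  obtain W where W: "nsq (k - ptraj A B1 B2 0 W) < d"
    using ptraj_dense[OF A k(1) d] k(2) by metis
  note sp = traj_sqi[OF traj_ptraj[OF A, of B1 B2 V 0]] traj_sqi[OF traj_ptraj[OF A, of B1 B2 0 W]]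
  have 1: "\<bar>Bq Q (ptraj A B1 B2 V 0) (ptraj A B1 B2 V 0) - Bq Q h h\<bar> < e"
    using V by (intro d1 sp) (auto simp: d_def)
  have 2: "\<bar>Bq Q (ptraj A B1 B2 V 0) (ptraj A B1 B2 0 W) - Bq Q h k\<bar> < e"
    using V W by (intro d2 sp) (auto simp: d_def)
  have 3: "\<bar>Bq Q (ptraj A B1 B2 0 W) (ptraj A B1 B2 0 W) - Bq Q k k\<bar> < e"
    using W by (intro d3 sp) (auto simp: d_def)
  have 4: "\<bar>2 * \<epsilon> * Bq Q (ptraj A B1 B2 V 0) (ptraj A B1 B2 0 W) - 2 * \<epsilon> * Bq Q h k\<bar> \<le> 2 * \<bar>\<epsilon>\<bar> * e"
    unfolding right_diff_distrib[symmetric] abs_mult using 2 by (intro mult_mono) auto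
  have "(2 + 2 * \<bar>\<epsilon>\<bar>) * e = m"
    by (simp add: e_def add_nonneg_eq_0_iff)
  then have "m = 2 * e + 2 * \<bar>\<epsilon>\<bar> * e" by (simp only: distrib_right)
  with frequency_inequality_poly[OF A Q fdi, of V W] 1 3 4 show False
    by (simp add: m_def)
qed

subsection \<open>Inversion of the minimum phase output\<close>

text \<open>Equals \<open>sysmat\<close> at s = (1 + z) / (1 - z) with the state columns multiplied
  by 1 - z, so the minimum phase condition excludes zeros of its determinant in the open
  disc.\<close>

definition syspoly :: "real^'n^'n \<Rightarrow> real^'k^'n \<Rightarrow> real^'n^'k \<Rightarrow> real^'k^'k \<Rightarrow> real poly^('n + 'k)^('n + 'k)" where
  "syspoly A B1 C D1 = (\<chi> i j. case (i, j) of
       (Inl a, Inl b) \<Rightarrow> - Epoly A $ a $ b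
     | (Inl a, Inr b) \<Rightarrow> [:B1 $ a $ b:]
     | (Inr a, Inl b) \<Rightarrow> [:1, -1:] * [:C $ a $ b:]
     | (Inr a, Inr b) \<Rightarrow> [:D1 $ a $ b:])"

lemma cp_det_syspoly_neq_0:
  fixes A :: "real^'n^'n" and B1 :: "real^'k^'n" and C :: "real^'n^'k" and D1 :: "real^'k^'k"
  assumes min_phase: "\<And>s. Re s > 0 \<Longrightarrow> det (sysmat A B1 C D1 s) \<noteq> 0" and z: "cmod z < 1"
  shows "cp (det (syspoly A B1 C D1)) z \<noteq> 0"
proof -
  define s where "s = (1 + z) / (1 - z)"
  define L :: "complex^('n + 'k)^('n + 'k)" where
    "L = (\<chi> i j. if i = j then (case i of Inl _ \<Rightarrow> 1 - z | Inr _ \<Rightarrow> 1) else 0)"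
  have z1: "z \<noteq> 1" using z by auto
  have "Re s > 0"
    unfolding s_def Re_Cayley using z z1 by (intro divide_pos_pos) (auto simp: abs_square_less_1)
  then have "det (sysmat A B1 C D1 s) \<noteq> 0" by (rule min_phase)
  moreover have "det L \<noteq> 0"
    using z1 by (auto simp: det_diagonal L_def split: sum.splits)
  moreover have "cem (syspoly A B1 C D1) z = sysmat A B1 C D1 s ** L"
  proof -
    have sz: "s * (1 - z) = 1 + z" using z1 by (simp add: s_def)
    have "(sysmat A B1 C D1 s ** L) $ i $ j = sysmat A B1 C D1 s $ i $ j * L $ j $ j" for i j
      unfolding matrix_matrix_mult_def
      by (simp add: L_def if_distrib sum.delta' cong: if_cong)
    moreover have "cem (syspoly A B1 C D1) z $ i $ j = sysmat A B1 C D1 s $ i $ j * L $ j $ j" for i j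
      using sz by (cases i; cases j) (auto simp: cem_def syspoly_def Epoly_def sysmat_def L_def algebra_simps)
    ultimately show ?thesis by (simp add: vec_eq_iff)
  qed
  ultimately show ?thesis by (simp add: cp_det det_mul)
qed

lemma join_eta: "join (\<chi> a. z $ Inl a) (\<chi> b. z $ Inr b) = z"
  by (auto simp: vec_eq_iff join_def split: sum.splits)

text \<open>No inverse system is needed, which zeros on the imaginary axis could make unstable:
  multiples of the determinant of the system matrix are dense, and such outputs are produced exactly
  by polynomial inputs and states.\<close>

lemma almost_zero_output:
  fixes A :: "real^'n^'n" and B1 :: "real^'k^'n" and B2 :: "real^'q^'n"
    and C :: "real^'n^'k" and D1 :: "real^'k^'k" and f :: "real \<Rightarrow> real^'k"
  assumes min_phase: "\<And>s. Re s > 0 \<Longrightarrow> det (sysmat A B1 C D1 s) \<noteq> 0"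
    and f: "sqi f" and d: "\<delta> > 0"
  obtains h where "traj A B1 B2 0 h" "wp h = 0"
    "nsq (f - (\<lambda>t. C *v xp h t + D1 *v vp h t)) < \<delta>"
proof -
  define S where "S = syspoly A B1 C D1"
  have nz: "cp (det S) z \<noteq> 0" if "cmod z < 1" for z
    unfolding S_def using min_phase that by (rule cp_det_syspoly_neq_0)
  obtain \<Psi> where Psi: "nsq (f - sig (det S *s \<Psi>)) < \<delta>"
    by (rule sig_multiples_dense[OF f d nz])
  \<comment> \<open>Cramer's rule with right-hand side (0, det S * \<Psi>): the zero block keeps the
    state equation exact, so the whole error sits in the output.\<close>
  define Z where "Z = adjp S *v join 0 \<Psi>"
  define Y where "Y = (\<chi> a. Z $ Inl a)"
  define V where "V = (\<chi> b. Z $ Inr b)"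
  have Z: "Z = join Y V" by (simp add: Y_def V_def join_eta)
  have SZ: "S *v join Y V = det S *s join 0 \<Psi>"
    unfolding Z[symmetric] Z_def by (rule mult_adjp_vector)
  have "Epoly A *v Y = constp B1 *v V"
  proof -
    have "(constp B1 *v V) $ a - (Epoly A *v Y) $ a = (S *v join Y V) $ Inl a" for a
      by (simp add: matrix_vector_mult_def sum_UNIV_sum_type S_def syspoly_def constp_def sum_negf)
    then have "(constp B1 *v V) $ a - (Epoly A *v Y) $ a = 0" for a
      by (simp add: SZ)
    then show ?thesis by (simp add: vec_eq_iff)
  qed
  then have ode: "ode A (sig (constp B1 *v V)) 0 (sig ([:1, -1:] *s Y))" by (rule ode_sig)
  have out: "constp C *v ([:1, -1:] *s Y) + constp D1 *v V = det S *s \<Psi>"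
  proof -
    have "(constp C *v ([:1, -1:] *s Y) + constp D1 *v V) $ b = (S *v join Y V) $ Inr b" for b
      by (simp add: matrix_vector_mult_def sum_UNIV_sum_type S_def syspoly_def constp_def mult_ac
          del: mult_pCons_left mult_pCons_right)
    then show ?thesis by (simp add: vec_eq_iff SZ)
  qed
  define h where "h = trip (sig ([:1, -1:] *s Y)) (sig V) (0 :: real \<Rightarrow> real^'q)"
  have "sig (constp B1 *v V) = (\<lambda>t. B1 *v sig V t + B2 *v (0 :: real \<Rightarrow> real^'q) t)"
    by (simp add: fun_eq_iff sig_constp)
  then have "traj A B1 B2 0 h"
    using ode by (simp add: traj_def solves_state_iff_ode h_def sqi_trip_iff)
  moreover have "(\<lambda>t. C *v xp h t + D1 *v vp h t) = sig (det S *s \<Psi>)"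
    unfolding out[symmetric] by (simp add: fun_eq_iff sig_add sig_constp h_def)
  ultimately show ?thesis using that[of h] Psi by (simp add: h_def)
qed

subsection \<open>The coupling with the initial state\<close>

lemma sum_coeff_lessThan:
  fixes p :: "complex poly"
  assumes "degree p < N"
  shows "(\<Sum>k\<le>degree p. f k * coeff p k) = (\<Sum>k<N. f k * coeff p k)"
proof -
  have "{..degree p} \<subseteq> {..<N}" using assms by auto
  then show ?thesis by (rule sum.mono_neutral_left[OF finite_lessThan]) (auto simp: coeff_eq_0 not_le)
qed

text \<open>Complex-linear extension of pairing with \<open>f\<close>; complex polynomials are
  needed to divide out roots on the circle.\<close>

definition lagfun :: "(real \<Rightarrow> real) \<Rightarrow> complex poly \<Rightarrow> complex" where
  "lagfun f p = (\<Sum>k\<le>degree p. complex_of_real (ip f (lag k)) * coeff p k)"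

lemma lagfun_eq: "degree p < N \<Longrightarrow> lagfun f p = (\<Sum>k<N. complex_of_real (ip f (lag k)) * coeff p k)"
  unfolding lagfun_def by (rule sum_coeff_lessThan)

lemma lagfun_add: "lagfun f (p + q) = lagfun f p + lagfun f q"
proof -
  define N where "N = Suc (max (degree p) (degree q))"
  have "degree p < N" "degree q < N" "degree (p + q) < N"
    by (auto simp: N_def less_Suc_eq_le intro: degree_add_le_max)
  then show ?thesis by (simp add: lagfun_eq algebra_simps sum.distrib)
qed

lemma lagfun_smult: "lagfun f (smult c p) = c * lagfun f p"
proof -
  have "degree (smult c p) < Suc (degree p)" by (simp add: less_Suc_eq_le degree_smult_le)
  then have "lagfun f (smult c p) = (\<Sum>k<Suc (degree p). complex_of_real (ip f (lag k)) * coeff (smult c p) k)"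
    by (rule lagfun_eq)
  then show ?thesis by (simp add: lagfun_eq[of p "Suc (degree p)"] sum_distrib_left mult_ac del: sum.lessThan_Suc)
qed

lemma lagfun_shift:
  "lagfun f (pCons 0 p) = (\<Sum>k\<le>degree p. complex_of_real (ip f (lag (Suc k))) * coeff p k)"
proof -
  have "degree (pCons 0 p) < Suc (Suc (degree p))"
    by (simp add: less_Suc_eq_le degree_pCons_le)
  then have "lagfun f (pCons 0 p) = (\<Sum>k<Suc (Suc (degree p)). complex_of_real (ip f (lag k)) * coeff (pCons 0 p) k)"
    by (rule lagfun_eq)
  then show ?thesis by (subst (asm) sum.lessThan_Suc_shift) (simp add: lessThan_Suc_atMost)
qed

lemma ip_sigs_lagfun: "complex_of_real (ip f (sigs p)) = lagfun f (map_poly complex_of_real p)"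
  if "sqi f"
proof -
  have "ip f (sigs p) = (\<Sum>k<Suc (degree p). ip f (lag k) * coeff p k)"
    unfolding sigs_def lessThan_Suc_atMost using that by (simp add: ip_sum_right sqi_scaleR mult.commute)
  moreover have "degree (map_poly complex_of_real p) < Suc (degree p)"
    using degree_map_of_real[of p] by simp
  ultimately show ?thesis by (simp add: lagfun_eq coeff_map_poly del: sum.lessThan_Suc)
qed

text \<open>Cauchy-Schwarz for sums together with Bessel's inequality for the Laguerre coefficients
  of \<open>f\<close>.\<close>

lemma lagfun_bound:
  assumes f: "sqi f"
  shows "(cmod (lagfun f p))\<^sup>2 \<le> nsq f * n2 p"
proof -
  define N where "N = Suc (degree p)"
  define c where "c k = ip f (lag k)" for k
  define s where "s = sigs (\<Sum>k<N. monom (c k) k)"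
  have s: "s = (\<Sum>k<N. c k *\<^sub>R lag k)" by (simp add: s_def sigs_sum sigs_monom)
  have fs: "ip f s = (\<Sum>k<N. (c k)\<^sup>2)"
    using f by (simp add: s ip_sum_right sqi_scaleR c_def power2_eq_square)
  have "ip (lag k) s = c k" if "k < N" for k
    using that by (simp add: s ip_sum_right sqi_scaleR ip_lag if_distrib sum.delta' cong: if_cong)
  then have ss: "nsq s = (\<Sum>k<N. (c k)\<^sup>2)"
    by (subst (1) s) (simp add: ip_sum_left sqi_scaleR sqi_sum s_def power2_eq_square)
  have "0 \<le> nsq (f - s)" by simp
  then have Bessel: "(\<Sum>k<N. (c k)\<^sup>2) \<le> nsq f"
    using f fs ss by (simp add: s_def ip_diff_left ip_diff_right sqi_diff ip_commute[of "sigs _" f])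
  have "cmod (lagfun f p) \<le> (\<Sum>k<N. cmod (complex_of_real (c k) * coeff p k))"
  proof -
    have "lagfun f p = (\<Sum>k<N. complex_of_real (c k) * coeff p k)"
      unfolding c_def by (rule lagfun_eq) (simp add: N_def)
    then show ?thesis by (simp only: norm_sum)
  qed
  also have "\<dots> = (\<Sum>k<N. \<bar>c k\<bar> * cmod (coeff p k))" by (simp add: norm_mult)
  finally have "(cmod (lagfun f p))\<^sup>2 \<le> (\<Sum>k<N. \<bar>c k\<bar> * cmod (coeff p k))\<^sup>2"
    by (intro power_mono) auto
  also have "\<dots> \<le> (\<Sum>k<N. \<bar>c k\<bar>\<^sup>2) * (\<Sum>k<N. (cmod (coeff p k))\<^sup>2)"
    by (rule Cauchy_Schwarz_ineq_sum)
  also have "\<dots> \<le> nsq f * n2 p"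
    using Bessel by (simp add: n2_eq[of p N] N_def mult_right_mono sum_nonneg)
  finally show ?thesis .
qed

text \<open>The derivative of |x|^2 is 2 x . A x, which is integrable because x is square
  integrable. Boundedness serves to drop the boundary term at infinity in the recurrence that
  follows.\<close>

lemma ode_free_bounded:
  fixes A :: "real^'n^'n"
  assumes x: "ode A (\<lambda>_. 0) \<xi> x" and s: "sqi x"
  obtains K where "\<And>t. t \<ge> 0 \<Longrightarrow> norm (x t) \<le> K"
proof -
  define g where "g t = 2 * (x t \<bullet> (A *v x t))" for t
  have sA: "sqi (\<lambda>t. A *v x t)" by (rule sqi_bounded_linear[OF matrix_vector_mul_bounded_linear s])
  have ig: "integrable halfline g" unfolding g_def using integrable_inner[OF s sA] by simp
  have "norm (x t) \<le> sqrt (x 0 \<bullet> x 0 + (LINT t|halfline. \<bar>g t\<bar>))" if t: "t \<ge> 0" for t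
  proof -
    have "(g has_integral x t \<bullet> x t - x 0 \<bullet> x 0) {0..t}"
    proof (rule fundamental_theorem_of_calculus[OF t])
      fix u assume u: "u \<in> {0..t}"
      have "((\<lambda>s. x s \<bullet> x s) has_vector_derivative (x u \<bullet> (A *v x u) + (A *v x u) \<bullet> x u)) (at u within {0..})"
        using ode_has_vector_derivative[OF x, of u] u
        by (intro bounded_bilinear.has_vector_derivative[OF bounded_bilinear_inner]) auto
      then show "((\<lambda>s. x s \<bullet> x s) has_vector_derivative g u) (at u within {0..t})"
        unfolding g_def inner_commute[of "A *v x u"] mult_2
        by (rule has_vector_derivative_within_subset) auto
    qed
    then have gi: "integral {0..t} g = x t \<bullet> x t - x 0 \<bullet> x 0" by (rule integral_unique)
    have abs: "g absolutely_integrable_on {0..}"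
      using ig by (simp add: set_integrable_def integrable_restrict_space)
    then have abst: "g absolutely_integrable_on {0..t}"
      by (rule set_integrable_subset) auto
    have "\<bar>integral {0..t} g\<bar> \<le> integral {0..t} (\<lambda>s. \<bar>g s\<bar>)"
      using abst integral_norm_bound_integral[of g "{0..t}" "\<lambda>s. \<bar>g s\<bar>"]
      by (auto simp: absolutely_integrable_on_def)
    also have "\<dots> \<le> integral {0..} (\<lambda>s. \<bar>g s\<bar>)"
      using abst abs by (intro integral_subset_le) (auto simp: absolutely_integrable_on_def)
    also have "\<dots> = (LINT t|halfline. \<bar>g t\<bar>)"
      using ig by (subst lebesgue_integral_eq_integral) auto
    finally have "(norm (x t))\<^sup>2 \<le> x 0 \<bullet> x 0 + (LINT t|halfline. \<bar>g t\<bar>)"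
      unfolding gi power2_norm_eq_inner by linarith
    then show ?thesis by (simp add: real_le_rsqrt)
  qed
  then show ?thesis by (rule that)
qed

text \<open>Integration by parts against a difference of Laguerre functions, which vanishes at 0;
  therefore the initial state does not enter.\<close>

lemma free_lag_recurrence:
  fixes A :: "real^'n^'n"
  assumes x: "ode A (\<lambda>_. 0) \<xi> x" and s: "sqi x"
  shows "ip (\<lambda>t. (A *v x t) $ j) (lag k - lag (Suc k)) + ip (\<lambda>t. x t $ j) (lag k + lag (Suc k)) = 0"
proof -
  have sA: "sqi (\<lambda>t. A *v x t)" by (rule sqi_bounded_linear[OF matrix_vector_mul_bounded_linear s])
  have "ip (\<lambda>t. (A *v x t) $ j) (lag k - lag (Suc k)) + ip (\<lambda>t. x t $ j) (lag k + lag (Suc k))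
      = - (x 0 $ j) * (lag k - lag (Suc k)) 0"
  proof (rule ip_integration_by_parts)
    fix t :: real assume t: "t \<ge> 0"
    show "((\<lambda>t. x t $ j) has_real_derivative (A *v x t) $ j) (at t within {0..})"
      unfolding has_real_derivative_iff_has_vector_derivative
      by (rule bounded_linear.has_vector_derivative[OF bounded_linear_vec_nth ode_has_vector_derivative[OF x t]])
  next
    obtain K where K: "\<And>t. t \<ge> 0 \<Longrightarrow> norm (x t) \<le> K" using ode_free_bounded[OF x s] by blast
    have "((\<lambda>t. K * norm (lag k t - lag (Suc k) t)) \<longlongrightarrow> K * norm (0 - 0 :: real)) at_top"
      by (intro tendsto_intros lag_tendsto_0)
    then show "((\<lambda>t. x t $ j * (lag k - lag (Suc k)) t) \<longlongrightarrow> 0) at_top"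
    proof (rule Lim_null_comparison[rotated, OF tendsto_eq_rhs])
      show "\<forall>\<^sub>F t in at_top. norm (x t $ j * (lag k - lag (Suc k)) t) \<le> K * norm (lag k t - lag (Suc k) t)"
        using eventually_ge_at_top[of 0]
      proof eventually_elim
        case (elim t)
        have "\<bar>x t $ j\<bar> \<le> K" using component_le_norm_cart[of "x t" j] K[OF elim] by linarith
        then show ?case by (simp add: abs_mult mult_right_mono)
      qed
    qed simp
  qed (simp_all add: sqi_component[OF s] sqi_component[OF sA] sqi_add sqi_diff DERIV_lag_diff' del: plus_fun_apply)
  then show ?thesis by simp
qed

text \<open>A times a free response is again a free response, from the state A e_i, so uniqueness
  expands it in the \<open>X l\<close>. This makes the span of these responses invariant under
  A.\<close>

lemma free_responses:
  fixes A :: "real^'n^'n"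
  assumes A: "hurwitz A"
  obtains X :: "'n \<Rightarrow> real \<Rightarrow> real^'n" where "\<And>i. sqi (X i)" "\<And>i. ode A (\<lambda>_. 0) (axis i 1) (X i)"
    "\<And>i t. t \<ge> 0 \<Longrightarrow> A *v X i t = (\<Sum>l\<in>UNIV. A $ l $ i *\<^sub>R X l t)"
    "\<And>\<xi> x t. ode A (\<lambda>_. 0) \<xi> x \<Longrightarrow> t \<ge> 0 \<Longrightarrow> x t = (\<Sum>i\<in>UNIV. \<xi> $ i *\<^sub>R X i t)"
proof -
  have "\<forall>i. \<exists>x. sqi x \<and> ode A (\<lambda>_. 0) (axis i 1) x"
  proof
    fix i
    obtain x where "sqi x" "ode A 0 (axis i 1) x" using free_response[OF A] .
    then show "\<exists>x. sqi x \<and> ode A (\<lambda>_. 0) (axis i 1) x" by (intro exI[of _ x]) (simp add: zero_fun_def)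
  qed
  then obtain X where X: "\<And>i. sqi (X i)" "\<And>i. ode A (\<lambda>_. 0) (axis i 1) (X i)" by metis
  have sum: "ode A (\<lambda>_. 0) \<xi> (\<Sum>i\<in>UNIV. \<xi> $ i *\<^sub>R X i)" for \<xi>
  proof -
    have z: "(\<lambda>_. 0) = (0 :: real \<Rightarrow> real^'n)" by (simp add: zero_fun_def)
    have "ode A 0 (\<Sum>i\<in>I. \<xi> $ i *\<^sub>R axis i 1) (\<Sum>i\<in>I. \<xi> $ i *\<^sub>R X i)" for I
    proof (induction I rule: infinite_finite_induct)
      case (insert i I)
      then show ?case using ode_add[OF ode_scaleR[OF X(2)[of i, unfolded z], of "\<xi> $ i"] insert.IH]
        by (simp only: sum.insert[OF insert.hyps] scaleR_zero_right add_0)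
    qed (auto simp: ode_def)
    moreover have "(\<Sum>i\<in>UNIV. \<xi> $ i *\<^sub>R axis i 1) = \<xi>"
      by (simp add: vec_eq_iff axis_def if_distrib sum.delta' cong: if_cong)
    ultimately show ?thesis unfolding z by metis
  qed
  have uniq: "x t = (\<Sum>i\<in>UNIV. \<xi> $ i *\<^sub>R X i t)" if "ode A (\<lambda>_. 0) \<xi> x" "t \<ge> 0" for \<xi> x t
    using ode_unique[OF that(1) sum that(2)] by (simp add: sum_fun_apply)
  have AX: "A *v X i t = (\<Sum>l\<in>UNIV. A $ l $ i *\<^sub>R X l t)" if t: "t \<ge> 0" for i t
  proof -
    have "ode A (\<lambda>_. 0) (A *v axis i 1) (\<lambda>t. A *v X i t)"
      unfolding ode_def
    proof (intro allI impI)
      fix t :: real assume "t \<ge> 0"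
      then have "((\<lambda>s. A *v X i s + 0) has_integral (X i t - axis i 1)) {0..t}"
        using X(2)[of i] by (simp add: ode_def)
      from has_integral_linear[OF this matrix_vector_mul_bounded_linear[of A]]
      show "((\<lambda>s. A *v (A *v X i s) + 0) has_integral (A *v X i t - A *v axis i 1)) {0..t}"
        by (simp add: o_def matrix_vector_mult_diff_distrib)
    qed
    from uniq[OF this t] show ?thesis
      by (simp add: matrix_vector_mult_basis column_def)
  qed
  show ?thesis by (rule that[of X]) (fact X AX uniq)+
qed

lemma minus_matrix_vector: "(- M) *v x = - (M *v x)" for x :: "complex^'n"
  by (simp add: vec_eq_iff matrix_vector_mult_def sum_negf)

lemma matrix_vector_minus: "M *v (- x) = - (M *v x)" for x :: "complex^'n"
  by (simp add: vec_eq_iff matrix_vector_mult_def sum_negf)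

text \<open>By the recurrence the Laguerre coefficients of the free responses satisfy m(k+1) = M
  m(k), where M is a Cayley transform of \<open>At\<close> with spectrum in the open disc. For
  |\<zeta>| = 1, z - \<zeta> acts on these functionals as the invertible matrix M - \<zeta>, so
  dividing by it costs only a fixed matrix. Peeling off the roots of \<open>h\<close> gives
  \<open>H\<close>, independent of j and p.\<close>

lemma lagfun_circle_multiplier:
  fixes A :: "real^'n^'n" and X :: "'n \<Rightarrow> real \<Rightarrow> real^'n"
  assumes A: "hurwitz A" and X: "\<And>i. sqi (X i)" "\<And>i. ode A (\<lambda>_. 0) (axis i 1) (X i)"
    "\<And>i t. t \<ge> 0 \<Longrightarrow> A *v X i t = (\<Sum>l\<in>UNIV. A $ l $ i *\<^sub>R X l t)"
    and h: "h \<noteq> 0" "\<And>z. poly h z = 0 \<Longrightarrow> cmod z = 1"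
  shows "\<exists>H. \<forall>j p. (\<chi> i. lagfun (\<lambda>t. X i t $ j) p) = H *v (\<chi> i. lagfun (\<lambda>t. X i t $ j) (h * p))"
proof -
  define a where "a j p = (\<chi> i. lagfun (\<lambda>t. X i t $ j) p)" for j p
  have a_add: "a j (p + q) = a j p + a j q" and a_smult: "a j (smult c p) = c *s a j p" for j p q c
    by (simp_all add: a_def vec_eq_iff lagfun_add lagfun_smult)
  define At where "At = cmat (transpose A)"
  have rec: "a j p + a j (pCons 0 p) = - (At *v (a j p - a j (pCons 0 p)))" for j p
  proof -
    define m where "m i k = ip (\<lambda>t. X i t $ j) (lag k)" for i k
    have m: "m i k + m i (Suc k) = - (\<Sum>l\<in>UNIV. A $ l $ i * (m l k - m l (Suc k)))" for i k
    proof -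
      have "ip (\<lambda>t. (A *v X i t) $ j) (lag k - lag (Suc k))
          = ip (\<Sum>l\<in>UNIV. A $ l $ i *\<^sub>R (\<lambda>t. X l t $ j)) (lag k - lag (Suc k))"
        by (rule ip_cong) (simp_all add: X(3) sum_fun_apply)
      also have "\<dots> = (\<Sum>l\<in>UNIV. A $ l $ i * ip (\<lambda>t. X l t $ j) (lag k - lag (Suc k)))"
      proof -
        have "sqi (A $ l $ i *\<^sub>R (\<lambda>t. X l t $ j))" for l
          by (rule sqi_scaleR[OF sqi_component[OF X(1)]])
        then show ?thesis
          by (simp only: ip_sum_left sqi_diff sqi_lag ip_scaleR_left)
      qed
      also have "\<dots> = (\<Sum>l\<in>UNIV. A $ l $ i * (m l k - m l (Suc k)))"
        by (simp add: m_def ip_diff_right sqi_component[OF X(1)])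
      finally show ?thesis
        using free_lag_recurrence[OF X(2)[of i] X(1)[of i], of j k]
        by (simp add: m_def ip_add_right sqi_component[OF X(1)])
    qed
    have lf: "lagfun (\<lambda>t. X i t $ j) p = (\<Sum>k\<le>degree p. complex_of_real (m i k) * coeff p k)"
      "lagfun (\<lambda>t. X i t $ j) (pCons 0 p) = (\<Sum>k\<le>degree p. complex_of_real (m i (Suc k)) * coeff p k)" for i
      unfolding m_def lagfun_shift by (simp_all only: lagfun_def)
    have "lagfun (\<lambda>t. X i t $ j) p + lagfun (\<lambda>t. X i t $ j) (pCons 0 p)
        = - (\<Sum>l\<in>UNIV. complex_of_real (A $ l $ i) * (lagfun (\<lambda>t. X l t $ j) p - lagfun (\<lambda>t. X l t $ j) (pCons 0 p)))" for i
    proof -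
      have "lagfun (\<lambda>t. X i t $ j) p + lagfun (\<lambda>t. X i t $ j) (pCons 0 p)
          = (\<Sum>k\<le>degree p. complex_of_real (m i k + m i (Suc k)) * coeff p k)"
        unfolding lf by (simp add: sum.distrib[symmetric] algebra_simps)
      also have "\<dots> = (\<Sum>k\<le>degree p. - (\<Sum>l\<in>UNIV. complex_of_real (A $ l $ i * (m l k - m l (Suc k))) * coeff p k))"
        unfolding m by (simp add: sum_distrib_right)
      also have "\<dots> = - (\<Sum>l\<in>UNIV. \<Sum>k\<le>degree p. complex_of_real (A $ l $ i * (m l k - m l (Suc k))) * coeff p k)"
        unfolding sum_negf by (subst sum.swap) (rule refl)
      also have "\<dots> = - (\<Sum>l\<in>UNIV. complex_of_real (A $ l $ i) * (lagfun (\<lambda>t. X l t $ j) p - lagfun (\<lambda>t. X l t $ j) (pCons 0 p)))"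
        unfolding lf by (simp add: sum_distrib_left sum_subtractf[symmetric] algebra_simps)
      finally show ?thesis .
    qed
    then show ?thesis
      by (simp add: vec_eq_iff a_def At_def cmat_def transpose_def matrix_vector_mult_def)
  qed
  have At: "invertible (mat s - At)" if "Re s \<ge> 0" for s
  proof -
    have "mat s - At = transpose (mat s - cmat A)"
      by (simp add: At_def cmat_def transpose_def mat_def vec_eq_iff)
    then show ?thesis using A that unfolding hurwitz_def by (simp add: invertible_det_nz det_transpose)
  qed
  have factor: "\<exists>H. \<forall>j p. a j p = H *v a j ([:- \<zeta>, 1:] * p)" if zeta: "cmod \<zeta> = 1" for \<zeta>
  proof -
    \<comment> \<open>For \<zeta> other than 1 this is -(1 - \<zeta>) (s - At) with s = -(1 +
      \<zeta>) / (1 - \<zeta>) on the imaginary axis, invertible as A is Hurwitz; at \<zeta> = 1 it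
      is twice the identity.\<close>
    define N where "N = mat (1 + \<zeta>) + mat (1 - \<zeta>) ** At"
    have invN: "invertible N"
    proof (cases "\<zeta> = 1")
      case True
      then have "N = mat 2" by (simp add: N_def vec_eq_iff mat_mult_nth)
      then show ?thesis using invertible_mat[of "2::complex"] by simp
    next
      case False
      define s where "s = - ((1 + \<zeta>) / (1 - \<zeta>))"
      have "1 - \<zeta> \<noteq> 0" using False by simp
      then have ss: "(1 - \<zeta>) * s = - (1 + \<zeta>)" by (simp add: s_def)
      have "N = mat (- (1 - \<zeta>)) ** (mat s - At)"
        unfolding N_def vec_eq_iff mat_mult_nth vector_add_component vector_minus_component
        using ss by (auto simp: mat_def algebra_simps)
      moreover have "Re s \<ge> 0" unfolding s_def using Re_Cayley[of \<zeta>] zeta by simp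
      ultimately show ?thesis using False by (simp add: invertible_mult invertible_mat At)
    qed
    \<comment> \<open>Solves the recurrence for \<open>u\<close> with only the combination
      \<open>b - \<zeta> *s u\<close>, the value at (z - \<zeta>) p, on the right.\<close>
    define H where "H = - (matrix_inv N ** (mat 1 - At))"
    have "a j p = H *v a j ([:- \<zeta>, 1:] * p)" for j p
    proof -
      define u where "u = a j p"
      define b where "b = a j (pCons 0 p)"
      have c: "a j ([:- \<zeta>, 1:] * p) = b - \<zeta> *s u"
      proof -
        have "[:- \<zeta>, 1:] * p = smult (- \<zeta>) p + pCons 0 p" by simp
        then show ?thesis by (simp only: a_add a_smult b_def u_def) (simp add: vec_eq_iff)
      qed
      have ub: "u + b = - (At *v (u - b))" unfolding u_def b_def by (rule rec)
      have "N *v u = (1 + \<zeta>) *s u + (1 - \<zeta>) *s (At *v u)"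
        by (simp add: N_def matrix_vector_mult_add_rdistrib mat_mult_vector matrix_vector_mul_assoc[symmetric]
            del: vector_sadd_rdistrib)
      also have "\<dots> = - ((mat 1 - At) *v (b - \<zeta> *s u))"
      proof -
        have "((1 + \<zeta>) *s u + (1 - \<zeta>) *s (At *v u)) $ i = (- ((mat 1 - At) *v (b - \<zeta> *s u))) $ i" for i
        proof -
          have "(u + b) $ i = (- (At *v (u - b))) $ i" using ub by simp
          then have "u $ i + b $ i + (At *v u) $ i - (At *v b) $ i = 0"
            by (simp add: matrix_vector_mult_diff_distrib algebra_simps)
          then show ?thesis
            by (simp add: matrix_vector_mult_diff_distrib matrix_vector_mult_diff_rdistrib
                matrix_vector_mult_scale mat_mult_vector algebra_simps)
        qed
        then show ?thesis by (simp add: vec_eq_iff)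
      qed
      finally have Nu: "N *v u = - ((mat 1 - At) *v (b - \<zeta> *s u))" .
      have "u = matrix_inv N *v (N *v u)"
        using invN by (simp add: matrix_vector_mul_assoc matrix_inv_left)
      also have "\<dots> = H *v (b - \<zeta> *s u)"
        unfolding Nu H_def minus_matrix_vector matrix_vector_minus matrix_vector_mul_assoc ..
      finally show ?thesis unfolding c u_def .
    qed
    then show ?thesis by blast
  qed
  have "(\<forall>z. poly h z = 0 \<longrightarrow> cmod z = 1) \<longrightarrow> (\<exists>H. \<forall>j p. a j p = H *v a j (h * p))"
    using h(1)
  proof (induction h rule: complex_poly_root_induct)
    case (const c)
    then have "a j p = mat (1 / c) *v a j ([:c:] * p)" for j p
      by (simp add: a_smult mat_mult_vector)
    then show ?case by blast
  next
    case (root \<zeta> q)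
    show ?case
    proof
      assume r: "\<forall>z. poly ([:- \<zeta>, 1:] * q) z = 0 \<longrightarrow> cmod z = 1"
      have "cmod \<zeta> = 1" using r[rule_format, of \<zeta>] by simp
      then obtain H1 where H1: "\<And>j p. a j p = H1 *v a j ([:- \<zeta>, 1:] * p)" using factor by blast
      have "\<forall>z. poly q z = 0 \<longrightarrow> cmod z = 1" using r by (simp del: mult_pCons_left)
      then obtain H2 where H2: "\<And>j p. a j p = H2 *v a j (q * p)" using root.IH by blast
      have "a j p = (H2 ** H1) *v a j ([:- \<zeta>, 1:] * q * p)" for j p
        by (subst H2, subst H1) (simp add: matrix_vector_mul_assoc mult.assoc del: mult_pCons_left)
      then show "\<exists>H. \<forall>j p. a j p = H *v a j ([:- \<zeta>, 1:] * q * p)" by blast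
    qed
  qed
  with h(2) show ?thesis by (simp add: a_def)
qed

section \<open>A lower bound for the form in w\<close>

lemma cem_mult: "cem (M ** N) z = cem M z ** cem N z"
  by (simp add: vec_eq_iff cem_def matrix_matrix_mult_def)

text \<open>The map from W to the stacked signal with V = 0, as a polynomial matrix: the entries of
  the resulting Hermitian form are then trigonometric polynomials.\<close>

definition Gpoly :: "real^'n^'n \<Rightarrow> real^'q^'n \<Rightarrow> real poly^'q^('n + ('k::finite + 'q))" where
  "Gpoly A B2 = (\<chi> i b. case i of
       Inl a \<Rightarrow> [:1, -1:] * (adjp (Epoly A) ** constp B2) $ a $ b
     | Inr j \<Rightarrow> (case j of Inl _ \<Rightarrow> 0 | Inr c \<Rightarrow> if c = b then det (Epoly A) else 0))"

lemma Gpoly_mult: "Gpoly A B2 *v W = Spoly A B1 B2 0 W"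
proof -
  have "(Gpoly A B2 *v W) $ i = Spoly A B1 B2 0 W $ i" for i
  proof (cases i)
    case (Inl a)
    have "(Gpoly A B2 *v W) $ Inl a = [:1, -1:] * ((adjp (Epoly A) ** constp B2) *v W) $ a"
      by (simp add: Gpoly_def matrix_vector_mult_def sum_distrib_left mult.assoc del: mult_pCons_left)
    then show ?thesis
      using Inl by (simp add: Spoly_def Xpoly_def matrix_vector_mul_assoc del: mult_pCons_left)
  next
    case (Inr j)
    then show ?thesis
      by (cases j) (simp_all add: Gpoly_def matrix_vector_mult_def Spoly_def if_distrib if_distribR sum.delta cong: if_cong)
  qed
  then show ?thesis by (simp add: vec_eq_iff)
qed

lemma cem_Gpoly_mult:
  fixes A :: "real^'n^'n" and B1 :: "real^'k^'n" and B2 :: "real^'q^'n"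
  assumes A: "hurwitz A" and z: "cmod z = 1" "z \<noteq> 1"
  shows "cem (Gpoly A B2) z *v w
    = Mfreq A B1 B2 ((1 + z) / (1 - z)) *v (cp (det (Epoly A)) z *s join 0 w)"
proof -
  let ?d = "cp (det (Epoly A)) z"
  have "cem (Gpoly A B2) z *v w = join ((1 - z) *s (cem (adjp (Epoly A)) z *v (cmat B2 *v w))) (?d *s join (0 :: complex^'k) w)"
  proof -
    have "(cem (Gpoly A B2) z *v w) $ i
        = join ((1 - z) *s (cem (adjp (Epoly A)) z *v (cmat B2 *v w))) (?d *s join (0 :: complex^'k) w) $ i" for i
    proof (cases i)
      case (Inl a)
      have "(cem (Gpoly A B2) z *v w) $ Inl a = (1 - z) * (cem (adjp (Epoly A) ** constp B2) z *v w) $ a"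
        by (simp add: cem_def Gpoly_def matrix_vector_mult_def sum_distrib_left mult.assoc
            del: mult_pCons_left)
      then show ?thesis
        using Inl by (simp only: cem_mult cem_constp matrix_vector_mul_assoc[symmetric] join_nth
            vector_smult_component)
    next
      case (Inr j)
      then show ?thesis
        by (cases j) (simp_all add: cem_def Gpoly_def matrix_vector_mult_def if_distrib if_distribR sum.delta cong: if_cong)
    qed
    then show ?thesis unfolding vec_eq_iff by blast
  qed
  also have "\<dots> = Mfreq A B1 B2 ((1 + z) / (1 - z)) *v (?d *s join 0 w)"
    unfolding Mfreq_mult matrix_vector_mult_scale[of "cmat (Bcat B1 B2)"] cmat_Bcat_join
      Cayley_resolvent[OF assms, symmetric] by simp
  finally show ?thesis .
qed

lemma cadj_mult: "cadj (M ** N) = cadj N ** cadj M"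
  by (simp add: vec_eq_iff cadj_def matrix_matrix_mult_def mult.commute)

lemma cadj_cadj [simp]: "cadj (cadj M) = M"
  by (simp add: vec_eq_iff cadj_def)

lemma cadj_minus: "cadj (- M) = - cadj M"
  by (simp add: vec_eq_iff cadj_def)

lemma cadj_cmat: "cadj (cmat M) = cmat (transpose M)"
  by (simp add: vec_eq_iff cadj_def cmat_def transpose_def)

lemma ses_minus: "ses (- M) x y = - ses M x y"
  by (simp add: ses_def matrix_vector_mult_def sum_negf)

lemma Cayley_inverse:
  assumes "Re s = 0"
  shows "cmod ((s - 1) / (s + 1)) = 1" "(s - 1) / (s + 1) \<noteq> 1"
    "(1 + (s - 1) / (s + 1)) / (1 - (s - 1) / (s + 1)) = s"
proof -
  have nz: "s + 1 \<noteq> 0" using assms by (auto simp: complex_eq_iff)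
  have "cmod (s - 1) = cmod (s + 1)" using assms by (simp add: cmod_def power2_eq_square)
  then show "cmod ((s - 1) / (s + 1)) = 1" using nz by (simp add: norm_divide)
  show "(s - 1) / (s + 1) \<noteq> 1" using nz by (simp add: divide_eq_1_iff)
  have "1 + (s - 1) / (s + 1) = 2 * s / (s + 1)" "1 - (s - 1) / (s + 1) = 2 / (s + 1)"
    using nz by (simp_all add: field_simps)
  then show "(1 + (s - 1) / (s + 1)) / (1 - (s - 1) / (s + 1)) = s" using nz by simp
qed

lemma cpsd_blk22:
  assumes "cpsd (blk_eps \<epsilon> P)"
  shows "0 \<le> Re (cquad (- blk22 P) w)"
proof -
  have "join 0 0 = (0 :: complex^('a + 'b))" by (auto simp: vec_eq_iff join_def split: sum.splits)
  moreover have "ses P 0 x = 0" "ses P x 0 = 0" for x by (simp_all add: ses_def)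
  ultimately have "cquad (blk_eps \<epsilon> P) (join 0 w) = cquad (- blk22 P) w"
    by (simp add: cquad_blk_eps ses_blk22)
  then show ?thesis using assms unfolding cpsd_def by metis
qed

text \<open>\<open>T\<close> is the form of -Pi22 with the denominator cleared, semidefinite on the
  circle away from 1. The determinant bound applies with constants uniform on the circle, and
  \<open>h\<close> collects the zeros of the determinant of \<open>T\<close> there.\<close>

lemma w_form_lower_bound:
  fixes A :: "real^'n^'n" and B1 :: "real^'k^'n" and B2 :: "real^'q^'n"
  assumes A: "hurwitz A" and Q: "transpose Q = Q"
    and fdi: "\<And>s. Re s = 0 \<Longrightarrow> cpsd (blk_eps \<epsilon> (PiQ A B1 B2 Q s))"
    and s0: "Re s0 = 0" "cpd (- blk22 (PiQ A B1 B2 Q s0))"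
  obtains h c where "c > 0" "h \<noteq> 0" "\<And>z. poly h z = 0 \<Longrightarrow> cmod z = 1"
    "\<And>z w. cmod z = 1 \<Longrightarrow> z \<noteq> 1 \<Longrightarrow> c * ((cmod (poly h z))\<^sup>2 * (norm w)\<^sup>2)
      \<le> - Re (ses (cmat Q) (cem (Gpoly A B2) z *v w) (cem (Gpoly A B2) z *v w))"
proof -
  define G where "G = (Gpoly A B2 :: real poly^'q^('n + ('k + 'q)))"
  define T where "T z = - (cadj (cem G z) ** cmat Q ** cem G z)" for z
  have T_eq: "cquad (T z) w = - ses (cmat Q) (cem G z *v w) (cem G z *v w)" for z w
    by (simp add: T_def cquad_eq_ses ses_minus ses_congruence)
  have T22: "cquad (T z) w = cquad (- blk22 (PiQ A B1 B2 Q ((1 + z) / (1 - z)))) (cp (det (Epoly A)) z *s w)"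
    if "cmod z = 1" "z \<noteq> 1" for z w
    unfolding T_eq G_def cem_Gpoly_mult[OF A that, of B2 w B1] ses_congruence[symmetric] PiQ_eq[symmetric]
    by (simp add: scale_join ses_blk22)
  have herm: "cadj (T z) = T z" for z
    by (simp add: T_def cadj_minus cadj_mult cadj_cmat Q matrix_mul_assoc)
  have psd: "cpsd (T z)" if "cmod z = 1" "z \<noteq> 1" for z
  proof -
    have "Re ((1 + z) / (1 - z)) = 0" unfolding Re_Cayley using that by simp
    then show ?thesis
      unfolding cpsd_def using herm T22[OF that] cpsd_blk22[OF fdi] by simp
  qed
  have trigT: "trigfun (\<lambda>z. T z $ i $ j)" for i j
  proof -
    have "trigfun (\<lambda>z. \<Sum>r\<in>UNIV. (\<Sum>l\<in>UNIV. cnj (cp (G $ l $ i) z) * cmat Q $ l $ r) * cp (G $ r $ j) z)"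
      by (intro trigfun_sum trigfun_mult trigfun_cnj trigfun_cp trigfun_const)
    from trigfun_mult[OF trigfun_const[of "- 1"] this] show ?thesis
      by (simp add: T_def matrix_matrix_mult_def cadj_def cem_def)
  qed
  have trigdet: "trigfun (\<lambda>z. det (T z))" by (intro trigfun_det trigT)
  have trigadj: "trigfun (\<lambda>z. adjp (T z) $ i $ j)" for i j
    unfolding adjp_def vec_lambda_beta
  proof (rule trigfun_det)
    fix a b
    show "trigfun (\<lambda>z. (\<chi> r. if r = j then axis i 1 else T z $ r) $ a $ b)"
      by (cases "a = j") (simp_all add: trigT trigfun_const)
  qed
  obtain d where d: "d > 0" "\<And>z. cmod z = 1 \<Longrightarrow> cmod (det (T z)) \<le> d"
    using trigfun_bounded[OF trigdet] by blast
  obtain a where a: "a > 0" "\<And>i z. cmod z = 1 \<Longrightarrow> cmod (adjp (T z) $ fst i $ snd i) \<le> a"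
    using trigfun_bounded_finite[of "\<lambda>i z. adjp (T z) $ fst i $ snd i"] trigadj by blast
  define z0 where "z0 = (s0 - 1) / (s0 + 1)"
  have z0: "cmod z0 = 1" "z0 \<noteq> 1" "(1 + z0) / (1 - z0) = s0"
    unfolding z0_def by (rule Cayley_inverse[OF s0(1)])+
  \<comment> \<open>Strict definiteness at the single frequency \<open>s0\<close> has only to
    exclude that the determinant vanishes identically on the circle.\<close>
  have detT: "det (T z0) \<noteq> 0"
  proof -
    have dE: "cp (det (Epoly A)) z0 \<noteq> 0" using cp_det_Epoly_neq_0[OF A, of z0] z0 by simp
    have "w = 0" if "T z0 *v w = 0" for w
    proof (rule ccontr)
      assume "w \<noteq> 0"
      then have "cp (det (Epoly A)) z0 *s w \<noteq> 0" using dE by (simp add: vector_mul_eq_0)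
      then have "0 < Re (cquad (T z0) w)"
        using s0(2) unfolding T22[OF z0(1,2)] z0(3) cpd_def by blast
      moreover have "cquad (T z0) w = 0" using that by (simp add: cquad_eq_ses ses_def)
      ultimately show False by simp
    qed
    then have "inj ((*v) (T z0))"
      by (auto simp: inj_on_def) (metis eq_iff_diff_eq_0 matrix_vector_mult_diff_distrib)
    then show ?thesis 
      using det_nz_iff_inj_gen[OF matrix_vector_mul_linear_gen, of "T z0"]
      by (simp only: matrix_of_matrix_vector_mul)
  qed
  obtain h c where h: "c > 0" "\<And>z. poly h z = 0 \<Longrightarrow> cmod z = 1"
    "\<And>z. cmod z = 1 \<Longrightarrow> c * cmod (poly h z) \<le> cmod (det (T z))" "h \<noteq> 0"
    by (rule trigfun_lower_bound[OF trigdet z0(1) detT]) (rule that)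
  define M where "M = d * (real CARD('q) * (real CARD('q) * a))"
  have M: "M > 0" using d a by (simp add: M_def)
  show ?thesis
  proof (rule that[of "c\<^sup>2 / M" h])
    show "c\<^sup>2 / M > 0" using h M by simp
    fix z :: complex and w :: "complex^'q"
    assume z: "cmod z = 1" "z \<noteq> 1"
    have "c\<^sup>2 * (cmod (poly h z))\<^sup>2 * (norm w)\<^sup>2 \<le> (cmod (det (T z)))\<^sup>2 * (norm w)\<^sup>2"
      using h(1) h(3)[OF z(1)] unfolding power_mult_distrib[symmetric]
      by (intro power_mono mult_right_mono) auto
    also have "\<dots> \<le> M * Re (cquad (T z) w)"
      unfolding M_def using a(2)[OF z(1), of "(_, _)"] d z
      by (intro psd_det_lower_bound psd) (auto simp: a(1))
    finally have "c\<^sup>2 / M * ((cmod (poly h z))\<^sup>2 * (norm w)\<^sup>2) \<le> Re (cquad (T z) w)"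
      using M by (simp add: field_simps)
    then show "c\<^sup>2 / M * ((cmod (poly h z))\<^sup>2 * (norm w)\<^sup>2)
      \<le> - Re (ses (cmat Q) (cem (Gpoly A B2) z *v w) (cem (Gpoly A B2) z *v w))"
      by (simp add: T_eq G_def)
  qed (use h in auto)
qed

lemma Bq_tendsto:
  fixes Q :: "real^('n::finite + ('k::finite + 'q::finite))^('n + ('k + 'q))"
  assumes "sqi y" "sqi u" "\<And>i. sqi (y' i)" "\<And>i. sqi (u' i)"
    and "(\<lambda>i. nsq (y - y' i)) \<longlonglongrightarrow> 0" "(\<lambda>i. nsq (u - u' i)) \<longlonglongrightarrow> 0"
  shows "(\<lambda>i. Bq Q (y' i) (u' i)) \<longlonglongrightarrow> Bq Q y u"
proof (rule tendstoI)
  fix e :: real assume "e > 0"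
  then obtain \<delta> where d: "\<delta> > 0" "\<And>y' u'. sqi y' \<Longrightarrow> sqi u' \<Longrightarrow> nsq (y - y') < \<delta> \<Longrightarrow> nsq (u - u') < \<delta>
    \<Longrightarrow> \<bar>Bq Q y' u' - Bq Q y u\<bar> < e"
    using Bq_approx[OF assms(1,2)] by blast
  have "eventually (\<lambda>i. nsq (y - y' i) < \<delta>) sequentially"
    "eventually (\<lambda>i. nsq (u - u' i) < \<delta>) sequentially"
    using assms(5,6) d(1) by (auto intro: order_tendstoD(2))
  then show "\<forall>\<^sub>F i in sequentially. dist (Bq Q (y' i) (u' i)) (Bq Q y u) < e"
  proof eventually_elim
    case (elim i)
    then show ?case unfolding dist_real_def by (intro d(2) assms)
  qed
qed

text \<open>The form in w is bounded below only with the weight |h|^2, which may vanish. The pairing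
  with a free response can be written in terms of \<open>h * p\<close> instead of \<open>p\<close>,
  and then carries the same weight, so the two sides match.\<close>

lemma free_cross_bound_poly:
  fixes A :: "real^'n^'n" and B1 :: "real^'k^'n" and B2 :: "real^'q^'n"
  assumes A: "hurwitz A" and Q: "transpose Q = Q"
    and fdi: "\<And>s. Re s = 0 \<Longrightarrow> cpsd (blk_eps \<epsilon> (PiQ A B1 B2 Q s))"
    and s0: "Re s0 = 0" "cpd (- blk22 (PiQ A B1 B2 Q s0))"
    and y: "traj A B1 B2 \<xi> y" "vp y = 0" "wp y = 0"
  obtains C where "C \<ge> 0" "\<And>W. (Bq Q y (ptraj A B1 B2 0 W))\<^sup>2
    \<le> C * (- Bq Q (ptraj A B1 B2 0 W) (ptraj A B1 B2 0 W))"
proof -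
  obtain h c where h: "c > 0" "h \<noteq> 0" "\<And>z. poly h z = 0 \<Longrightarrow> cmod z = 1"
    "\<And>z w. cmod z = 1 \<Longrightarrow> z \<noteq> 1 \<Longrightarrow> c * ((cmod (poly h z))\<^sup>2 * (norm w)\<^sup>2)
      \<le> - Re (ses (cmat Q) (cem (Gpoly A B2) z *v w) (cem (Gpoly A B2) z *v w))"
    using w_form_lower_bound[OF A Q fdi s0] by metis
  obtain X :: "'n \<Rightarrow> real \<Rightarrow> real^'n" where X: "\<And>i. sqi (X i)" "\<And>i. ode A (\<lambda>_. 0) (axis i 1) (X i)"
    "\<And>i t. t \<ge> 0 \<Longrightarrow> A *v X i t = (\<Sum>l\<in>UNIV. A $ l $ i *\<^sub>R X l t)"
    "\<And>\<xi> x t. ode A (\<lambda>_. 0) \<xi> x \<Longrightarrow> t \<ge> 0 \<Longrightarrow> x t = (\<Sum>i\<in>UNIV. \<xi> $ i *\<^sub>R X i t)"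
    by (rule free_responses[OF A]) blast
  obtain H where H: "\<And>j p. (\<chi> i. lagfun (\<lambda>t. X i t $ j) p) = H *v (\<chi> i. lagfun (\<lambda>t. X i t $ j) (h * p))"
    using lagfun_circle_multiplier[OF A X(1-3) h(2,3)] by blast
  obtain K where K: "K > 0" "\<And>z u. cmod z = 1 \<Longrightarrow> norm (cem (constp Q ** Gpoly A B2) z *v u) \<le> K * norm u"
    using cem_bounded_circ by blast
  \<comment> \<open>Collects the constants of the triangle inequality; it involves \<xi>,
    \<open>H\<close> and the free responses, but not \<open>W\<close>.\<close>
  define M where "M = (\<Sum>i\<in>UNIV. \<Sum>j\<in>UNIV. \<Sum>l\<in>UNIV. \<bar>\<xi> $ i\<bar> * (cmod (H $ i $ l) * sqrt (nsq (\<lambda>t. X l t $ j))))"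
  show ?thesis
  proof (rule that[of "M\<^sup>2 * (K\<^sup>2 / c)"])
    show "0 \<le> M\<^sup>2 * (K\<^sup>2 / c)" using h(1) by simp
  next
    fix W
    define k where "k = ptraj A B1 B2 0 W"
    define S where "S = Spoly A B1 B2 0 W"
    \<comment> \<open>Only the state block of Q S is paired, since both inputs of \<open>y\<close>
      are zero.\<close>
    define F where "F = (\<chi> a. (constp Q *v S) $ Inl a)"
    define p where "p j = map_poly complex_of_real (F $ j)" for j
    define R where "R = (\<Sum>j\<in>UNIV. n2 (h * p j))"
    have S: "S = Gpoly A B2 *v W" unfolding S_def by (rule Gpoly_mult[symmetric])
    have R0: "R \<ge> 0" by (simp add: R_def sum_nonneg)
    have "Bq Q y k = ip (xp y) (sig F)"
    proof -
      have "stk (y t) \<bullet> (Q *v stk (k t)) = xp y t \<bullet> sig F t" for t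
      proof -
        have y0: "fst (snd (y t)) = 0" "snd (snd (y t)) = 0"
          using fun_cong[OF y(2), of t] fun_cong[OF y(3), of t] by (simp_all add: vp_def wp_def)
        have "Q *v stk (k t) = sig (constp Q *v S) t" unfolding k_def S_def stk_ptraj sig_constp ..
        then show ?thesis
          by (simp add: inner_vec_def sum_UNIV_sum_type stk_def stack3_def y0 xp_def F_def)
      qed
      then show ?thesis by (simp add: Bq_def ip_def)
    qed
    also have "\<dots> = ip (\<Sum>i\<in>UNIV. \<xi> $ i *\<^sub>R X i) (sig F)"
    proof (rule ip_cong)
      fix t :: real assume t: "t \<ge> 0"
      have "ode A (\<lambda>_. 0) \<xi> (xp y)" using y by (simp add: traj_def solves_state_iff_ode)
      from X(4)[OF this t] show "xp y t = (\<Sum>i\<in>UNIV. \<xi> $ i *\<^sub>R X i) t" by (simp add: sum_fun_apply)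
    qed simp
    also have "\<dots> = (\<Sum>i\<in>UNIV. \<xi> $ i * ip (X i) (sig F))"
      by (simp only: ip_sum_left sqi_scaleR X(1) sqi_sig ip_scaleR_left)
    also have "\<dots> = (\<Sum>i\<in>UNIV. \<Sum>j\<in>UNIV. \<xi> $ i * ip (\<lambda>t. X i t $ j) (sigs (F $ j)))"
      by (simp add: ip_vec X(1) sum_distrib_left)
    finally have B: "complex_of_real (Bq Q y k) = (\<Sum>i\<in>UNIV. \<Sum>j\<in>UNIV. complex_of_real (\<xi> $ i) * lagfun (\<lambda>t. X i t $ j) (p j))"
      by (simp add: ip_sigs_lagfun[OF sqi_component[OF X(1)], symmetric] p_def)
    have lf: "lagfun (\<lambda>t. X i t $ j) (p j) = (\<Sum>l\<in>UNIV. H $ i $ l * lagfun (\<lambda>t. X l t $ j) (h * p j))" for i j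
      using arg_cong[OF H[of j "p j"], of "\<lambda>v. v $ i"] by (simp add: matrix_vector_mult_def)
    have lb: "cmod (lagfun (\<lambda>t. X l t $ j) (h * p j)) \<le> sqrt (nsq (\<lambda>t. X l t $ j)) * sqrt R" for l j
    proof -
      have "n2 (h * p j) \<le> R" unfolding R_def by (rule member_le_sum) auto
      then have "(cmod (lagfun (\<lambda>t. X l t $ j) (h * p j)))\<^sup>2 \<le> nsq (\<lambda>t. X l t $ j) * R"
        using lagfun_bound[OF sqi_component[OF X(1)[of l]], of j "h * p j"]
        by (meson ip_nonneg mult_left_mono order_trans)
      then show ?thesis by (simp add: real_le_rsqrt real_sqrt_mult[symmetric])
    qed
    have "\<bar>Bq Q y k\<bar> = cmod (complex_of_real (Bq Q y k))" by simp
    also have "\<dots> \<le> (\<Sum>i\<in>UNIV. \<Sum>j\<in>UNIV. \<Sum>l\<in>UNIV. \<bar>\<xi> $ i\<bar> * (cmod (H $ i $ l) * cmod (lagfun (\<lambda>t. X l t $ j) (h * p j))))"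
      unfolding B lf
      by (intro sum_norm_le) (simp add: norm_mult sum_distrib_left[symmetric] mult_left_mono sum_norm_le)
    also have "\<dots> \<le> (\<Sum>i\<in>UNIV. \<Sum>j\<in>UNIV. \<Sum>l\<in>UNIV. \<bar>\<xi> $ i\<bar> * (cmod (H $ i $ l) * (sqrt (nsq (\<lambda>t. X l t $ j)) * sqrt R)))"
      by (intro sum_mono mult_left_mono lb) auto
    also have "\<dots> = M * sqrt R" by (simp add: M_def sum_distrib_right mult.assoc)
    finally have "\<bar>Bq Q y k\<bar>\<^sup>2 \<le> (M * sqrt R)\<^sup>2" by (intro power_mono) auto
    then have 1: "(Bq Q y k)\<^sup>2 \<le> M\<^sup>2 * R" using R0 by (simp add: power_mult_distrib)
    \<comment> \<open>Both sides are averages over the same nodes, where |h|^2 |F|^2 is at most K^2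
      |h|^2 |W|^2, and \<open>h(4)\<close> bounds c |h|^2 |W|^2 by the form.\<close>
    have 2: "R \<le> K\<^sup>2 / c * (- Bq Q k k)"
    proof -
      define N where "N = Suc (degb S + degb (constp Q *v S) + (\<Sum>j\<in>UNIV. degree (h * p j)))"
      have N: "degb S < N" "degb (constp Q *v S) < N" "degree (h * p j) < N" "N > 0" for j
        using member_le_sum[of j UNIV "\<lambda>j. degree (h * p j)"] by (auto simp: N_def)
      have "real N * R = (\<Sum>m<N. (cmod (poly h (circ N m)))\<^sup>2 * (norm (cev F (circ N m)))\<^sup>2)"
      proof -
        have "real N * R = (\<Sum>j\<in>UNIV. \<Sum>m<N. (cmod (poly (h * p j) (circ N m)))\<^sup>2)"
          by (simp only: R_def sum_distrib_left n2_circ[OF N(3)])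
        also have "\<dots> = (\<Sum>m<N. \<Sum>j\<in>UNIV. (cmod (poly (h * p j) (circ N m)))\<^sup>2)" by (rule sum.swap)
        also have "\<dots> = (\<Sum>m<N. (cmod (poly h (circ N m)))\<^sup>2 * (norm (cev F (circ N m)))\<^sup>2)"
          by (simp add: power2_norm_complex_vec cev_def cp_def p_def norm_mult power_mult_distrib sum_distrib_left)
        finally show ?thesis .
      qed
      also have "\<dots> \<le> (\<Sum>m<N. K\<^sup>2 / c * - Re (ses (cmat Q) (cev S (circ N m)) (cev S (circ N m))))"
      proof (rule sum_mono)
        fix m
        define z where "z = circ N m"
        have z: "cmod z = 1" "z \<noteq> 1" using N(4) by (simp_all add: z_def)
        have "norm (cev F z) \<le> norm (cev (constp Q *v S) z)"
        proof -
          have "(norm (cev F z))\<^sup>2 \<le> (norm (cev (constp Q *v S) z))\<^sup>2"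
            by (simp add: power2_norm_complex_vec sum_UNIV_sum_type F_def cev_def sum_nonneg)
          then show ?thesis by (rule power2_le_imp_le) simp
        qed
        also have "cev (constp Q *v S) z = cem (constp Q ** Gpoly A B2) z *v cev W z"
          unfolding S matrix_vector_mul_assoc cev_mult ..
        also have "norm \<dots> \<le> K * norm (cev W z)" by (rule K(2)[OF z(1)])
        finally have "(norm (cev F z))\<^sup>2 \<le> (K * norm (cev W z))\<^sup>2" by (intro power_mono) auto
        then have "(cmod (poly h z))\<^sup>2 * (norm (cev F z))\<^sup>2 \<le> (cmod (poly h z))\<^sup>2 * (K * norm (cev W z))\<^sup>2"
          by (intro mult_left_mono) auto
        also have "\<dots> = K\<^sup>2 / c * (c * ((cmod (poly h z))\<^sup>2 * (norm (cev W z))\<^sup>2))"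
          using h(1) by (simp add: power_mult_distrib)
        also have "\<dots> \<le> K\<^sup>2 / c * - Re (ses (cmat Q) (cev S z) (cev S z))"
          unfolding S cev_mult using h(1) h(4)[OF z] by (intro mult_left_mono) auto
        finally show "(cmod (poly h (circ N m)))\<^sup>2 * (norm (cev F (circ N m)))\<^sup>2
          \<le> K\<^sup>2 / c * - Re (ses (cmat Q) (cev S (circ N m)) (cev S (circ N m)))" by (simp add: z_def)
      qed
      also have "\<dots> = real N * (K\<^sup>2 / c * (- Bq Q k k))"
      proof -
        have "real N * Bq Q k k = (\<Sum>m<N. Re (ses (cmat Q) (cev S (circ N m)) (cev S (circ N m))))"
          unfolding Bq_def k_def stk_ptraj S_def[symmetric] using N by (intro ip_sig_quad_circ)
        then show ?thesis
          by (simp only: sum_distrib_left[symmetric] sum_negf mult.left_commute[of "real N"] mult_minus_right)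
      qed
      finally show ?thesis by (rule mult_left_le_imp_le) (use N(4) in simp)
    qed
    have "(Bq Q y k)\<^sup>2 \<le> M\<^sup>2 * (K\<^sup>2 / c * (- Bq Q k k))"
      using 1 mult_left_mono[OF 2, of "M\<^sup>2"] by simp
    then show "(Bq Q y (ptraj A B1 B2 0 W))\<^sup>2 \<le> M\<^sup>2 * (K\<^sup>2 / c) * (- Bq Q (ptraj A B1 B2 0 W) (ptraj A B1 B2 0 W))"
      by (simp add: k_def mult.assoc)
  qed
qed

lemma free_cross_bound:
  fixes A :: "real^'n^'n" and B1 :: "real^'k^'n" and B2 :: "real^'q^'n"
  assumes A: "hurwitz A" and Q: "transpose Q = Q"
    and fdi: "\<And>s. Re s = 0 \<Longrightarrow> cpsd (blk_eps \<epsilon> (PiQ A B1 B2 Q s))"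
    and s0: "Re s0 = 0" "cpd (- blk22 (PiQ A B1 B2 Q s0))"
    and y: "traj A B1 B2 \<xi> y" "vp y = 0" "wp y = 0"
  obtains C where "C \<ge> 0" "\<And>k. traj A B1 B2 0 k \<Longrightarrow> vp k = 0 \<Longrightarrow> (Bq Q y k)\<^sup>2 \<le> C * (- Bq Q k k)"
proof -
  obtain C where C: "C \<ge> 0" "\<And>W. (Bq Q y (ptraj A B1 B2 0 W))\<^sup>2
    \<le> C * (- Bq Q (ptraj A B1 B2 0 W) (ptraj A B1 B2 0 W))"
    using free_cross_bound_poly[OF A Q fdi s0 y] by metis
  have "(Bq Q y k)\<^sup>2 \<le> C * (- Bq Q k k)" if k: "traj A B1 B2 0 k" "vp k = 0" for k
  proof -
    have "\<exists>W. nsq (k - ptraj A B1 B2 0 W) < 1 / real (Suc i)" for i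
    proof -
      have "1 / real (Suc i) > 0" by simp
      then show ?thesis using ptraj_dense[OF A k(1)] k(2) by metis
    qed
    then obtain W where W: "\<And>i. nsq (k - ptraj A B1 B2 0 (W i)) < 1 / real (Suc i)"
      by metis
    define p where "p i = ptraj A B1 B2 0 (W i)" for i
    have inv: "(\<lambda>i. 1 / real (Suc i)) \<longlonglongrightarrow> 0"
      using LIMSEQ_inverse_real_of_nat by (simp add: inverse_eq_divide del: of_nat_Suc)
    have lim: "(\<lambda>i. nsq (k - p i)) \<longlonglongrightarrow> 0"
      by (rule tendsto_sandwich[OF always_eventually always_eventually tendsto_const inv])
        (use W in \<open>auto simp: p_def intro: less_imp_le\<close>)
    have sp: "sqi (p i)" for i unfolding p_def by (rule traj_sqi[OF traj_ptraj[OF A]])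
    note sk = traj_sqi[OF k(1)] and sy = traj_sqi[OF y(1)]
    have l1: "(\<lambda>i. Bq Q y (p i)) \<longlonglongrightarrow> Bq Q y k"
      by (rule Bq_tendsto[OF sy sk sy sp _ lim]) simp
    have l2: "(\<lambda>i. Bq Q (p i) (p i)) \<longlonglongrightarrow> Bq Q k k"
      by (rule Bq_tendsto[OF sk sk sp sp lim lim])
    have "(\<lambda>i. (Bq Q y (p i))\<^sup>2) \<longlonglongrightarrow> (Bq Q y k)\<^sup>2" by (intro tendsto_intros l1)
    moreover have "(\<lambda>i. C * (- Bq Q (p i) (p i))) \<longlonglongrightarrow> C * (- Bq Q k k)" by (intro tendsto_intros l2)
    ultimately show ?thesis
      by (rule LIMSEQ_le) (use C(2) in \<open>auto simp: p_def\<close>)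
  qed
  with C(1) show ?thesis by (rule that)
qed

subsection \<open>The minimax argument\<close>

lemma am_gm_abs:
  fixes x p q :: real
  assumes "x\<^sup>2 \<le> p * q" "0 \<le> p" "0 \<le> q"
  shows "2 * \<bar>x\<bar> \<le> p + q"
proof -
  have "(2 * \<bar>x\<bar>)\<^sup>2 \<le> 4 * (p * q)" using assms(1) by (simp add: power_mult_distrib)
  also have "4 * (p * q) = (p + q)\<^sup>2 - (p - q)\<^sup>2" by (simp add: power2_eq_square algebra_simps)
  also have "\<dots> \<le> (p + q)\<^sup>2" by simp
  finally show ?thesis by (rule power2_le_imp_le) (simp add: assms(2,3))
qed

text \<open>The quadratic functional \<open>y \<mapsto> B y y\<close> is convex along \<open>HV\<close> and concave along \<open>HW\<close>;
  \<open>freq\<close> bounds the coupling of the two directions.\<close>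

locale saddle =
  fixes B :: "'a::real_vector \<Rightarrow> 'a \<Rightarrow> real" and nn :: "'a \<Rightarrow> real" and S HV HW Y :: "'a set" and \<epsilon> :: real
  assumes S: "subspace S" and HV: "subspace HV" "HV \<subseteq> S" and HW: "subspace HW" "HW \<subseteq> S"
    and Y: "Y \<noteq> {}" "Y \<subseteq> S" "\<And>y h. y \<in> Y \<Longrightarrow> h \<in> HV \<Longrightarrow> y + h \<in> Y" "\<And>y k. y \<in> Y \<Longrightarrow> k \<in> HW \<Longrightarrow> y + k \<in> Y"
    and B_add: "\<And>x y z. x \<in> S \<Longrightarrow> y \<in> S \<Longrightarrow> z \<in> S \<Longrightarrow> B (x + y) z = B x z + B y z"
    and B_scale: "\<And>c x y. B (c *\<^sub>R x) y = c * B x y"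
    and B_sym: "\<And>x y. B x y = B y x"
    and nn: "\<And>x. nn x \<ge> 0" "\<And>c x. nn (c *\<^sub>R x) = c\<^sup>2 * nn x"
    and B_bound: "\<exists>K>0. \<forall>x\<in>S. \<forall>y\<in>S. (B x y)\<^sup>2 \<le> K * nn x * nn y"
    and eps: "\<epsilon> > 0"
    and freq: "\<And>h k. h \<in> HV \<Longrightarrow> k \<in> HW \<Longrightarrow> 0 \<le> B h h + 2 * \<epsilon> * B h k - B k k"
    and cross: "\<And>y. y \<in> Y \<Longrightarrow> \<exists>C\<ge>0. \<forall>k\<in>HW. (B y k)\<^sup>2 \<le> C * (- B k k)"
    and achieve: "\<And>y \<delta>. y \<in> Y \<Longrightarrow> \<delta> > 0 \<Longrightarrow> \<exists>h\<in>HV. B (y + h) (y + h) \<le> \<delta>"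
begin

lemma zero_mem: "0 \<in> HV" "0 \<in> HW"
  using HV HW by (simp_all add: subspace_0)

lemma B_scale_right: "B x (c *\<^sub>R y) = c * B x y"
  using B_scale[of c y x] by (simp add: B_sym)

lemma B_zero: "B 0 y = 0" "B y 0 = 0"
  using B_scale[of 0 0 y] B_sym[of 0 y] by simp_all

lemma B_expand: "x \<in> S \<Longrightarrow> y \<in> S \<Longrightarrow> B (x + y) (x + y) = B x x + 2 * B x y + B y y"
proof -
  assume s: "x \<in> S" "y \<in> S"
  have xy: "x + y \<in> S" by (rule subspace_add[OF S s])
  have "B (x + y) (x + y) = B (x + y) x + B (x + y) y"
    unfolding B_add[OF s xy] B_sym[of x "x + y"] B_sym[of y "x + y"] ..
  also have "B (x + y) x = B x x + B x y" unfolding B_add[OF s s(1)] B_sym[of y x] ..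
  also have "B (x + y) y = B x y + B y y" by (rule B_add[OF s s(2)])
  finally show ?thesis by simp
qed

lemma HV_nonneg: "h \<in> HV \<Longrightarrow> 0 \<le> B h h"
  using freq[of h 0] zero_mem by (simp add: B_zero)

lemma HW_nonneg: "k \<in> HW \<Longrightarrow> 0 \<le> - B k k"
  using freq[of 0 k] zero_mem by (simp add: B_zero)

text \<open>\<open>freq\<close> holds for all multiples of h, so its discriminant in the scaling
  factor is nonpositive; dividing out \<epsilon> leaves
  \<open>1 / \<epsilon>\<^sup>2\<close>.\<close>

lemma coupling:
  assumes "h \<in> HV" "k \<in> HW"
  shows "(B h k)\<^sup>2 \<le> B h h / \<epsilon>\<^sup>2 * (- B k k)"
proof -
  have "0 \<le> - B k k + 2 * t * (\<epsilon> * B h k) + t\<^sup>2 * B h h" for t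
    using freq[OF subspace_scale[OF HV(1) assms(1), of t] assms(2)]
    by (simp add: B_scale B_scale_right power2_eq_square algebra_simps)
  then have "(\<epsilon> * B h k)\<^sup>2 \<le> - B k k * B h h" by (rule quadratic_nonneg_discriminant)
  then show ?thesis using eps by (simp add: power_mult_distrib field_simps)
qed

lemma mem_S: "y \<in> Y \<Longrightarrow> y \<in> S" "h \<in> HV \<Longrightarrow> h \<in> S" "k \<in> HW \<Longrightarrow> k \<in> S"
  using HV HW Y by auto

lemma sup_bound:
  assumes "y \<in> Y"
  shows "\<exists>M. \<forall>k\<in>HW. B (y + k) (y + k) \<le> M"
proof -
  obtain C where C: "C \<ge> 0" "\<And>k. k \<in> HW \<Longrightarrow> (B y k)\<^sup>2 \<le> C * (- B k k)" using cross[OF assms] by blast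
  have "B (y + k) (y + k) \<le> B y y + C" if k: "k \<in> HW" for k
    using am_gm_abs[OF C(2)[OF k] C(1) HW_nonneg[OF k]] B_expand[of y k] mem_S(1)[OF assms] mem_S(3)[OF k] by simp
  then show ?thesis by blast
qed

text \<open>If h could lower the value noticeably, so could some multiple t h at first order in t.
  The best reply k to t h regains, by \<open>coupling\<close>, only second order in t up to
  multiples of \<eta>, while the reply must still reach m - \<eta>. Hence the slope of B at y along
  h is small relative to the curvature.\<close>

lemma almost_saddle:
  assumes "\<eta> > 0" and low: "\<And>y. y \<in> Y \<Longrightarrow> \<exists>k\<in>HW. B (y + k) (y + k) \<ge> m - \<eta>"
    and y: "y \<in> Y" and up: "\<And>k. k \<in> HW \<Longrightarrow> B (y + k) (y + k) \<le> B y y + \<eta>" and close: "B y y \<le> m + \<eta>"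
    and h: "h \<in> HV"
  shows "B (y + h) (y + h) \<ge> B y y - 5 * \<eta> * (1 + 2 / \<epsilon>\<^sup>2)"
proof -
  define L where "L = 1 + 2 / \<epsilon>\<^sup>2"
  have L: "L > 0" using eps by (simp add: L_def add_pos_pos)
  note SS = mem_S(1)[OF y] mem_S(2)[OF h]
  \<comment> \<open>\<open>y\<close> is within \<eta> of the maximum along the whole line through k,
    so its slope there is controlled by the curvature.\<close>
  have dW: "(B y k)\<^sup>2 \<le> \<eta> * (- B k k)" if k: "k \<in> HW" for k
  proof -
    have "0 \<le> \<eta> + 2 * t * (- B y k) + t\<^sup>2 * (- B k k)" for t
      using up[OF subspace_scale[OF HW(1) k, of t]] B_expand[OF SS(1) mem_S(3)[OF subspace_scale[OF HW(1) k, of t]]]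
      by (simp add: B_scale B_scale_right power2_eq_square algebra_simps)
    from quadratic_nonneg_discriminant[OF this] show ?thesis by simp
  qed
  \<comment> \<open>One \<eta> is spent in \<open>low\<close>, one in \<open>close\<close> and two
    in the slope along k; 5 leaves slack. The two halves of \<open>- B k k\<close> absorb
    \<open>B k k\<close>.\<close>
  have "0 \<le> 5 * \<eta> + 2 * t * B y h + t\<^sup>2 * (B h h * L)" for t
  proof -
    have th: "t *\<^sub>R h \<in> HV" by (rule subspace_scale[OF HV(1) h])
    obtain k where k: "k \<in> HW" "B ((y + t *\<^sub>R h) + k) ((y + t *\<^sub>R h) + k) \<ge> m - \<eta>"
      using low[OF Y(3)[OF y th]] by blast
    have "B ((y + t *\<^sub>R h) + k) ((y + t *\<^sub>R h) + k)
        = B y y + 2 * t * B y h + t\<^sup>2 * B h h + 2 * (B (t *\<^sub>R h) k) + 2 * B y k + B k k"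
      using B_expand[OF mem_S(1)[OF Y(3)[OF y th]] mem_S(3)[OF k(1)]] B_expand[OF SS(1) mem_S(2)[OF th]]
        B_add[OF SS(1) mem_S(2)[OF th] mem_S(3)[OF k(1)]]
      by (simp add: B_scale B_scale_right power2_eq_square)
    moreover have "2 * \<bar>B (t *\<^sub>R h) k\<bar> \<le> 2 * (t\<^sup>2 * B h h / \<epsilon>\<^sup>2) + (- B k k) / 2"
    proof (rule am_gm_abs)
      have "t\<^sup>2 * B h h = B (t *\<^sub>R h) (t *\<^sub>R h)" by (simp add: B_scale B_scale_right power2_eq_square)
      then show "(B (t *\<^sub>R h) k)\<^sup>2 \<le> 2 * (t\<^sup>2 * B h h / \<epsilon>\<^sup>2) * (- B k k / 2)"
        using coupling[OF th k(1)] by simp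
      show "0 \<le> 2 * (t\<^sup>2 * B h h / \<epsilon>\<^sup>2)" using HV_nonneg[OF h] by (intro mult_nonneg_nonneg divide_nonneg_nonneg) auto
      show "0 \<le> - B k k / 2" using HW_nonneg[OF k(1)] by simp
    qed
    moreover have "2 * \<bar>B y k\<bar> \<le> 2 * \<eta> + (- B k k) / 2"
      using dW[OF k(1)] HW_nonneg[OF k(1)] assms(1) by (intro am_gm_abs) auto
    moreover have "t\<^sup>2 * (B h h * L) = t\<^sup>2 * B h h + 2 * (t\<^sup>2 * B h h / \<epsilon>\<^sup>2)"
      by (simp add: L_def algebra_simps)
    ultimately show ?thesis using assms(1) k(2) close abs_ge_self[of "B (t *\<^sub>R h) k"] abs_ge_self[of "B y k"] by linarith
  qed
  then have "(B y h)\<^sup>2 \<le> 5 * \<eta> * (B h h * L)" by (rule quadratic_nonneg_discriminant)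
  then have "(B y h)\<^sup>2 \<le> (5 * \<eta> * L) * B h h" by (simp add: mult_ac)
  then have "2 * \<bar>B y h\<bar> \<le> 5 * \<eta> * L + B h h"
    using assms(1) L HV_nonneg[OF h] by (intro am_gm_abs) auto
  then show ?thesis
    using B_expand[OF SS] abs_ge_minus_self[of "B y h"] by (simp add: L_def)
qed

text \<open>A positive inf-sup value m would give an almost saddle point with value near m, from
  which moves along \<open>HV\<close> gain almost nothing; but \<open>achieve\<close> brings the
  value down to m / 2.\<close>

lemma minimax:
  assumes d: "\<delta> > 0"
  shows "\<exists>y\<in>Y. \<forall>k\<in>HW. B (y + k) (y + k) \<le> \<delta>"
proof (rule ccontr)
  assume neg: "\<not> ?thesis"
  define G where "G y = (SUP k\<in>HW. B (y + k) (y + k))" for y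
  have bdd: "bdd_above ((\<lambda>k. B (y + k) (y + k)) ` HW)" if "y \<in> Y" for y
    using sup_bound[OF that] by (auto simp: bdd_above_def)
  have ne: "(\<lambda>k. B (y + k) (y + k)) ` HW \<noteq> {}" for y using zero_mem by blast
  have GU: "B (y + k) (y + k) \<le> G y" if "y \<in> Y" "k \<in> HW" for y k
    unfolding G_def using that by (intro cSUP_upper bdd)
  have G_ge: "G y \<ge> \<delta>" if "y \<in> Y" for y
    using neg GU[OF that] that by (meson less_imp_le not_le order_trans)
  define m where "m = (INF y\<in>Y. G y)"
  have m: "m \<ge> \<delta>" unfolding m_def using Y(1) G_ge by (intro cINF_greatest)
  have Gm: "m \<le> G y" if "y \<in> Y" for y
    unfolding m_def using G_ge that by (intro cINF_lower) (auto simp: bdd_below_def)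
  define L where "L = 5 * (1 + 2 / \<epsilon>\<^sup>2)"
  have L: "L > 0" using eps by (simp add: L_def add_pos_pos)
  \<comment> \<open>The losses add up to \<open>\<eta> * (1 + L)\<close>, that is m / 4, so the
    value would stay above 3 m / 4.\<close>
  define \<eta> where "\<eta> = m / (4 * (1 + L))"
  have eta: "\<eta> > 0" using m d L by (simp add: \<eta>_def)
  obtain y0 where y0: "y0 \<in> Y" "G y0 < m + \<eta>"
    using cInf_lessD[of "G ` Y" "m + \<eta>"] Y(1) eta unfolding m_def by auto
  obtain k0 where k0: "k0 \<in> HW" "G y0 - \<eta> < B (y0 + k0) (y0 + k0)"
    using less_cSupD[OF ne[of y0], of "G y0 - \<eta>"] eta unfolding G_def by auto
  \<comment> \<open>Absorbing the almost maximal \<open>k0\<close> makes a single point almost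
    optimal in both directions.\<close>
  define y where "y = y0 + k0"
  have y: "y \<in> Y" unfolding y_def by (rule Y(4)[OF y0(1) k0(1)])
  have low: "\<exists>k\<in>HW. B (y + k) (y + k) \<ge> m - \<eta>" if "y \<in> Y" for y
  proof -
    have "G y - \<eta> < Sup ((\<lambda>k. B (y + k) (y + k)) ` HW)" using eta by (simp add: G_def)
    from less_cSupD[OF ne this] obtain k where "k \<in> HW" "G y - \<eta> < B (y + k) (y + k)" by auto
    then show ?thesis using Gm[OF that] by (intro bexI[of _ k]) auto
  qed
  have up: "B (y + k) (y + k) \<le> B y y + \<eta>" if "k \<in> HW" for k
  proof -
    have "B (y0 + (k0 + k)) (y0 + (k0 + k)) \<le> G y0"
      by (intro GU y0 subspace_add[OF HW(1)] k0 that)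
    then show ?thesis using k0(2) by (simp add: y_def add.assoc)
  qed
  have close: "B y y \<le> m + \<eta>" using GU[OF y0(1) k0(1)] y0(2) by (simp add: y_def)
  have Byy: "B y y > m - \<eta>" using k0(2) Gm[OF y0(1)] by (simp add: y_def)
  have "m / 2 > 0" using m d by simp
  then obtain h where h: "h \<in> HV" "B (y + h) (y + h) \<le> m / 2" using achieve[OF y] by blast
  have "B (y + h) (y + h) \<ge> B y y - \<eta> * L"
    using almost_saddle[OF eta low y up close h(1)] by (simp add: L_def mult_ac)
  then have "m / 2 > m - \<eta> * (1 + L)" using h(2) Byy by (simp add: algebra_simps)
  moreover have "\<eta> * (1 + L) = m / 4"
  proof -
    have "1 + L \<noteq> 0" using L by simp
    then have "m / (4 * (1 + L)) * (1 + L) = m / 4" by (metis divide_divide_eq_left nonzero_eq_divide_eq)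
    then show ?thesis by (simp only: \<eta>_def)
  qed
  ultimately show False using m d by simp
qed

text \<open>Convexity along \<open>HV\<close> turns the uniform bound on a ball into continuity of the supremum over \<open>HW\<close>.\<close>

lemma robust:
  assumes y: "y \<in> Y" and le: "\<And>k. k \<in> HW \<Longrightarrow> B (y + k) (y + k) \<le> \<delta>" and d: "\<delta> > 0"
  shows "\<exists>\<rho>>0. \<forall>h\<in>HV. nn h < \<rho> \<longrightarrow> (\<forall>k\<in>HW. B (y + h + k) (y + h + k) \<le> 2 * \<delta>)"
proof -
  obtain C where C: "C \<ge> 0" "\<And>k. k \<in> HW \<Longrightarrow> (B y k)\<^sup>2 \<le> C * (- B k k)" using cross[OF y] by blast
  obtain K where K: "K > 0" "\<And>x y. x \<in> S \<Longrightarrow> y \<in> S \<Longrightarrow> (B x y)\<^sup>2 \<le> K * nn x * nn y" using B_bound by blast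
  note yS = mem_S(1)[OF y]
  \<comment> \<open>One summand for \<open>2 * B y h\<close>, one for \<open>B h h\<close> together
    with the coupling of h and k, one for the coupling of y and k; the halves of
    \<open>- B k k\<close> used in the couplings cancel \<open>B k k\<close>, so the bound is
    uniform in k.\<close>
  define M where "M = B y y + (K * nn y + 1) + (K + 1) * (1 + 2 / \<epsilon>\<^sup>2) + 2 * C"
  have bound: "B (y + h + k) (y + h + k) \<le> M" if h: "h \<in> HV" "nn h \<le> 1" and k: "k \<in> HW" for h k
  proof -
    note SS = mem_S(2)[OF h(1)] mem_S(3)[OF k] mem_S(1)[OF Y(3)[OF y h(1)]]
    have e: "B (y + h + k) (y + h + k) = B y y + 2 * B y h + B h h + 2 * B h k + 2 * B y k + B k k"
      using B_expand[OF SS(3) SS(2)] B_expand[OF yS SS(1)] B_add[OF yS SS(1) SS(2)] by simp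
    have "(B y h)\<^sup>2 \<le> K * nn y * nn h" by (rule K(2)[OF yS SS(1)])
    also have "\<dots> \<le> K * nn y * 1" using h K(1) nn(1)[of y] by (intro mult_left_mono) auto
    finally have 1: "2 * \<bar>B y h\<bar> \<le> K * nn y + 1" using K(1) nn(1)[of y] by (intro am_gm_abs) auto
    have "(B h h)\<^sup>2 \<le> K * nn h * nn h" by (rule K(2)[OF SS(1) SS(1)])
    also have "\<dots> \<le> K * 1 * 1" using h K(1) nn(1)[of h] by (intro mult_mono) auto
    finally have "2 * \<bar>B h h\<bar> \<le> K + 1" using K(1) by (intro am_gm_abs) auto
    then have 2: "B h h \<le> K + 1" using K(1) by linarith
    have "(B h k)\<^sup>2 \<le> (2 * (B h h / \<epsilon>\<^sup>2)) * ((- B k k) / 2)" using coupling[OF h(1) k] by simp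
    then have 3: "2 * \<bar>B h k\<bar> \<le> 2 * (B h h / \<epsilon>\<^sup>2) + (- B k k) / 2"
      using HV_nonneg[OF h(1)] HW_nonneg[OF k] by (intro am_gm_abs) auto
    have 4: "2 * \<bar>B y k\<bar> \<le> 2 * C + (- B k k) / 2"
      using C(2)[OF k] C(1) HW_nonneg[OF k] by (intro am_gm_abs) auto
    have "B h h * (1 + 2 / \<epsilon>\<^sup>2) \<le> (K + 1) * (1 + 2 / \<epsilon>\<^sup>2)"
      using 2 eps by (intro mult_right_mono) auto
    then have 5: "B h h + 2 * (B h h / \<epsilon>\<^sup>2) \<le> (K + 1) * (1 + 2 / \<epsilon>\<^sup>2)" by (simp add: algebra_simps)
    show ?thesis unfolding e M_def
      using 1 3 4 5 abs_ge_self[of "B y h"] abs_ge_self[of "B h k"] abs_ge_self[of "B y k"] by linarith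
  qed
  \<comment> \<open>Scaling h by 1 / s reaches the unit ball, hence the radius
    \<open>s\<^sup>2\<close>; convexity weights the bound \<open>M\<close> with s, and
    \<open>s * \<bar>M\<bar>\<close> is at most \<delta>.\<close>
  define s where "s = min (1 / 2) (\<delta> / (1 + \<bar>M\<bar>))"
  have s: "s > 0" "s \<le> 1" "s * \<bar>M\<bar> \<le> \<delta>"
  proof -
    show "s > 0" "s \<le> 1" using d by (auto simp: s_def)
    have "s * \<bar>M\<bar> \<le> \<delta> / (1 + \<bar>M\<bar>) * \<bar>M\<bar>" by (intro mult_right_mono) (auto simp: s_def)
    also have "\<dots> \<le> \<delta>" using d by (simp add: field_simps)
    finally show "s * \<bar>M\<bar> \<le> \<delta>" .
  qed
  show ?thesis
  proof (intro exI[of _ "s\<^sup>2"] conjI ballI impI)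
    show "s\<^sup>2 > 0" using s by simp
    fix h k assume h: "h \<in> HV" "nn h < s\<^sup>2" and k: "k \<in> HW"
    define g where "g = (1 / s) *\<^sub>R h"
    have g: "g \<in> HV" unfolding g_def by (rule subspace_scale[OF HV(1) h(1)])
    have "nn g \<le> 1" using h(2) s by (simp add: g_def nn(2) power_divide field_simps)
    then have M: "B (y + g + k) (y + g + k) \<le> M" by (rule bound[OF g _ k])
    have hg: "h = s *\<^sub>R g" using s by (simp add: g_def)
    have yk: "y + k \<in> S" using mem_S(1)[OF Y(4)[OF y k]] .
    have e: "B ((y + k) + g) ((y + k) + g) = B (y + k) (y + k) + 2 * B (y + k) g + B g g"
      by (rule B_expand[OF yk mem_S(2)[OF g]])
    have "B ((y + k) + h) ((y + k) + h) = B (y + k) (y + k) + 2 * s * B (y + k) g + s\<^sup>2 * B g g"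
      using B_expand[OF yk mem_S(2)[OF h(1)]] by (simp add: hg B_scale B_scale_right power2_eq_square)
    \<comment> \<open>Convexity enters here: \<open>B g g\<close> is nonnegative and s is at most
      1.\<close>
    also have "s\<^sup>2 * B g g \<le> s * B g g"
      using s mult_left_le_one_le[of s s] by (intro mult_right_mono HV_nonneg[OF g]) (simp add: power2_eq_square)
    also have "B (y + k) (y + k) + 2 * s * B (y + k) g + s * B g g
        = (1 - s) * B (y + k) (y + k) + s * B ((y + k) + g) ((y + k) + g)"
      unfolding e by (simp add: algebra_simps)
    also have "(1 - s) * B (y + k) (y + k) \<le> (1 - s) * \<delta>"
      using le[OF k] s by (intro mult_left_mono) auto
    also have "(1 - s) * \<delta> \<le> \<delta>" using s d by (simp add: mult_left_le_one_le)
    also have "s * B ((y + k) + g) ((y + k) + g) \<le> s * \<bar>M\<bar>"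
      using M s abs_ge_self[of M] by (intro mult_left_mono) (auto simp: add_ac)
    also have "s * \<bar>M\<bar> \<le> \<delta>" by (rule s(3))
    finally show "B (y + h + k) (y + h + k) \<le> 2 * \<delta>" by (simp add: add_ac)
  qed
qed

end

section \<open>The minimax argument for trajectories\<close>

lemma Bq_0: "Bq Q 0 u = 0"
  using Bq_scaleR_left[of Q 0 0 u] by simp

lemma Bq_add_right:
  "transpose Q = Q \<Longrightarrow> sqi y \<Longrightarrow> sqi y' \<Longrightarrow> sqi u \<Longrightarrow> Bq Q u (y + y') = Bq Q u y + Bq Q u y'"
  using Bq_add_left[of y y' u Q] by (simp only: Bq_sym[of Q u])

lemma Bq_scaleR_right: "transpose Q = Q \<Longrightarrow> Bq Q u (c *\<^sub>R y) = c * Bq Q u y"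
  using Bq_scaleR_left[of Q c y u] by (simp only: Bq_sym[of Q u])

text \<open>The trajectory is split into its free part, its response to v and its response to w. The
  three pairings with k are bounded by the free coupling, by the frequency inequality, and by
  Cauchy-Schwarz for the semidefinite form in w.\<close>

lemma cross_bound:
  fixes A :: "real^'n^'n" and B1 :: "real^'k^'n" and B2 :: "real^'q^'n"
  assumes A: "hurwitz A" and Q: "transpose Q = Q" and eps: "\<epsilon> > 0"
    and fdi: "\<And>s. Re s = 0 \<Longrightarrow> cpsd (blk_eps \<epsilon> (PiQ A B1 B2 Q s))"
    and s0: "Re s0 = 0" "cpd (- blk22 (PiQ A B1 B2 Q s0))"
    and y: "traj A B1 B2 \<xi> y"
  shows "\<exists>C\<ge>0. \<forall>k. traj A B1 B2 0 k \<and> vp k = 0 \<longrightarrow> (Bq Q y k)\<^sup>2 \<le> C * (- Bq Q k k)"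
proof -
  note sy = sqi_proj[OF traj_sqi[OF y]]
  obtain x0 where "traj A B1 B2 \<xi> (trip x0 0 0)" using traj_exists[OF A sqi_0 sqi_0] by blast
  then obtain yf where yf: "traj A B1 B2 \<xi> yf" "vp yf = 0" "wp yf = 0" by (metis trip_proj(2,3))
  obtain xh where h: "traj A B1 B2 0 (trip xh (vp y) 0)" using traj_exists[OF A sy(2) sqi_0] by blast
  define h0 where "h0 = trip xh (vp y) (0 :: real \<Rightarrow> real^'q)"
  have h0: "traj A B1 B2 0 h0" "vp h0 = vp y" "wp h0 = 0" using h by (simp_all add: h0_def)
  define k0 where "k0 = y - yf - h0"
  have k0: "traj A B1 B2 0 k0" "vp k0 = 0"
    using traj_diff[OF traj_diff[OF y yf(1)] h0(1)] yf h0 by (simp_all add: k0_def)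
  obtain C where C: "C \<ge> 0" "\<And>k. traj A B1 B2 0 k \<Longrightarrow> vp k = 0 \<Longrightarrow> (Bq Q yf k)\<^sup>2 \<le> C * (- Bq Q k k)"
    using free_cross_bound[OF A Q fdi s0 yf] by metis
  have ineq: "0 \<le> Bq Q h h + 2 * \<epsilon> * Bq Q h k - Bq Q k k"
    if "traj A B1 B2 0 h" "wp h = 0" "traj A B1 B2 0 k" "vp k = 0" for h k
    by (rule frequency_inequality[OF A Q fdi that])
  have neg: "0 \<le> - Bq Q k k" if "traj A B1 B2 0 k" "vp k = 0" for k
  proof -
    have "traj A B1 B2 0 0" using traj_scaleR[OF h0(1), of 0] by simp
    from ineq[OF this _ that] show ?thesis by (simp add: Bq_0)
  qed
  \<comment> \<open>The 3 is from (a + b + c)^2 being at most 3 (a^2 + b^2 + c^2).\<close>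
  define C' where "C' = 3 * (C + Bq Q h0 h0 / \<epsilon>\<^sup>2 + - Bq Q k0 k0)"
  have hh: "0 \<le> Bq Q h0 h0"
  proof -
    have "traj A B1 B2 0 0" using traj_scaleR[OF h0(1), of 0] by simp
    from ineq[OF h0(1,3) this] show ?thesis by (simp add: Bq_0 Bq_sym[OF Q, of _ 0])
  qed
  show ?thesis
  proof (intro exI[of _ C'] conjI allI impI)
    have "0 \<le> Bq Q h0 h0 / \<epsilon>\<^sup>2" using hh by simp
    then show "0 \<le> C'" using C(1) neg[OF k0] by (simp add: C'_def)
    fix k assume "traj A B1 B2 0 k \<and> vp k = 0"
    then have k: "traj A B1 B2 0 k" "vp k = 0" by auto
    note s = traj_sqi[OF yf(1)] traj_sqi[OF h0(1)] traj_sqi[OF k0(1)] traj_sqi[OF k(1)]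
    have "(\<epsilon> * Bq Q h0 k)\<^sup>2 \<le> - Bq Q k k * Bq Q h0 h0"
    proof (rule quadratic_nonneg_discriminant)
      fix t
      have "traj A B1 B2 0 (t *\<^sub>R h0)" "wp (t *\<^sub>R h0) = 0"
        using traj_scaleR[OF h0(1), of t] h0(3) by simp_all
      from ineq[OF this k] show "0 \<le> - Bq Q k k + 2 * t * (\<epsilon> * Bq Q h0 k) + t\<^sup>2 * Bq Q h0 h0"
        by (simp add: Bq_scaleR_left Bq_sym[OF Q, of h0 "t *\<^sub>R h0"] power2_eq_square algebra_simps)
    qed
    then have 1: "(Bq Q h0 k)\<^sup>2 \<le> Bq Q h0 h0 / \<epsilon>\<^sup>2 * (- Bq Q k k)"
      using eps by (simp add: power_mult_distrib field_simps)
    have 2: "(Bq Q k0 k)\<^sup>2 \<le> - Bq Q k0 k0 * (- Bq Q k k)"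
    proof -
      have "(- Bq Q k0 k)\<^sup>2 \<le> - Bq Q k0 k0 * (- Bq Q k k)"
      proof (rule quadratic_nonneg_discriminant)
        fix t
        have "traj A B1 B2 0 (k0 + t *\<^sub>R k)" "vp (k0 + t *\<^sub>R k) = 0"
          using traj_add[OF k0(1) traj_scaleR[OF k(1), of t]] k0(2) k(2) by simp_all
        from neg[OF this] show "0 \<le> - Bq Q k0 k0 + 2 * t * (- Bq Q k0 k) + t\<^sup>2 * (- Bq Q k k)"
          using s by (simp add: Bq_add_left Bq_add_right[OF Q] sqi_add sqi_scaleR Bq_scaleR_left Bq_scaleR_right[OF Q]
              Bq_sym[OF Q, of k k0] power2_eq_square algebra_simps)
      qed
      then show ?thesis by simp
    qed
    have "y = (yf + h0) + k0" by (simp add: k0_def)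
    then have "Bq Q y k = Bq Q yf k + Bq Q h0 k + Bq Q k0 k"
      using s by (simp add: Bq_add_left sqi_add)
    moreover have "(a + b + c)\<^sup>2 \<le> 3 * (a\<^sup>2 + b\<^sup>2 + c\<^sup>2)" for a b c :: real
    proof -
      have "3 * (a\<^sup>2 + b\<^sup>2 + c\<^sup>2) - (a + b + c)\<^sup>2 = (a - b)\<^sup>2 + (b - c)\<^sup>2 + (a - c)\<^sup>2"
        by (simp add: power2_eq_square algebra_simps)
      then show ?thesis by (smt (verit) zero_le_power2)
    qed
    ultimately have "(Bq Q y k)\<^sup>2 \<le> 3 * ((Bq Q yf k)\<^sup>2 + (Bq Q h0 k)\<^sup>2 + (Bq Q k0 k)\<^sup>2)" by simp
    also have "\<dots> \<le> C' * (- Bq Q k k)"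
      using C(2)[OF k] 1 2 unfolding C'_def by (simp add: algebra_simps)
    finally show "(Bq Q y k)\<^sup>2 \<le> C' * (- Bq Q k k)" .
  qed
qed

text \<open>\<open>HV\<close> and \<open>HW\<close> are the zero-state responses to v alone and to w
  alone. A trajectory from \<xi> whose v is close to the chosen one differs from the chosen
  trajectory by a small element of \<open>HV\<close> and an arbitrary one of \<open>HW\<close>, so
  the bound holds whatever w is.\<close>

lemma game:
  fixes A :: "real^'n^'n" and B1 :: "real^'k^'n" and B2 :: "real^'q^'n"
    and C :: "real^'n^'k" and D1 :: "real^'k^'k" and D2 :: "real^'q^'k"
  assumes A: "hurwitz A" and Q: "transpose Q = Q" and eps: "\<epsilon> > 0"
    and fdi: "\<And>s. Re s = 0 \<Longrightarrow> cpsd (blk_eps \<epsilon> (PiQ A B1 B2 Q s))"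
    and s0: "Re s0 = 0" "cpd (- blk22 (PiQ A B1 B2 Q s0))"
    and out: "\<And>x v w. sigma_Q Q x v w \<le> (norm (C *v x + D1 *v v + D2 *v w))\<^sup>2"
    and min_phase: "\<And>s. Re s > 0 \<Longrightarrow> det (sysmat A B1 C D1 s) \<noteq> 0"
    and d: "\<delta> > 0"
  obtains v \<rho> where "sqi v" "\<rho> > 0"
    "\<And>y. traj A B1 B2 \<xi> y \<Longrightarrow> nsq (vp y - v) < \<rho> \<Longrightarrow> Bq Q y y \<le> \<delta>"
proof -
  define HV where "HV = {h. traj A B1 B2 0 h \<and> wp h = 0}"
  define HW where "HW = {k. traj A B1 B2 0 k \<and> vp k = 0}"
  define Y where "Y = {y. traj A B1 B2 \<xi> y}"
  have t0: "traj A B1 B2 0 0"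
  proof -
    obtain x where "traj A B1 B2 0 (trip x 0 0)" using traj_exists[OF A sqi_0 sqi_0] by blast
    from traj_scaleR[OF this, of 0] show ?thesis by simp
  qed
  have subspaces: "subspace {y. sqi y}" "subspace HV" "subspace HW"
    unfolding subspace_def HV_def HW_def
    using t0 traj_add[of A B1 B2 0 _ 0] traj_scaleR[of A B1 B2 0]
    by (auto simp: sqi_add sqi_scaleR)
  interpret saddle "Bq Q" "\<lambda>y. nsq y" "{y. sqi y}" HV HW Y \<epsilon>
  proof
    show "subspace {y. sqi y}" "subspace HV" "subspace HW" by (rule subspaces)+
    show "HV \<subseteq> {y. sqi y}" "HW \<subseteq> {y. sqi y}" "Y \<subseteq> {y. sqi y}"
      by (auto simp: HV_def HW_def Y_def dest: traj_sqi)
    show "Y \<noteq> {}" using traj_exists[OF A sqi_0 sqi_0, of B1 B2 \<xi>] unfolding Y_def by blast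
    show "y + h \<in> Y" if "y \<in> Y" "h \<in> HV" for y h
      using that traj_add[of A B1 B2 \<xi> y 0 h] by (simp add: Y_def HV_def)
    show "y + k \<in> Y" if "y \<in> Y" "k \<in> HW" for y k
      using that traj_add[of A B1 B2 \<xi> y 0 k] by (simp add: Y_def HW_def)
    show "Bq Q (x + y) z = Bq Q x z + Bq Q y z" if "x \<in> {y. sqi y}" "y \<in> {y. sqi y}" "z \<in> {y. sqi y}" for x y z
      using that by (simp add: Bq_add_left)
    show "Bq Q (c *\<^sub>R x) y = c * Bq Q x y" for c x y by (rule Bq_scaleR_left)
    show "Bq Q x y = Bq Q y x" for x y by (rule Bq_sym[OF Q])
    show "0 \<le> nsq x" for x :: "real \<Rightarrow> (real^'n) \<times> (real^'k) \<times> (real^'q)" by simp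
    show "nsq (c *\<^sub>R x) = c\<^sup>2 * nsq x" for c and x :: "real \<Rightarrow> (real^'n) \<times> (real^'k) \<times> (real^'q)"
      by (simp add: power2_eq_square)
    show "\<exists>K>0. \<forall>x\<in>{y. sqi y}. \<forall>y\<in>{y. sqi y}. (Bq Q x y)\<^sup>2 \<le> K * nsq x * nsq y"
      using Bq_bounded[of Q] by (metis mem_Collect_eq)
    show "\<epsilon> > 0" by (rule eps)
    show "0 \<le> Bq Q h h + 2 * \<epsilon> * Bq Q h k - Bq Q k k" if "h \<in> HV" "k \<in> HW" for h k
    proof -
      have t: "traj A B1 B2 0 h" "wp h = 0" "traj A B1 B2 0 k" "vp k = 0"
        using that by (auto simp: HV_def HW_def)
      show ?thesis by (rule frequency_inequality[OF A Q fdi t])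
    qed
    show "\<exists>C\<ge>0. \<forall>k\<in>HW. (Bq Q y k)\<^sup>2 \<le> C * - Bq Q k k" if "y \<in> Y" for y
      using cross_bound[OF A Q eps fdi s0, of \<xi> y] that by (auto simp: Y_def HW_def)
    show "\<exists>h\<in>HV. Bq Q (y + h) (y + h) \<le> \<delta>'" if y: "y \<in> Y" and d': "\<delta>' > 0" for y \<delta>'
    proof -
      have ty: "traj A B1 B2 \<xi> y" using y by (simp add: Y_def)
      note sy = sqi_proj[OF traj_sqi[OF ty]]
      \<comment> \<open>The output of \<open>y\<close>. A response to v alone whose output is close
        to its negative makes the total output small, and \<open>out\<close> bounds the cost by the
        squared norm of that output.\<close>
      define o1 where "o1 = (\<lambda>t. C *v xp y t) + (\<lambda>t. D1 *v vp y t) + (\<lambda>t. D2 *v wp y t)"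
      have so: "sqi (- o1)"
      proof -
        have "sqi ((-1) *\<^sub>R o1)"
          unfolding o1_def
          by (intro sqi_scaleR sqi_add sqi_bounded_linear[OF matrix_vector_mul_bounded_linear] sy)
        then show ?thesis by simp
      qed
      obtain h where h: "traj A B1 B2 0 h" "wp h = 0"
        "nsq (- o1 - (\<lambda>t. C *v xp h t + D1 *v vp h t)) < \<delta>'"
        by (rule almost_zero_output[OF min_phase so d', of B2])
      let ?e = "- o1 - (\<lambda>t. C *v xp h t + D1 *v vp h t)"
      note sh = sqi_proj[OF traj_sqi[OF h(1)]]
      have th: "traj A B1 B2 \<xi> (y + h)" using traj_add[OF ty h(1)] by simp
      have se: "sqi ?e" using so sqi_input[OF sh(1,2), of C D1] by (rule sqi_diff)
      have "Bq Q (y + h) (y + h) = (LINT t|halfline. sigma_Q Q (xp (y + h) t) (vp (y + h) t) (wp (y + h) t))"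
        by (rule Bq_eq_integral)
      also have "\<dots> \<le> (LINT t|halfline. ?e t \<bullet> ?e t)"
      proof (rule integral_mono)
        have "integrable halfline (\<lambda>t. stk ((y + h) t) \<bullet> (Q *v stk ((y + h) t)))"
          by (intro integrable_inner sqi_stk sqi_Q_stk traj_sqi[OF th])
        then show "integrable halfline (\<lambda>t. sigma_Q Q (xp (y + h) t) (vp (y + h) t) (wp (y + h) t))"
          by (simp add: sigma_Q_def stk_def xp_def vp_def wp_def)
        show "integrable halfline (\<lambda>t. ?e t \<bullet> ?e t)" by (rule integrable_inner[OF se se])
        fix t
        have "?e t = - (C *v xp (y + h) t + D1 *v vp (y + h) t + D2 *v wp (y + h) t)"
          using h(2) by (simp add: o1_def matrix_vector_right_distrib)
        then have "?e t \<bullet> ?e t = (norm (C *v xp (y + h) t + D1 *v vp (y + h) t + D2 *v wp (y + h) t))\<^sup>2"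
          by (simp only: power2_norm_eq_inner inner_minus_left inner_minus_right minus_minus)
        then show "sigma_Q Q (xp (y + h) t) (vp (y + h) t) (wp (y + h) t) \<le> ?e t \<bullet> ?e t"
          using out by simp
      qed
      also have "\<dots> = nsq ?e" by (simp add: ip_def)
      finally show ?thesis using h by (intro bexI[of _ h]) (auto simp: HV_def)
    qed
  qed
  \<comment> \<open>\<open>robust\<close> doubles the bound, so the minimax is run with half of
    \<delta>.\<close>
  have d2: "\<delta> / 2 > 0" using d by simp
  obtain y where y: "y \<in> Y" "\<And>k. k \<in> HW \<Longrightarrow> Bq Q (y + k) (y + k) \<le> \<delta> / 2" using minimax[OF d2] by blast
  obtain \<rho> where rho: "\<rho> > 0" "\<And>h k. h \<in> HV \<Longrightarrow> nsq h < \<rho> \<Longrightarrow> k \<in> HW \<Longrightarrow> Bq Q (y + h + k) (y + h + k) \<le> 2 * (\<delta> / 2)"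
    using robust[OF y d2] by blast
  have ty: "traj A B1 B2 \<xi> y" using y by (simp add: Y_def)
  obtain K where K: "K > 0" "\<And>y. traj A B1 B2 0 y \<Longrightarrow> nsq y \<le> K * (nsq (vp y) + nsq (wp y))"
    using traj_bound[OF A, of B1 B2] by blast
  show ?thesis
  proof (rule that[of "vp y" "\<rho> / K"])
    show "sqi (vp y)" by (rule sqi_proj[OF traj_sqi[OF ty]])
    show "\<rho> / K > 0" using rho K by simp
    fix y' assume y': "traj A B1 B2 \<xi> y'" and close: "nsq (vp y' - vp y) < \<rho> / K"
    have "sqi (vp y' - vp y)" by (intro sqi_diff sqi_proj[OF traj_sqi[OF ty]] sqi_proj[OF traj_sqi[OF y']])
    then obtain xh where "traj A B1 B2 0 (trip xh (vp y' - vp y) 0)" using traj_exists[OF A _ sqi_0] by blast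
    then obtain h where h: "traj A B1 B2 0 h" "vp h = vp y' - vp y" "wp h = 0" by (metis trip_proj(2,3))
    have "nsq h \<le> K * nsq (vp y' - vp y)" using K(2)[OF h(1)] by (simp add: h)
    also have "\<dots> < \<rho>" using close K(1) by (simp add: pos_less_divide_eq mult.commute)
    finally have hs: "nsq h < \<rho>" .
    define k where "k = y' - y - h"
    have "traj A B1 B2 0 k" "vp k = 0"
      using traj_diff[OF traj_diff[OF y' ty] h(1)] h(2) by (simp_all add: k_def)
    then have "Bq Q (y + h + k) (y + h + k) \<le> 2 * (\<delta> / 2)"
      using h hs by (intro rho(2)) (auto simp: HV_def HW_def)
    then show "Bq Q y' y' \<le> \<delta>" by (simp add: k_def)
  qed
qed

subsection \<open>Continuation of signals\<close>

lemma measurable_shift: "(\<lambda>t::real. t + c) \<in> lebesgue \<rightarrow>\<^sub>M lebesgue"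
  using lebesgue_affine_measurable[of "\<lambda>_. 1" c] by (simp add: add.commute)

lemma lebesgue_distr_shift: "distr lebesgue lebesgue (\<lambda>t::real. t + c) = lebesgue"
  using lebesgue_real_affine[of 1 c] by (simp add: density_1 add.commute)

lemma lebesgue_shift:
  fixes f :: "real \<Rightarrow> 'a::euclidean_space"
  assumes f: "f \<in> borel_measurable lebesgue"
  shows "(\<lambda>t. f (t + c)) \<in> borel_measurable lebesgue"
    "integrable lebesgue (\<lambda>t. f (t + c)) \<longleftrightarrow> integrable lebesgue f"
    "(LINT t|lebesgue. f (t + c)) = (LINT t|lebesgue. f t)"
proof -
  show "(\<lambda>t. f (t + c)) \<in> borel_measurable lebesgue"
    by (rule measurable_compose[OF measurable_shift f])
  show "integrable lebesgue (\<lambda>t. f (t + c)) \<longleftrightarrow> integrable lebesgue f"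
    using integrable_distr_eq[OF measurable_shift f, of c] by (simp add: lebesgue_distr_shift)
  show "(LINT t|lebesgue. f (t + c)) = (LINT t|lebesgue. f t)"
    using integral_distr[OF measurable_shift f, of c] by (simp add: lebesgue_distr_shift)
qed

lemma sqi_iff_lebesgue:
  "sqi f \<longleftrightarrow> (\<lambda>t. indicator {0..} t *\<^sub>R f t) \<in> borel_measurable lebesgue \<and>
    integrable lebesgue (\<lambda>t. indicator {0..} t * (norm (f t))\<^sup>2)"
  by (simp add: sqi_def borel_measurable_restrict_space_iff integrable_restrict_space)

lemma sqi_advance:
  fixes u :: "real \<Rightarrow> 'a::euclidean_space"
  assumes u: "sqi u" and T: "T \<ge> 0"
  shows "sqi (\<lambda>t. u (t + T))" "nsq (\<lambda>t. u (t + T)) \<le> nsq u"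
proof -
  have m: "(\<lambda>t. indicator {0..} t *\<^sub>R u t) \<in> borel_measurable lebesgue"
    and i: "integrable lebesgue (\<lambda>t. indicator {0..} t * (norm (u t))\<^sup>2)"
    using u by (auto simp: sqi_iff_lebesgue)
  have mi: "(\<lambda>t. indicator {0..} t * (norm (u t))\<^sup>2) \<in> borel_measurable lebesgue"
    using i by (rule borel_measurable_integrable)
  have eq: "indicator {0..} t *\<^sub>R u (t + T) = indicator {0..} t *\<^sub>R (indicator {0..} (t + T) *\<^sub>R u (t + T))" for t
    using T by (auto simp: indicator_def)
  have eq2: "indicator {0..} t * (norm (u (t + T)))\<^sup>2
      = indicator {0..} t * (indicator {0..} (t + T) * (norm (u (t + T)))\<^sup>2)" for t
    using T by (auto simp: indicator_def)
  have ind: "(indicator {0..} :: real \<Rightarrow> real) \<in> borel_measurable lebesgue"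
    by (rule borel_measurable_indicator) simp
  have 1: "(\<lambda>t. indicator {0..} t *\<^sub>R u (t + T)) \<in> borel_measurable lebesgue"
    unfolding eq by (intro borel_measurable_scaleR ind lebesgue_shift(1)[OF m])
  have sh: "integrable lebesgue (\<lambda>t. indicator {0..} (t + T) * (norm (u (t + T)))\<^sup>2)"
    using i lebesgue_shift(2)[OF mi, of T] by simp
  have 2: "integrable lebesgue (\<lambda>t. indicator {0..} t * (norm (u (t + T)))\<^sup>2)"
    unfolding eq2
  proof (rule Bochner_Integration.integrable_bound[OF sh])
    show "(\<lambda>t. indicator {0..} t * (indicator {0..} (t + T) * (norm (u (t + T)))\<^sup>2)) \<in> borel_measurable lebesgue"
      by (rule borel_measurable_times[OF ind borel_measurable_integrable[OF sh]])
  qed (auto simp: indicator_def)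
  show "sqi (\<lambda>t. u (t + T))" using 1 2 by (simp add: sqi_iff_lebesgue)
  have ipe: "nsq f = (LINT t|lebesgue. indicator {0..} t * (norm (f t))\<^sup>2)" for f :: "real \<Rightarrow> 'a"
    by (simp add: ip_def integral_restrict_space power2_norm_eq_inner)
  have "(LINT t|lebesgue. indicator {0..} t * (norm (u (t + T)))\<^sup>2)
      \<le> (LINT t|lebesgue. indicator {0..} (t + T) * (norm (u (t + T)))\<^sup>2)"
    by (rule integral_mono[OF 2 sh]) (use T in \<open>auto simp: indicator_def\<close>)
  also have "\<dots> = (LINT t|lebesgue. indicator {0..} t * (norm (u t))\<^sup>2)" by (rule lebesgue_shift(3)[OF mi])
  finally show "nsq (\<lambda>t. u (t + T)) \<le> nsq u" unfolding ipe .
qed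

lemma sqi_delay:
  fixes u :: "real \<Rightarrow> 'a::euclidean_space"
  assumes u: "sqi u" and T: "T \<ge> 0"
  shows "sqi (\<lambda>t. if t < T then 0 else u (t - T))"
proof -
  have m: "(\<lambda>t. indicator {0..} t *\<^sub>R u t) \<in> borel_measurable lebesgue"
    and i: "integrable lebesgue (\<lambda>t. indicator {0..} t * (norm (u t))\<^sup>2)"
    using u by (auto simp: sqi_iff_lebesgue)
  have "(\<lambda>t. indicator {0..} t *\<^sub>R (if t < T then 0 else u (t - T))) = (\<lambda>t. indicator {0..} (t + - T) *\<^sub>R u (t + - T))"
    using T by (auto simp: indicator_def)
  moreover have "(\<lambda>t. indicator {0..} t * (norm (if t < T then 0 else u (t - T)))\<^sup>2)
      = (\<lambda>t. indicator {0..} (t + - T) * (norm (u (t + - T)))\<^sup>2)"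
    using T by (auto simp: indicator_def)
  ultimately show ?thesis
    using lebesgue_shift(1)[OF m, of "- T"] lebesgue_shift(2)[OF borel_measurable_integrable[OF i], of "- T"] i
    by (simp add: sqi_iff_lebesgue)
qed

lemma integral_delay:
  fixes g :: "real \<Rightarrow> real"
  assumes g: "integrable halfline g" and T: "T \<ge> 0"
  shows "(LINT t|halfline. (if t < T then 0 else g (t - T))) = (LINT t|halfline. g t)"
proof -
  have i: "integrable lebesgue (\<lambda>t. indicator {0..} t * g t)"
    using g by (simp add: integrable_restrict_space)
  have "(LINT t|halfline. (if t < T then 0 else g (t - T)))
      = (LINT t|lebesgue. indicator {0..} (t + - T) * g (t + - T))"
    by (subst integral_restrict_space) (use T in \<open>auto simp: indicator_def intro!: Bochner_Integration.integral_cong\<close>)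
  also have "\<dots> = (LINT t|lebesgue. indicator {0..} t * g t)"
    by (rule lebesgue_shift(3)[OF borel_measurable_integrable[OF i]])
  also have "\<dots> = (LINT t|halfline. g t)" by (simp add: integral_restrict_space)
  finally show ?thesis .
qed

lemma sqi_truncate:
  fixes u :: "real \<Rightarrow> real^'m"
  assumes u: "loc_L2 u" and T: "T \<ge> 0"
  shows "sqi (\<lambda>t. if t < T then u t else 0)"
proof -
  have m: "u \<in> borel_measurable halfline"
    using u by (simp add: loc_L2_def measurable_on_iff_borel_measurable)
  have "(\<lambda>t. (norm (u t))\<^sup>2) absolutely_integrable_on {0..T}"
    using u T by (intro nonnegative_absolutely_integrable_1) (auto simp: loc_L2_def)
  then have "(\<lambda>t. (norm (u t))\<^sup>2) absolutely_integrable_on {0..<T}"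
    by (rule set_integrable_subset) auto
  then have i: "integrable lebesgue (\<lambda>t. indicator {0..<T} t * (norm (u t))\<^sup>2)"
    by (simp add: set_integrable_def)
  have "(\<lambda>t. indicator {0..} t * (norm (if t < T then u t else 0))\<^sup>2) = (\<lambda>t. indicator {0..<T} t * (norm (u t))\<^sup>2)"
    by (auto simp: indicator_def)
  moreover have "(\<lambda>t. indicator {0..} t *\<^sub>R (if t < T then u t else 0))
      = (\<lambda>t. indicator {..<T} t *\<^sub>R (indicator {0..} t *\<^sub>R u t))"
    by (auto simp: indicator_def)
  moreover have "(\<lambda>t. indicator {..<T} t *\<^sub>R (indicator {0..} t *\<^sub>R u t)) \<in> borel_measurable lebesgue"
  proof (rule borel_measurable_scaleR)
    show "(indicator {..<T} :: real \<Rightarrow> real) \<in> borel_measurable lebesgue"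
      by (rule borel_measurable_indicator) simp
    show "(\<lambda>t. indicator {0..} t *\<^sub>R u t) \<in> borel_measurable lebesgue"
      using m by (simp add: borel_measurable_restrict_space_iff)
  qed
  ultimately show ?thesis using i by (simp add: sqi_iff_lebesgue)
qed

text \<open>A change at one instant is harmless, but needs an argument because functions are not
  identified almost everywhere.\<close>

lemma sqi_spike:
  fixes f g :: "real \<Rightarrow> 'a::euclidean_space"
  assumes "sqi g" "\<And>t. t \<noteq> a \<Longrightarrow> f t = g t"
  shows "sqi f"
proof -
  have m: "{t. t = a \<and> 0 \<le> t} \<in> sets lebesgue"
    by (rule negligible_imp_sets) (rule negligible_subset[of "{a}"], auto)
  have "integrable lebesgue (indicator {t. t = a \<and> 0 \<le> t} :: real \<Rightarrow> real)"
  proof (rule integrable_real_indicator[OF m])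
    have "{t. t = a \<and> 0 \<le> t} \<in> null_sets lebesgue"
      unfolding negligible_iff_null_sets[symmetric] by (rule negligible_subset[of "{a}"]) auto
    then show "emeasure lebesgue {t. t = a \<and> 0 \<le> t} < \<infinity>" by (simp add: null_setsD1)
  qed
  moreover have "(\<lambda>t. indicator {0..} t * (norm (indicator {a} t :: real))\<^sup>2) = indicator {t. t = a \<and> 0 \<le> t}"
    "(\<lambda>t. indicator {0..} t *\<^sub>R indicator {a} t) = (indicator {t. t = a \<and> 0 \<le> t} :: real \<Rightarrow> real)"
    by (auto simp: indicator_def)
  ultimately have "sqi (indicator {a} :: real \<Rightarrow> real)"
    unfolding sqi_iff_lebesgue using m by simp
  then have "sqi (\<lambda>t. indicator {a} t *\<^sub>R (f a - g a))"
    by (rule sqi_bounded_linear[OF bounded_linear_scaleR_left])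
  then have "sqi (g + (\<lambda>t. indicator {a} t *\<^sub>R (f a - g a)))" by (rule sqi_add[OF assms(1)])
  also have "g + (\<lambda>t. indicator {a} t *\<^sub>R (f a - g a)) = f"
  proof
    fix t show "(g + (\<lambda>t. indicator {a} t *\<^sub>R (f a - g a))) t = f t"
      using assms(2)[of t] by (cases "t = a") auto
  qed
  finally show ?thesis .
qed

text \<open>Time 0 is exempt because the value of a continued input at the switching time belongs to
  its first piece.\<close>

lemma ip_self_cong_pos:
  assumes "sqi f" "sqi g" "\<And>t. t > 0 \<Longrightarrow> f t = g t"
  shows "nsq f = nsq g"
  unfolding ip_def
proof (rule integral_cong_AE)
  show "(\<lambda>t. f t \<bullet> f t) \<in> borel_measurable halfline" "(\<lambda>t. g t \<bullet> g t) \<in> borel_measurable halfline"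
    using assms by (auto simp: sqi_def)
  have "{0::real} \<in> null_sets lebesgue" by (simp add: negligible_iff_null_sets[symmetric])
  then have "AE t in lebesgue. t \<notin> {0::real}" by (rule AE_not_in)
  then show "AE t in halfline. f t \<bullet> f t = g t \<bullet> g t"
    by (subst AE_restrict_space_iff) (use assms(3) in \<open>auto elim!: eventually_mono simp: less_le\<close>)
qed

lemma solves_state_at_0:
  assumes "solves_state A B1 B2 \<xi> v w x"
  shows "x 0 = \<xi>"
proof -
  have "((\<lambda>s. A *v x s + B1 *v v s + B2 *v w s) has_integral (x 0 - \<xi>)) {0}"
    using assms by (auto simp: solves_state_def dest!: spec[of _ 0])
  then have "x 0 - \<xi> = 0" by (rule has_integral_unique[OF _ has_integral_refl(2)])
  then show ?thesis by simp
qed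

lemma solves_state_concat:
  assumes T: "T \<ge> 0" and x: "solves_state A B1 B2 x0 v w x"
    and v: "\<And>t. t \<in> {0..T} \<Longrightarrow> v' t = v t" "\<And>t. t \<in> {0..T} \<Longrightarrow> w' t = w t"
    and y: "solves_state A B1 B2 (x T) (\<lambda>t. v' (t + T)) (\<lambda>t. w' (t + T)) y"
  shows "solves_state A B1 B2 x0 v' w' (\<lambda>t. if t < T then x t else y (t - T))"
proof -
  define z where "z t = (if t < T then x t else y (t - T))" for t
  \<comment> \<open>The pieces meet: \<open>y\<close> starts at \<open>x T\<close>, so the second
    branch also gives \<open>x\<close> at time T.\<close>
  have zx: "z t = x t" if "t \<le> T" for t
    using that solves_state_at_0[OF y] by (cases "t = T") (auto simp: z_def)
  have zy: "z (t + T) = y t" if "t \<ge> 0" for t using that by (simp add: z_def)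
  define g where "g t = A *v z t + B1 *v v' t + B2 *v w' t" for t
  have 1: "(g has_integral (x t - x0)) {0..t}" if t: "0 \<le> t" "t \<le> T" for t
  proof -
    have "((\<lambda>s. A *v x s + B1 *v v s + B2 *v w s) has_integral (x t - x0)) {0..t}"
      using x t by (simp add: solves_state_def)
    then show ?thesis
      by (rule has_integral_eq[rotated]) (use t v zx in \<open>auto simp: g_def\<close>)
  qed
  have "(g has_integral (z t - x0)) {0..t}" if t: "t \<ge> 0" for t
  proof (cases "t \<le> T")
    case True
    then show ?thesis using 1[OF t True] zx[OF True] by simp
  next
    case False
    have "((\<lambda>s. A *v y s + B1 *v v' (s + T) + B2 *v w' (s + T)) has_integral (y (t - T) - x T)) {0..t - T}"
      using y False by (simp add: solves_state_def)
    then have "(g \<circ> (+) T has_integral (y (t - T) - x T)) {0..t - T}"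
      by (rule has_integral_eq[rotated]) (auto simp: g_def o_def zy[symmetric] add.commute)
    then have "(g has_integral (y (t - T) - x T)) {0 + T..t - T + T}"
      by (simp only: has_integral_shift_Icc_real)
    then have "(g has_integral (y (t - T) - x T)) {T..t}" by simp
    with 1[OF T order_refl] have "(g has_integral (x T - x0 + (y (t - T) - x T))) {0..t}"
      using T False by (intro has_integral_combine[of 0 T t]) auto
    then show ?thesis using False by (simp add: z_def)
  qed
  then show ?thesis by (simp add: solves_state_def g_def[abs_def] z_def[abs_def])
qed

theorem theorem2p4:
  fixes A :: "real^'n^'n" and B1 :: "real^'k^'n" and B2 :: "real^'q^'n"
    and Q :: "real^('n + ('k + 'q))^('n + ('k + 'q))" and X0 :: "(real^'n) set"
    and \<Delta> :: "((real \<Rightarrow> real^'k) \<times> (real \<Rightarrow> real^'q)) set"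
  assumes hurwitz: "hurwitz A"
    and Qsym: "transpose Q = Q"
    and Delta_sub: "\<forall>(v, w) \<in> \<Delta>. loc_L2 v \<and> loc_L2 w"
    and wcs: "weakly_causally_stable \<Delta>"
    and ciqc: "conditional_IQC \<Delta> A B1 B2 Q X0"
    and a: "\<exists>\<epsilon>>0. \<exists>s0. Re s0 = 0 \<and>
              (\<forall>s. Re s = 0 \<longrightarrow> cpsd (blk_eps \<epsilon> (PiQ A B1 B2 Q s))) \<and>
              cpd (blk11 (PiQ A B1 B2 Q s0)) \<and> cpd (- blk22 (PiQ A B1 B2 Q s0))"
    and b: "\<exists>(C :: real^'n^'k) (D1 :: real^'k^'k) (D2 :: real^'q^'k).
              (\<forall>x v w. sigma_Q Q x v w \<le> (norm (C *v x + D1 *v v + D2 *v w))\<^sup>2) \<and>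
              (\<forall>s::complex. Re s > 0 \<longrightarrow> det (sysmat A B1 C D1 s) \<noteq> 0)"
  shows "complete_IQC \<Delta> A B1 B2 Q X0"
proof -
  obtain \<epsilon> s0 where eps: "\<epsilon> > 0" and s0: "Re s0 = 0" "cpd (- blk22 (PiQ A B1 B2 Q s0))"
    and fdi: "\<And>s. Re s = 0 \<Longrightarrow> cpsd (blk_eps \<epsilon> (PiQ A B1 B2 Q s))"
    using a by metis
  obtain C :: "real^'n^'k" and D1 :: "real^'k^'k" and D2 :: "real^'q^'k" where
    out: "\<And>x v w. sigma_Q Q x v w \<le> (norm (C *v x + D1 *v v + D2 *v w))\<^sup>2"
    and min_phase: "\<And>s. Re s > 0 \<Longrightarrow> det (sysmat A B1 C D1 s) \<noteq> 0"
    using b by metis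
  obtain \<kappa> :: "(real^'n) \<times> (real^'k) \<times> (real^'q) \<Rightarrow> real" where cont: "continuous_on UNIV \<kappa>"
    and kappa: "\<forall>v w x0 x. (v, w) \<in> \<Delta> \<and> L2 v \<and> L2 w \<and> x0 \<in> X0 \<and> solves_state A B1 B2 x0 v w x \<longrightarrow>
         integral {0..} (\<lambda>t. sigma_Q Q (x t) (v t) (w t)) \<ge> - \<kappa> (x0, v 0, w 0)"
    using ciqc unfolding conditional_IQC_def by (elim exE conjE)
  have int_sigma: "integrable halfline (\<lambda>t. sigma_Q Q (xp y t) (vp y t) (wp y t))" if "sqi y"
    for y :: "real \<Rightarrow> (real^'n) \<times> (real^'k) \<times> (real^'q)"
    using integrable_inner[OF sqi_stk[OF that] sqi_Q_stk[OF that], of Q]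
    by (simp add: sigma_Q_def stk_def xp_def vp_def wp_def)
  have sigma0: "sigma_Q Q 0 0 0 = 0"
  proof -
    have "stack3 0 0 0 = (0 :: real^('n + ('k + 'q)))"
      by (auto simp: vec_eq_iff stack3_def split: sum.splits)
    then show ?thesis by (simp add: sigma_Q_def)
  qed
  have "integral {0..T} (\<lambda>t. sigma_Q Q (x t) (v t) (w t)) \<ge> - \<kappa> (x0, v 0, w 0)"
    if T: "T \<ge> 0" and vw: "(v, w) \<in> \<Delta>" and x0: "x0 \<in> X0" and lx: "loc_L2 x"
      and sx: "solves_state A B1 B2 x0 v w x" for T v w x0 x
  \<comment> \<open>Each positive \<delta> will bound the cost after T from above, so
    \<open>\<kappa>\<close> itself works in the limit.\<close>
  proof (rule field_le_epsilon)
    fix \<delta> :: real assume d: "\<delta> > 0"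
    have lv: "loc_L2 v" and lw: "loc_L2 w" using Delta_sub vw by auto
    obtain vo \<rho> where vo: "sqi vo" "\<rho> > 0"
      "\<And>y. traj A B1 B2 (x T) y \<Longrightarrow> nsq (vp y - vo) < \<rho> \<Longrightarrow> Bq Q y y \<le> \<delta>"
      by (rule game[OF hurwitz Qsym eps fdi s0 out min_phase d, where \<xi> = "x T"]) (assumption | rule that)+
    \<comment> \<open>At t = T the value is \<open>v T\<close>, since weak causal stability asks for
      agreement on the closed interval; the sum of truncation and delay below may differ at this one
      instant.\<close>
    define vs where "vs t = (if t \<le> T then v t else vo (t - T))" for t
    have svs: "sqi vs"
    proof (rule sqi_spike)
      show "sqi ((\<lambda>t. if t < T then v t else 0) + (\<lambda>t. if t < T then 0 else vo (t - T)))"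
        by (intro sqi_add sqi_truncate[OF lv T] sqi_delay[OF vo(1) T])
      show "vs t = ((\<lambda>t. if t < T then v t else 0) + (\<lambda>t. if t < T then 0 else vo (t - T))) t" if "t \<noteq> T" for t
        using that by (simp add: vs_def)
    qed
    obtain seq :: "nat \<Rightarrow> (real \<Rightarrow> real^'k) \<times> (real \<Rightarrow> real^'q)" where
      seq: "\<And>i. seq i \<in> \<Delta> \<and> L2 (fst (seq i)) \<and> L2 (snd (seq i)) \<and>
               (\<forall>t\<in>{0..T}. fst (seq i) t = v t \<and> snd (seq i) t = w t)"
      and lim: "(\<lambda>i. L2norm (\<lambda>t. fst (seq i) t - vs t)) \<longlonglongrightarrow> 0"
      using wcs[unfolded weakly_causally_stable_def, rule_format, OF T, of v w vs] vw svs
      by (auto simp: L2_iff_sqi vs_def)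
    have "eventually (\<lambda>i. L2norm (\<lambda>t. fst (seq i) t - vs t) < sqrt \<rho>) sequentially"
      using lim vo(2) by (intro order_tendstoD(2)) auto
    then obtain i where i: "L2norm (\<lambda>t. fst (seq i) t - vs t) < sqrt \<rho>"
      by (auto simp: eventually_sequentially)
    define v' where "v' = fst (seq i)"
    define w' where "w' = snd (seq i)"
    have vw': "(v', w') \<in> \<Delta>" "sqi v'" "sqi w'" using seq[of i] by (auto simp: v'_def w'_def L2_iff_sqi)
    have agree: "v' t = v t" "w' t = w t" if "t \<in> {0..T}" for t using seq[of i] that by (auto simp: v'_def w'_def)
    have close: "nsq (v' - vs) < \<rho>"
    proof -
      have "L2norm (v' - vs) < sqrt \<rho>" using i by (simp add: v'_def fun_diff_def)
      then show ?thesis using L2norm_eq_ip[OF sqi_diff[OF vw'(2) svs]] by simp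
    qed
    define va where "va t = v' (t + T)" for t
    define wa where "wa t = w' (t + T)" for t
    have sa: "sqi va" "sqi wa" unfolding va_def wa_def by (intro sqi_advance vw' T)+
    obtain xa where xa: "traj A B1 B2 (x T) (trip xa va wa)" using traj_exists[OF hurwitz sa] by blast
    \<comment> \<open>The two tails can differ only at their time 0, where \<open>vs\<close> carries
      \<open>v T\<close> instead of \<open>vo 0\<close>.\<close>
    have "nsq (va - vo) = nsq (\<lambda>t. (v' - vs) (t + T))"
      by (rule ip_self_cong_pos)
        (use sa vo(1) sqi_advance(1)[OF sqi_diff[OF vw'(2) svs] T] T in \<open>auto simp: sqi_diff va_def vs_def\<close>)
    also have "\<dots> < \<rho>" using sqi_advance(2)[OF sqi_diff[OF vw'(2) svs] T] close by linarith
    finally have tail: "Bq Q (trip xa va wa) (trip xa va wa) \<le> \<delta>" using vo(3)[OF xa] by simp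
    define xi where "xi t = (if t < T then x t else xa (t - T))" for t
    have sxa: "solves_state A B1 B2 (x T) va wa xa" using xa by (simp add: traj_def)
    have si: "solves_state A B1 B2 x0 v' w' xi"
      unfolding xi_def using sxa agree unfolding va_def wa_def by (intro solves_state_concat[OF T sx]) auto
    \<comment> \<open>Both pieces are extended by zero to square-integrable functions on the whole
      half-line. As sigma vanishes at zero, the integral splits without mixed terms.\<close>
    define y1 where "y1 = trip (\<lambda>t. if t < T then x t else 0) (\<lambda>t. if t < T then v t else 0) (\<lambda>t. if t < T then w t else 0)"
    define y2 where "y2 t = (if t < T then 0 else trip xa va wa (t - T))" for t
    have s1: "sqi y1" unfolding y1_def sqi_trip_iff by (intro conjI sqi_truncate lx lv lw T)
    have s2: "sqi y2" unfolding y2_def by (rule sqi_delay[OF traj_sqi[OF xa] T])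
    let ?\<sigma> = "\<lambda>y t. sigma_Q Q (xp y t) (vp y t) (wp y t)"
    have split: "sigma_Q Q (xi t) (v' t) (w' t) = ?\<sigma> y1 t + ?\<sigma> y2 t" if "t \<ge> 0" for t
    proof (cases "t < T")
      case True
      then show ?thesis using agree[of t] that
        by (simp add: xi_def y1_def y2_def xp_def vp_def wp_def trip_def sigma0)
    next
      case False
      then show ?thesis
        by (simp add: xi_def y1_def y2_def xp_def vp_def wp_def trip_def sigma0 va_def wa_def)
    qed
    \<comment> \<open>The closed interval of agreement contains 0 even if T = 0, so
      \<open>\<kappa>\<close> sees the same initial values.\<close>
    have "- \<kappa> (x0, v 0, w 0) = - \<kappa> (x0, v' 0, w' 0)" using agree[of 0] T by simp
    also have "\<dots> \<le> integral {0..} (\<lambda>t. sigma_Q Q (xi t) (v' t) (w' t))"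
      using vw' by (intro kappa[rule_format] conjI x0 si) (simp_all add: L2_iff_sqi)
    also have "\<dots> = integral {0..} (\<lambda>t. ?\<sigma> y1 t + ?\<sigma> y2 t)"
      by (rule Henstock_Kurzweil_Integration.integral_cong) (use split in auto)
    also have "\<dots> = (LINT t|halfline. ?\<sigma> y1 t + ?\<sigma> y2 t)"
      by (rule lebesgue_integral_eq_integral[symmetric]) (use int_sigma[OF s1] int_sigma[OF s2] in auto)
    also have "\<dots> = (LINT t|halfline. ?\<sigma> y1 t) + (LINT t|halfline. ?\<sigma> y2 t)"
      by (rule Bochner_Integration.integral_add[OF int_sigma[OF s1] int_sigma[OF s2]])
    also have "(LINT t|halfline. ?\<sigma> y2 t) = Bq Q (trip xa va wa) (trip xa va wa)"
    proof -
      have "?\<sigma> y2 t = (if t < T then 0 else ?\<sigma> (trip xa va wa) (t - T))" for t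
        by (simp add: y2_def xp_def vp_def wp_def trip_def sigma0)
      then show ?thesis
        unfolding Bq_eq_integral using integral_delay[OF int_sigma[OF traj_sqi[OF xa]] T] by simp
    qed
    also have "(LINT t|halfline. ?\<sigma> y1 t) = integral {0..T} (\<lambda>t. sigma_Q Q (x t) (v t) (w t))"
    proof -
      have "(LINT t|halfline. ?\<sigma> y1 t) = integral {0..} (?\<sigma> y1)"
        by (rule lebesgue_integral_eq_integral[OF int_sigma[OF s1]]) simp
      also have "\<dots> = integral {0..T} (?\<sigma> y1)"
      proof -
        have "integral {0..} (?\<sigma> y1) = integral {0..} (\<lambda>t. if t \<in> {0..T} then ?\<sigma> y1 t else 0)"
          by (rule Henstock_Kurzweil_Integration.integral_cong)
            (auto simp: y1_def xp_def vp_def wp_def trip_def sigma0)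
        also have "\<dots> = integral ({0..T} \<inter> {0..}) (?\<sigma> y1)" by (rule integral_restrict_Int)
        also have "{0..T} \<inter> {0..} = {0..T}" by auto
        finally show ?thesis .
      qed
      also have "\<dots> = integral {0..T} (\<lambda>t. sigma_Q Q (x t) (v t) (w t))"
        by (rule integral_spike[of "{T}"]) (auto simp: y1_def xp_def vp_def wp_def trip_def)
      finally show ?thesis .
    qed
    finally show "- \<kappa> (x0, v 0, w 0) \<le> integral {0..T} (\<lambda>t. sigma_Q Q (x t) (v t) (w t)) + \<delta>"
      using tail by linarith
  qed
  with cont show ?thesis unfolding complete_IQC_def by blast
qed

end
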